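(* For every distance monoid $\mathfrak{M}=(M,\oplus,\preceq,0)$, the class $\overrightarrow{\mathcal{M}}_{\mathfrak{M}}$ of all convexly ordered finite $\mathfrak{M}$-metric spaces is a Ramsey class.
   Context: A distance monoid is a structure $\mathfrak{M}=(M,\oplus,\preceq,0)$ such that (1) $(M,\oplus,0)$ is a commutative monoid with identity $0$; (2) $\preceq$ is a linear order on $M$ with least element $0$; (3) for all $a,b,c,d\in M$, if $a\preceq c$ and $b\preceq d$ then $a\oplus b\preceq c\oplus d$. Write $n\times r$ for the sum $r\oplus\cdots\oplus r$ of length $n$. A distance monoid is archimedean if for all $r,s\in M$ with $r,s\neq 0$ there is an integer $n>0$ with $s\preceq n\times r$. An $\mathfrak{M}$-metric space is a set $A$ with a function $d:A\times A\to M$ such that for all $a,b,c\in A$: $d(a,b)=0$ iff $a=b$; $d(a,b)=d(b,a)$; and $d(a,c)\preceq d(a,b)\oplus d(b,c)$. A block of $\mathfrak{M}$ is a subset $\mathcal{B}\subseteq M$ such that either $\mathcal{B}=\{0\}$, or $0\notin\mathcal{B}$ and $\{0\}\cup\mathcal{B}$ induces a maximal (under inclusion) archimedean submonoid of $\mathfrak{M}$. In an $\mathfrak{M}$-metric space $(A,d)$ and for a block $\mathcal{B}$, the block equivalence $\sim_{\mathcal{B}}$ is defined by $u\sim_{\mathcal{B}}v$ iff there is $a\in\mathcal{B}$ with $d(u,v)\preceq a$ (this is an equivalence relation). A convexly ordered $\mathfrak{M}$-metric space is a triple $(A,d,\leq)$ where $(A,d)$ is an $\mathfrak{M}$-metric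 space and $\leq$ is a linear order on $A$ such that for every block $\mathcal{B}$ of $\mathfrak{M}$ and all $a,b,c\in A$ with $a\sim_{\mathcal{B}}b$ and $a\not\sim_{\mathcal{B}}c$ one has $a\leq c$ if and only if $b\leq c$ (i.e. every equivalence class of $\sim_{\mathcal{B}}$ is an interval of $\leq$). Substructures of $(A,d,\le)$ are subsets of $A$ with the restricted $d$ and $\leq$; isomorphisms are bijections preserving both $d$ and $\leq$. For structures $\mathbf{A},\mathbf{B}$, let $\binom{\mathbf{B}}{\mathbf{A}}$ be the set of all substructures of $\mathbf{B}$ isomorphic to $\mathbf{A}$. A class $\mathcal{C}$ of structures is a Ramsey class if for all $\mathbf{A},\mathbf{B}\in\mathcal{C}$ and every positive integer $k$ there is $\mathbf{C}\in\mathcal{C}$ such that for every partition of $\binom{\mathbf{C}}{\mathbf{A}}$ into $k$ classes there is $\widetilde{\mathbf{B}}\in\binom{\mathbf{C}}{\mathbf{B}}$ such that $\binom{\widetilde{\mathbf{B}}}{\mathbf{A}}$ is contained in one class of the partition. *)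

theory Defs
  imports "HOL-Library.Infinite_Typeclass" "HOL-Library.Disjoint_Sets"
begin

(* Compatibility of the sum with the order is inherited from
   ordered_comm_monoid_add as translation invariance (add_left_mono); for a
   commutative operation and a transitive order this amounts to
   a \<le> c \<Longrightarrow> b \<le> d \<Longrightarrow> a + b \<le> c + d, which is the library fact add_mono. *)
class distance_monoid = ordered_comm_monoid_add + linorder +
  assumes zero_least: "0 \<le> a"

definition nsum :: "nat \<Rightarrow> 'm::distance_monoid \<Rightarrow> 'm" where
  "nsum n r = (\<Sum>i<n. r)"

definition archimedean_submonoid :: "'m::distance_monoid set \<Rightarrow> bool" where
  "archimedean_submonoid S \<longleftrightarrow>
     0 \<in> S \<and> (\<forall>r\<in>S. \<forall>s\<in>S. r + s \<in> S) \<and>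
     (\<forall>r\<in>S. \<forall>s\<in>S. r \<noteq> 0 \<longrightarrow> s \<noteq> 0 \<longrightarrow> (\<exists>n>0. s \<le> nsum n r))"

definition maximal_archimedean_submonoid :: "'m::distance_monoid set \<Rightarrow> bool" where
  "maximal_archimedean_submonoid S \<longleftrightarrow>
     archimedean_submonoid S \<and> (\<forall>T. archimedean_submonoid T \<longrightarrow> S \<subseteq> T \<longrightarrow> T = S)"

definition block :: "'m::distance_monoid set \<Rightarrow> bool" where
  "block B \<longleftrightarrow> B = {0} \<or> (0 \<notin> B \<and> maximal_archimedean_submonoid (insert 0 B))"

definition metric_on :: "'a set \<Rightarrow> ('a \<Rightarrow> 'a \<Rightarrow> 'm::distance_monoid) \<Rightarrow> bool" where
  "metric_on A d \<longleftrightarrow>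
     (\<forall>a\<in>A. \<forall>b\<in>A. d a b = 0 \<longleftrightarrow> a = b) \<and>
     (\<forall>a\<in>A. \<forall>b\<in>A. d a b = d b a) \<and>
     (\<forall>a\<in>A. \<forall>b\<in>A. \<forall>c\<in>A. d a c \<le> d a b + d b c)"

definition block_equiv ::
  "('a \<Rightarrow> 'a \<Rightarrow> 'm::distance_monoid) \<Rightarrow> 'm set \<Rightarrow> 'a \<Rightarrow> 'a \<Rightarrow> bool" where
  "block_equiv d B u v \<longleftrightarrow> (\<exists>a\<in>B. d u v \<le> a)"

(* Only the values of mdist on points \<times> points are meaningful; all notions
   below ignore the others. *)
record ('a, 'm) ordered_space =
  points :: "'a set"
  mdist :: "'a \<Rightarrow> 'a \<Rightarrow> 'm"
  ordering :: "('a \<times> 'a) set"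

definition convexly_ordered_metric_space ::
  "('a, 'm::distance_monoid) ordered_space \<Rightarrow> bool" where
  "convexly_ordered_metric_space X \<longleftrightarrow>
     metric_on (points X) (mdist X) \<and>
     linear_order_on (points X) (ordering X) \<and>
     (\<forall>B. block B \<longrightarrow>
       (\<forall>a\<in>points X. \<forall>b\<in>points X. \<forall>c\<in>points X.
          block_equiv (mdist X) B a b \<longrightarrow> \<not> block_equiv (mdist X) B a c \<longrightarrow>
          ((a, c) \<in> ordering X \<longleftrightarrow> (b, c) \<in> ordering X)))"

definition induced ::
  "('a, 'm) ordered_space \<Rightarrow> 'a set \<Rightarrow> ('a, 'm) ordered_space" where
  "induced X S = \<lparr>points = S, mdist = mdist X, ordering = Restr (ordering X) S\<rparr>"

definition isomorphic ::
  "('a, 'm) ordered_space \<Rightarrow> ('a, 'm) ordered_space \<Rightarrow> bool" where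
  "isomorphic X Y \<longleftrightarrow>
     (\<exists>f. bij_betw f (points X) (points Y) \<and>
        (\<forall>x\<in>points X. \<forall>y\<in>points X.
           mdist Y (f x) (f y) = mdist X x y \<and>
           ((f x, f y) \<in> ordering Y \<longleftrightarrow> (x, y) \<in> ordering X)))"

definition copies ::
  "('a, 'm) ordered_space \<Rightarrow> ('a, 'm) ordered_space \<Rightarrow> ('a, 'm) ordered_space set" where
  "copies B A = {induced B S |S. S \<subseteq> points B \<and> isomorphic (induced B S) A}"

(* P 0, ..., P (k - 1) is a partition into k labelled classes, some of which
   may be empty.  Demanding nonempty classes would make the property vacuous
   for every C with fewer than k copies of A. *)
definition ramsey_class :: "('a, 'm) ordered_space set \<Rightarrow> bool" where
  "ramsey_class K \<longleftrightarrow>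
     (\<forall>A\<in>K. \<forall>B\<in>K. \<forall>k::nat. k > 0 \<longrightarrow>
       (\<exists>C\<in>K. \<forall>P::nat \<Rightarrow> ('a, 'm) ordered_space set.
          (\<Union>i<k. P i) = copies C A \<longrightarrow> disjoint_family_on P {..<k} \<longrightarrow>
          (\<exists>B'\<in>copies C B. \<exists>i<k. copies B' A \<subseteq> P i)))"

(* The points are drawn from an arbitrary infinite type 'a, so every finite
   structure has an isomorphic copy in the class. *)
definition finite_convexly_ordered_spaces ::
  "('a::infinite, 'm::distance_monoid) ordered_space set" where
  "finite_convexly_ordered_spaces =
     {X. finite (points X) \<and> convexly_ordered_metric_space X}"

end

theory Submission
  imports Defs Complex_Main "HOL-Library.FuncSet"
begin

text \<open>
The proof turns points into words, so that the Ramsey property becomes an instance of the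
Graham-Rothschild theorem for parameter words over the empty alphabet, which is the finite dual
Ramsey theorem for rigid surjections.

Fix \<open>A\<close> and \<open>B\<close>. The submonoid \<open>W\<close> generated by the distances of \<open>B\<close> is well-ordered by \<open>\<le>\<close>
(Dickson's lemma). Hence every \<open>t\<close> in \<open>W\<close> has for each \<open>e\<close> a least \<open>s\<close> in \<open>W\<close> with \<open>t \<le> s + e\<close>, a
substitute for \<open>t - e\<close>, and there is a finite set \<open>\<Sigma>\<close> of letters that contains the distances of
\<open>B\<close> and is closed under these residuals. With the distance given by the larger of the two residuals
of a pair, \<open>\<Sigma>\<close> is itself a convexly ordered space, and so is every power \<open>\<Sigma>^n\<close> with the sup
distance and an order that compares words at the first coordinate in which they differ by as much,
up to multiples, as they do altogether.

List all Lipschitz functions \<open>B \<Rightarrow> \<Sigma>\<close> as \<open>h\<^sub>0, h\<^sub>1, ...\<close>, and let \<open>m\<close> be their number. As in the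
Kuratowski embedding, the map that sends \<open>x\<close> to the word of all values \<open>h\<^sub>j x\<close> is isometric, and it
stays so if the coordinates are repeated along a surjection \<open>u\<close> of \<open>n\<close> onto \<open>m\<close>. Along an embedding
\<open>f\<close> of \<open>A\<close> in \<open>B\<close> every \<open>h\<^sub>j\<close> restricts to a Lipschitz function on \<open>A\<close>; if these are listed too,
restriction becomes a map \<open>v\<close> from \<open>m\<close> to indices of functions on \<open>A\<close>, and the copy \<open>f A\<close> inside the
copy of \<open>B\<close> given by \<open>u\<close> is the copy of \<open>A\<close> given by \<open>v \<circ> u\<close>. So if every such \<open>v\<close> is a rigid
surjection, colour a rigid surjection by the class of the copy of \<open>A\<close> that it gives: the dual Ramsey
theorem provides \<open>u\<close>.

Everything rests on the order in which the functions are listed. It has to make restriction rigid and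
the coordinate map increasing, and this is where the convexity of the orders is used. Functions are
compared by their level sets from the highest level downwards, and level sets by their first
difference along the space. Each function on \<open>A\<close> has a pointwise least Lipschitz extension, which is
then its first extension in the list (lemma \<open>least_ext_not_after\<close>); by convexity, extension is
increasing (lemma \<open>least_ext_peak_less\<close>), so restriction is rigid. Also by convexity, the first
function in the list that separates two points at the scale of their distance separates them in the
right direction (lemma \<open>first_far_coordinate_increasing\<close>).
\<close>

section \<open>Parameter words\<close>

text \<open>
Alphabets are initial segments of the natural numbers and grow along the word: letters below \<open>a\<close> are
available, and the letter \<open>a\<close> itself introduces the next parameter. For \<open>a = 0\<close> these words are the
rigid surjections onto \<open>{..<b}\<close>, that is, the surjections whose values make their first appearance in
increasing order. Letting the alphabet grow makes a parameter a constant for the rest of the word, which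
is the form of the induction in the Graham-Rothschild theorem.
\<close>

fun param_word :: "nat \<Rightarrow> nat \<Rightarrow> nat list \<Rightarrow> bool" where
  "param_word a b [] \<longleftrightarrow> a = b"
| "param_word a b (x # w) \<longleftrightarrow> (x < a \<and> param_word a b w) \<or> (x = a \<and> param_word (Suc a) b w)"

text \<open>
Substitution of \<open>v\<close> for the parameters. For \<open>a = 0\<close> this is the composition of surjections.
\<close>

definition act :: "nat \<Rightarrow> nat list \<Rightarrow> nat list \<Rightarrow> nat list" where
  "act a v u = map ((!) ([0..<a] @ v)) u"

lemma param_word_le: "param_word a b w \<Longrightarrow> a \<le> b"
  by (induction w arbitrary: a) (auto dest: Suc_leD)

lemma param_word_letters: "param_word a b w \<Longrightarrow> set w \<subseteq> {..<b}"
proof (induction w arbitrary: a)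
  case (Cons x w)
  then show ?case using param_word_le[of a b w] param_word_le[of "Suc a" b w] by auto
qed simp

lemma param_word_const_iff: "param_word a a w \<longleftrightarrow> set w \<subseteq> {..<a}"
  by (induction w) (auto dest: param_word_le)

lemma param_word_append:
  "param_word a b (u @ w) \<longleftrightarrow> (\<exists>c. param_word a c u \<and> param_word c b w)"
  by (induction u arbitrary: a) auto

lemma param_word_params: "param_word a (a + n) [a..<a + n]"
proof (induction n arbitrary: a)
  case (Suc n)
  have "[a..<a + Suc n] = a # [Suc a..<Suc a + n]" by (simp add: upt_rec)
  then show ?case using Suc[of "Suc a"] by simp
qed simp

text \<open>
The letters in \<open>s\<close> replace those available at the start and the letters in \<open>t\<close> those still to be
introduced. Cutting the list of values at the current size of the alphabet is what lets the induction
move one letter from \<open>t\<close> to \<open>s\<close> whenever \<open>u\<close> introduces a parameter.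
\<close>

lemma param_word_subst:
  assumes "param_word a b u" "length s = a" "a + length t = b" "set s \<subseteq> {..<c}" "param_word c e t"
  shows "param_word c e (map ((!) (s @ t)) u)"
  using assms
proof (induction u arbitrary: a s t c)
  case Nil
  then show ?case by simp
next
  case (Cons x u)
  from Cons.prems(1) consider (const) "x < a" "param_word a b u" | (new) "x = a" "param_word (Suc a) b u"
    by auto
  then show ?case
  proof cases
    case const
    have "(s @ t) ! x \<in> set s" using const Cons.prems(2) by (simp add: nth_append)
    moreover have "param_word c e (map ((!) (s @ t)) u)"
      using Cons.IH[OF const(2) Cons.prems(2-5)] .
    ultimately show ?thesis using Cons.prems(4) by auto
  next
    case new
    have "Suc a \<le> b" using new param_word_le by blast
    then obtain y t' where t: "t = y # t'" using Cons.prems(3) by (cases t) auto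
    have xy: "(s @ t) ! x = y" using new Cons.prems(2) t by (simp add: nth_append)
    have st: "s @ t = (s @ [y]) @ t'" using t by simp
    from Cons.prems(5) t consider "y < c" "param_word c e t'" | "y = c" "param_word (Suc c) e t'" by auto
    then show ?thesis
    proof cases
      case 1
      have "param_word c e (map ((!) ((s @ [y]) @ t')) u)"
        by (rule Cons.IH[OF new(2)]) (use Cons.prems t 1 in auto)
      then show ?thesis using 1 xy st by simp
    next
      case 2
      have "param_word (Suc c) e (map ((!) ((s @ [y]) @ t')) u)"
        by (rule Cons.IH[OF new(2)]) (use Cons.prems t 2 in \<open>auto simp: subset_eq less_Suc_eq\<close>)
      then show ?thesis using 2 xy st by simp
    qed
  qed
qed

lemma length_act [simp]: "length (act a v u) = length u"
  by (simp add: act_def)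

lemma act_append: "act a v (u @ w) = act a v u @ act a v w"
  by (simp add: act_def)

lemma act_Nil [simp]: "act a v [] = []"
  by (simp add: act_def)

lemma act_Cons: "act a v (x # u) = (if x < a then x else v ! (x - a)) # act a v u"
  by (simp add: act_def nth_append)

lemma act_take:
  "set u \<subseteq> {..<a + length v} \<Longrightarrow> act a (v @ w) u = act a v u"
  by (auto simp: act_def nth_append)

lemma param_word_act:
  assumes "param_word a (a + length v) u" "param_word a c v"
  shows "param_word a c (act a v u)"
  unfolding act_def by (rule param_word_subst[OF assms(1)]) (use assms(2) in auto)

lemma act_act:
  assumes "set u \<subseteq> {..<a + length v}"
  shows "act a w (act a v u) = act a (act a w v) u"
  using assms by (auto simp: act_def nth_append)

lemma set_act_consts:
  assumes "set u \<subseteq> {..<a + length v}" "set v \<subseteq> {..<a}"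
  shows "set (act a v u) \<subseteq> {..<a}"
proof -
  have "v ! (x - a) < a" if "x \<in> set u" "\<not> x < a" for x
  proof -
    have "x - a < length v" using that assms(1) by fastforce
    then show ?thesis using assms(2) nth_mem by blast
  qed
  then show ?thesis by (auto simp: act_def nth_append)
qed

definition before :: "nat \<Rightarrow> nat list \<Rightarrow> nat list" where
  "before x w = takeWhile (\<lambda>y. y \<noteq> x) w"

lemma before_unique:
  "set u \<subseteq> {..<x} \<Longrightarrow> before x (u @ x # w) = u"
  unfolding before_def by (subst takeWhile_append2) auto

lemma param_word_split:
  assumes "param_word a b w" "a \<le> x" "x < b"
  obtains w' where "w = before x w @ x # w'" "param_word a x (before x w)" "param_word (Suc x) b w'"
proof -
  have "\<exists>u w'. w = u @ x # w' \<and> param_word a x u \<and> param_word (Suc x) b w'"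
    using assms
  proof (induction w arbitrary: a)
    case Nil
    then show ?case by simp
  next
    case (Cons y w)
    from Cons.prems(1) consider (const) "y < a" "param_word a b w" | (new) "y = a" "param_word (Suc a) b w"
      by auto
    then show ?case
    proof cases
      case const
      then obtain u w' where "w = u @ x # w'" "param_word a x u" "param_word (Suc x) b w'"
        using Cons.IH Cons.prems by blast
      then show ?thesis using const by (intro exI[of _ "y # u"] exI[of _ w']) auto
    next
      case new
      show ?thesis
      proof (cases "x = a")
        case True
        then show ?thesis using new by (intro exI[of _ "[]"] exI[of _ w]) auto
      next
        case False
        then obtain u w' where "w = u @ x # w'" "param_word (Suc a) x u" "param_word (Suc x) b w'"
          using Cons.IH[OF new(2)] Cons.prems by auto
        then show ?thesis using new by (intro exI[of _ "y # u"] exI[of _ w']) auto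
      qed
    qed
  qed
  then obtain u w' where w: "w = u @ x # w'" and u: "param_word a x u" and w': "param_word (Suc x) b w'"
    by blast
  have "before x w = u" using before_unique[of u x w'] param_word_letters[OF u] w by simp
  then show thesis using that w u w' by simp
qed

lemma act_params: "act a (v @ w) [a..<a + length v] = v"
  unfolding act_def by (rule nth_equalityI) (auto simp: nth_append)

lemma param_word_all_letters: "param_word a b w \<Longrightarrow> {a..<b} \<subseteq> set w"
proof (induction w arbitrary: a)
  case (Cons x w)
  from Cons.prems consider "x < a" "param_word a b w" | "x = a" "param_word (Suc a) b w" by auto
  then show ?case
  proof cases
    case 1
    then show ?thesis using Cons.IH[OF 1(2)] by auto
  next
    case 2
    have "{a..<b} \<subseteq> insert a {Suc a..<b}" by auto
    then show ?thesis using Cons.IH[OF 2(2)] 2(1) by auto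
  qed
qed simp

lemma param_wordI:
  assumes "a \<le> b" "set w \<subseteq> {..<b}" "\<And>i. a \<le> i \<Longrightarrow> i < b \<Longrightarrow> i \<in> set w"
    "\<And>l i. l < length w \<Longrightarrow> a \<le> i \<Longrightarrow> i < w ! l \<Longrightarrow> i \<in> set (take l w)"
  shows "param_word a b w"
  using assms
proof (induction w arbitrary: a)
  case Nil
  have "a = b"
  proof (rule ccontr)
    assume "a \<noteq> b"
    then have "a \<in> set []" using Nil.prems(1) by (intro Nil.prems(3)) auto
    then show False by simp
  qed
  then show ?case by simp
next
  case (Cons x w)
  have xa: "x \<le> a"
  proof (rule ccontr)
    assume "\<not> x \<le> a"
    then have "a \<in> set (take 0 (x # w))" by (intro Cons.prems(4)) auto
    then show False by simp
  qed
  have inner: "i \<in> set (take l w)" if "l < length w" "a \<le> i" "i < w ! l" "i \<noteq> x" for l i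
    using Cons.prems(4)[of "Suc l" i] that by auto
  show ?case
  proof (cases "x = a")
    case True
    have "param_word (Suc a) b w"
    proof (rule Cons.IH)
      show "Suc a \<le> b" using Cons.prems(2) True by auto
      show "set w \<subseteq> {..<b}" using Cons.prems(2) by auto
      show "i \<in> set w" if "Suc a \<le> i" "i < b" for i using Cons.prems(3)[of i] that True by auto
      show "i \<in> set (take l w)" if "l < length w" "Suc a \<le> i" "i < w ! l" for l i
        using inner[of l i] that True by auto
    qed
    then show ?thesis using True by simp
  next
    case False
    then have "x < a" using xa by simp
    have "param_word a b w"
    proof (rule Cons.IH)
      show "a \<le> b" by (rule Cons.prems(1))
      show "set w \<subseteq> {..<b}" using Cons.prems(2) by auto
      show "i \<in> set w" if "a \<le> i" "i < b" for i using Cons.prems(3)[of i] that \<open>x < a\<close> by auto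
      show "i \<in> set (take l w)" if "l < length w" "a \<le> i" "i < w ! l" for l i
        using inner[of l i] that \<open>x < a\<close> by auto
    qed
    then show ?thesis using \<open>x < a\<close> by simp
  qed
qed

lemma param_word_earlier:
  assumes "param_word a b w" "l < length w" "a \<le> j" "j < w ! l"
  shows "\<exists>l'<l. w ! l' = j"
  using assms
proof (induction w arbitrary: a l)
  case Nil
  then show ?case by simp
next
  case (Cons x w)
  show ?case
  proof (cases l)
    case 0
    then show ?thesis using Cons.prems by auto
  next
    case (Suc l0)
    then have l0: "l0 < length w" "j < w ! l0" using Cons.prems by auto
    consider "x < a" "param_word a b w" | "x = a" "param_word (Suc a) b w" using Cons.prems(1) by auto
    then have "j = x \<or> (\<exists>l'<l0. w ! l' = j)"
    proof cases
      case 1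
      then show ?thesis using Cons.IH[OF 1(2) l0(1) Cons.prems(3) l0(2)] by blast
    next
      case 2
      show ?thesis
      proof (cases "j = a")
        case False
        then show ?thesis using Cons.IH[OF 2(2) l0(1) _ l0(2)] Cons.prems(3) by simp
      qed (use 2 in simp)
    qed
    then show ?thesis
    proof
      assume "j = x"
      then show ?thesis using Suc by (intro exI[of _ 0]) simp
    next
      assume "\<exists>l'<l0. w ! l' = j"
      then obtain l' where "l' < l0" "w ! l' = j" by blast
      then show ?thesis using Suc by (intro exI[of _ "Suc l'"]) simp
    qed
  qed
qed

text \<open>
The form in which rigidity will be verified: \<open>pos i\<close> is the first position with value \<open>i\<close>.
\<close>

lemma param_word_from_first_positions:
  assumes bound: "\<And>l. l < n \<Longrightarrow> v l < k"
    and pos: "\<And>i. i < k \<Longrightarrow> pos i < n" "\<And>i. i < k \<Longrightarrow> v (pos i) = i"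
    and mono: "\<And>i j. i < j \<Longrightarrow> j < k \<Longrightarrow> pos i < (pos j :: nat)"
    and first: "\<And>l. l < n \<Longrightarrow> pos (v l) \<le> l"
  shows "param_word 0 k (map v [0..<n])"
proof (rule param_wordI)
  show "set (map v [0..<n]) \<subseteq> {..<k}" using bound by auto
  show "i \<in> set (map v [0..<n])" if "i < k" for i
    using pos[OF that] by (auto intro!: image_eqI[of _ _ "pos i"])
  fix l i assume l: "l < length (map v [0..<n])" and i: "i < map v [0..<n] ! l"
  have ln: "l < n" "i < v l" using l i by auto
  have "pos i < l" using mono[OF ln(2) bound[OF ln(1)]] first[OF ln(1)] by simp
  moreover have "v (pos i) = i" using pos(2) ln bound[OF ln(1)] by simp
  ultimately show "i \<in> set (take l (map v [0..<n]))"
    using ln by (auto simp: take_map intro!: image_eqI[of _ _ "pos i"])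
qed simp

section \<open>The Hales-Jewett theorem\<close>

text \<open>
Patterns of colours on a set \<open>X\<close> are used as colours in the inductions below. Coding them by numbers
keeps all colourings numerical; the number \<open>R\<close> of codes does not depend on the pattern.
\<close>

definition codes_colourings ::
  "'x set \<Rightarrow> nat \<Rightarrow> (('x \<Rightarrow> nat) \<Rightarrow> nat) \<Rightarrow> nat \<Rightarrow> bool" where
  "codes_colourings X r e R \<longleftrightarrow>
     (\<forall>f. (\<forall>x. f x < r) \<longrightarrow> e f < R) \<and>
     (\<forall>f g. (\<forall>x. f x < r) \<longrightarrow> (\<forall>x. g x < r) \<longrightarrow> e f = e g \<longrightarrow> (\<forall>x\<in>X. f x = g x))"

lemma codes_colourings_less: "codes_colourings X r e R \<Longrightarrow> (\<And>x. f x < r) \<Longrightarrow> e f < R"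
  by (simp add: codes_colourings_def)

lemma codes_colourings_eqD:
  "codes_colourings X r e R \<Longrightarrow> e f = e g \<Longrightarrow> (\<And>x. f x < r) \<Longrightarrow> (\<And>x. g x < r) \<Longrightarrow> x \<in> X \<Longrightarrow> f x = g x"
  by (simp add: codes_colourings_def)

lemma codes_colourings_exists:
  assumes "finite X"
  shows "\<exists>e R. codes_colourings X r e R"
proof -
  let ?F = "X \<rightarrow>\<^sub>E {..<r}"
  have fin: "finite ?F" using assms by (intro finite_PiE) auto
  obtain h where h: "bij_betw h ?F {0..<card ?F}" using ex_bij_betw_finite_nat[OF fin] by blast
  have mem: "restrict f X \<in> ?F" if "\<forall>x. f x < r" for f :: "'a \<Rightarrow> nat" using that by auto
  have "codes_colourings X r (\<lambda>f. h (restrict f X)) (card ?F)"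
    unfolding codes_colourings_def
  proof (intro conjI allI impI ballI)
    show "h (restrict f X) < card ?F" if "\<forall>x. f x < r" for f
      using bij_betwE[OF h] mem[OF that] by force
    show "f x = g x" if "\<forall>x. f x < r" "\<forall>x. g x < r" "h (restrict f X) = h (restrict g X)" "x \<in> X" for f g x
    proof -
      have "restrict f X = restrict g X"
        using bij_betw_imp_inj_on[OF h] mem[OF that(1)] mem[OF that(2)] that(3) by (meson inj_onD)
      then show ?thesis using that(4) by (metis restrict_apply')
    qed
  qed
  then show ?thesis by blast
qed

definition words :: "nat \<Rightarrow> nat \<Rightarrow> nat list set" where
  "words a n = {w. set w \<subseteq> {..<a} \<and> length w = n}"

lemma finite_words [simp]: "finite (words a n)"
  unfolding words_def by (rule finite_lists_length_eq) simp

text \<open>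
Makes room for \<open>j\<close> more parameters that come before those of \<open>u\<close>.
\<close>

definition shift :: "nat \<Rightarrow> nat \<Rightarrow> nat list \<Rightarrow> nat list" where
  "shift a j u = map (\<lambda>x. if x < a then x else x + j) u"

lemma length_shift [simp]: "length (shift a j u) = length u"
  by (simp add: shift_def)

lemma param_word_shift: "param_word b e u \<Longrightarrow> a \<le> b \<Longrightarrow> param_word (b + j) (e + j) (shift a j u)"
  by (induction u arbitrary: b) (force simp: shift_def)+

lemma act_shift: "length p = j \<Longrightarrow> act a (p @ w) (shift a j u) = act a w u"
  by (induction u) (auto simp: shift_def act_Cons nth_append)

text \<open>
A parameter whose value is its own name behaves as a constant.
\<close>

lemma act_new_constant: "act a (a # w) u = act (Suc a) w u"
  by (auto simp: act_def)

text \<open>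
The word whose first parameter is that of the line \<open>L\<close> and whose other parameters are those of \<open>U\<close>.
\<close>

definition shift_join :: "nat \<Rightarrow> nat list \<Rightarrow> nat list \<Rightarrow> nat list" where
  "shift_join a L U = L @ shift a 1 U"

lemma param_word_shift_join:
  assumes "param_word a (Suc a) L" "param_word a (a + n) U"
  shows "param_word a (a + Suc n) (shift_join a L U)"
  using assms(1) param_word_shift[OF assms(2), of a 1]
  by (auto simp: shift_join_def param_word_append)

lemma act_shift_join:
  assumes "param_word a (Suc a) L" 
  shows "act a (x # w) (shift_join a L U) = act a [x] L @ act a w U"
proof -
  have "act a ([x] @ w) L = act a [x] L"
    by (rule act_take) (use param_word_letters[OF assms] in auto)
  moreover have "act a (x # w) (shift a 1 U) = act a w U"
    using act_shift[of "[x]" 1] by simp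
  ultimately show ?thesis by (simp add: shift_join_def act_append)
qed

lemma length_shift_join: "length (shift_join a L U) = length L + length U"
  by (simp add: shift_join_def)

text \<open>
Shelah's lemma: in a large enough dimension some subspace does not notice when the last letter
\<open>Suc b\<close> is replaced by \<open>b\<close>. Each parameter takes a block of \<open>R1\<close> positions. Among the \<open>R1 + 1\<close> words of
the form \<open>Suc b, ..., Suc b, b, ..., b\<close> two have the same pattern of colours over all continuations, and
the positions where these two differ form the parameter.
\<close>

lemma Shelah_insensitive:
  fixes b r :: nat
  defines "a \<equiv> Suc (Suc b)"
  defines "\<kappa> \<equiv> (\<lambda>x. if x = Suc b then b else x)"
  shows "\<exists>N. \<forall>c. (\<forall>w. c w < r) \<longrightarrow> (\<exists>U. param_word a (a + n) U \<and> length U = N \<and>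
    (\<forall>w\<in>words a n. c (act a w U) = c (act a (map \<kappa> w) U)))"
proof (induction n arbitrary: r)
  case 0
  have "param_word a (a + 0) []" by simp
  then show ?case by (intro exI[of _ 0]) (auto simp: words_def)
next
  case (Suc n)
  obtain e2 R2 where e2: "codes_colourings ({..<a}) r e2 R2"
    using codes_colourings_exists finite_lessThan by blast
  obtain N2 where N2: "\<And>c. (\<forall>w. c w < R2) \<Longrightarrow> (\<exists>U. param_word a (a + n) U \<and> length U = N2 \<and>
    (\<forall>w\<in>words a n. c (act a w U) = c (act a (map \<kappa> w) U)))" using Suc.IH[of R2] by blast
  obtain e1 R1 where e1: "codes_colourings (words a N2) r e1 R1"
    using codes_colourings_exists finite_words by blast
  show ?case
  proof (intro exI[of _ "R1 + N2"] allI impI)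
    fix c :: "nat list \<Rightarrow> nat"
    assume c: "\<forall>w. c w < r"
    \<comment> \<open>\<open>z t\<close> and \<open>z t'\<close> will be the values of the line \<open>L\<close> at \<open>b\<close> and \<open>Suc b\<close>.\<close>
    define z where "z t = replicate t (Suc b) @ replicate (R1 - t) b" for t
    define f where "f t = e1 (\<lambda>w. c (z t @ w))" for t
    have "f ` {..R1} \<subseteq> {..<R1}" using codes_colourings_less[OF e1] c by (auto simp: f_def)
    then have "\<not> inj_on f {..R1}"
      using pigeonhole[of f "{..R1}"] card_mono[of "{..<R1}" "f ` {..R1}"] by auto
    then obtain t1 t2 where "t1 \<le> R1" "t2 \<le> R1" "f t1 = f t2" "t1 \<noteq> t2"
      by (auto simp: inj_on_def)
    then obtain t t' where t: "t < t'" "t' \<le> R1" "f t = f t'"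
      by (metis nat_neq_iff)
    define L where "L = replicate t (Suc b) @ replicate (t' - t) a @ replicate (R1 - t') b"
    have L: "param_word a (Suc a) L"
    proof -
      have "param_word a a (replicate t (Suc b))" by (auto simp: param_word_const_iff a_def)
      moreover obtain m where m: "t' - t = Suc m" using t by (metis Suc_diff_Suc)
      have "param_word (Suc a) (Suc a) (replicate m a @ replicate (R1 - t') b)"
        by (auto simp: param_word_const_iff a_def simp del: param_word.simps)
      then have "param_word a (Suc a) (replicate (t' - t) a @ replicate (R1 - t') b)" using m by simp
      ultimately show ?thesis unfolding L_def param_word_append[of a _ "replicate t (Suc b)"] by blast
    qed
    have lenL: "length L = R1" using t by (simp add: L_def)
    have "act a [Suc b] L = z t'" using t
      by (simp add: L_def z_def act_def a_def nth_append replicate_add[symmetric])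
    moreover have "act a [b] L = z t" using t
      by (simp add: L_def z_def act_def a_def nth_append replicate_add[symmetric])
    ultimately have Lx: "c (act a [x] L @ w) = c (act a [\<kappa> x] L @ w)" if "w \<in> words a N2" for x w
      using codes_colourings_eqD[OF e1, of "\<lambda>w. c (z t @ w)" "\<lambda>w. c (z t' @ w)" w] c that t(3) by (auto simp: f_def \<kappa>_def)
    define c2 where "c2 w = e2 (\<lambda>x. c (act a [x] L @ w))" for w
    have "\<forall>w. c2 w < R2" using codes_colourings_less[OF e2] c by (simp add: c2_def)
    then obtain U where U: "param_word a (a + n) U" "length U = N2"
      "\<And>w. w \<in> words a n \<Longrightarrow> c2 (act a w U) = c2 (act a (map \<kappa> w) U)"
      using N2 by blast
    have Ux: "c (act a [x] L @ act a w U) = c (act a [x] L @ act a (map \<kappa> w) U)"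
      if "w \<in> words a n" "x < a" for x w
      using codes_colourings_eqD[OF e2, of "\<lambda>x. c (act a [x] L @ act a w U)" "\<lambda>x. c (act a [x] L @ act a (map \<kappa> w) U)" x]
        U(3)[OF that(1)] that(2) c by (simp add: c2_def)
    show "\<exists>U. param_word a (a + Suc n) U \<and> length U = R1 + N2 \<and>
        (\<forall>w\<in>words a (Suc n). c (act a w U) = c (act a (map \<kappa> w) U))"
    proof (intro exI[of _ "shift_join a L U"] conjI ballI)
      show "param_word a (a + Suc n) (shift_join a L U)" by (rule param_word_shift_join[OF L U(1)])
      show "length (shift_join a L U) = R1 + N2" using lenL U(2) by (simp add: length_shift_join)
      fix v assume "v \<in> words a (Suc n)"
      then obtain x w where v: "v = x # w" "x < a" "w \<in> words a n"
        by (auto simp: words_def length_Suc_conv)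
      have "act a w U \<in> words a N2"
        using set_act_consts[of U a w] param_word_letters[OF U(1)] v(3) U(2) by (auto simp: words_def)
      moreover have "\<kappa> x < a" using v(2) by (auto simp: \<kappa>_def a_def)
      ultimately show "c (act a v (shift_join a L U)) = c (act a (map \<kappa> v) (shift_join a L U))"
        using Lx[of "act a w U" x] Ux[OF v(3), of "\<kappa> x"]
        unfolding v(1) list.map act_shift_join[OF L] by simp
    qed
  qed
qed

text \<open>
Induction on the alphabet. Within an insensitive subspace a line that is monochromatic for the letters
below the last one is monochromatic, because setting its parameter to the last letter has the same colour
as setting it to the one before.
\<close>

lemma Hales_Jewett_line:
  fixes r :: nat
  shows "\<exists>n. \<forall>c. (\<forall>w. c w < r) \<longrightarrow> (\<exists>L. param_word a (Suc a) L \<and> length L = n \<and>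
    (\<forall>x<a. \<forall>y<a. c (act a [x] L) = c (act a [y] L)))"
proof (induction a)
  case 0
  then show ?case by (intro exI[of _ 1] allI impI exI[of _ "[0]"]) auto
next
  case (Suc a0)
  show ?case
  proof (cases a0)
    case 0
    then show ?thesis by (intro exI[of _ 1] allI impI exI[of _ "[1]"]) auto
  next
    case (Suc b)
    define a where "a = Suc (Suc b)"
    define \<kappa> where "\<kappa> = (\<lambda>x. if x = Suc b then b else x)"
    obtain n where n: "\<And>c. (\<forall>w. c w < r) \<Longrightarrow> (\<exists>L. param_word (Suc b) (Suc (Suc b)) L \<and> length L = n \<and>
      (\<forall>x<Suc b. \<forall>y<Suc b. c (act (Suc b) [x] L) = c (act (Suc b) [y] L)))"
      using Suc.IH unfolding Suc by blast
    obtain N where N: "\<And>c. (\<forall>w. c w < r) \<Longrightarrow> (\<exists>U. param_word a (a + n) U \<and> length U = N \<and>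
      (\<forall>w\<in>words a n. c (act a w U) = c (act a (map \<kappa> w) U)))"
      using Shelah_insensitive[of r b n] unfolding a_def \<kappa>_def by blast
    have "\<exists>L. param_word a (Suc a) L \<and> length L = N \<and>
      (\<forall>x<a. \<forall>y<a. c (act a [x] L) = c (act a [y] L))" if c: "\<forall>w. c w < r" for c
    proof -
      obtain U where U: "param_word a (a + n) U" "length U = N"
        "\<And>w. w \<in> words a n \<Longrightarrow> c (act a w U) = c (act a (map \<kappa> w) U)"
        using N[OF c] by blast
      obtain L' where L': "param_word (Suc b) (Suc (Suc b)) L'" "length L' = n"
        "\<And>x y. x < Suc b \<Longrightarrow> y < Suc b \<Longrightarrow> c (act a (act (Suc b) [x] L') U) = c (act a (act (Suc b) [y] L') U)"
        using n[of "\<lambda>w. c (act a w U)"] c by blast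
      define L where "L = map ((!) ([0..<Suc b] @ [a])) L'"
      have L: "param_word a (Suc a) L" unfolding L_def
        by (rule param_word_subst[OF L'(1)]) (auto simp: a_def)
      have lenL: "length L = n" using L'(2) by (simp add: L_def)
      have L'let: "y \<le> Suc b" if "y \<in> set L'" for y using param_word_letters[OF L'(1)] that by fastforce
      have LL': "act a [x] L = act (Suc b) [x] L'" for x
        using L'let by (force simp: L_def act_def a_def nth_append less_Suc_eq simp del: upt_Suc)
      have "\<kappa> (([0..<Suc b] @ [Suc b]) ! y) = ([0..<Suc b] @ [b]) ! y" if "y \<in> set L'" for y
        using L'let[OF that] by (cases "y = Suc b") (auto simp: \<kappa>_def nth_append simp del: upt_Suc)
      then have col: "map \<kappa> (act a [Suc b] L) = act a [b] L"
        unfolding LL' unfolding act_def by (simp del: upt_Suc)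
      have top: "c (act a (act a [Suc b] L) U) = c (act a (act a [b] L) U)"
      proof -
        have "act a [Suc b] L \<in> words a n"
          using set_act_consts[of L a "[Suc b]"] param_word_letters[OF L] lenL by (auto simp: words_def a_def)
        then show ?thesis using U(3) col by metis
      qed
      have all: "c (act a (act a [x] L) U) = c (act a (act a [b] L) U)" if "x < a" for x
      proof (cases "x = Suc b")
        case True
        then show ?thesis using top by simp
      next
        case False
        then have "x < Suc b" using that by (simp add: a_def)
        then show ?thesis unfolding LL' by (intro L'(3)) simp_all
      qed
      have "act a [x] (act a L U) = act a (act a [x] L) U" for x
        by (rule act_act) (use param_word_letters[OF U(1)] lenL in auto)
      moreover have "param_word a (Suc a) (act a L U)"
        by (rule param_word_act) (use U(1) L lenL in auto)
      ultimately show ?thesis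
        using all U(2) by (intro exI[of _ "act a L U"]) (metis length_act)
    qed
    then show ?thesis unfolding Suc a_def by blast
  qed
qed

text \<open>
The parameters are found one at a time: the line for the first one is monochromatic for the pattern of
colours over all continuations, so afterwards its value has no influence.
\<close>

lemma Hales_Jewett:
  fixes r :: nat
  shows "\<exists>n. \<forall>c. (\<forall>w. c w < r) \<longrightarrow> (\<exists>U. param_word a (a + d) U \<and> length U = n \<and>
    (\<forall>w\<in>words a d. \<forall>w'\<in>words a d. c (act a w U) = c (act a w' U)))"
proof (induction d)
  case 0
  have "param_word a (a + 0) []" by simp
  then show ?case by (intro exI[of _ 0]) (auto simp: words_def)
next
  case (Suc d)
  obtain n2 where n2: "\<And>c. (\<forall>w. c w < r) \<Longrightarrow> (\<exists>U. param_word a (a + d) U \<and> length U = n2 \<and>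
    (\<forall>w\<in>words a d. \<forall>w'\<in>words a d. c (act a w U) = c (act a w' U)))" using Suc.IH by blast
  obtain e R where e: "codes_colourings (words a n2) r e R"
    using codes_colourings_exists finite_words by blast
  obtain n1 where n1: "\<And>c. (\<forall>w. c w < R) \<Longrightarrow> (\<exists>L. param_word a (Suc a) L \<and> length L = n1 \<and>
    (\<forall>x<a. \<forall>y<a. c (act a [x] L) = c (act a [y] L)))" using Hales_Jewett_line[of R a] by blast
  show ?case
  proof (intro exI[of _ "n1 + n2"] allI impI)
    fix c :: "nat list \<Rightarrow> nat"
    assume c: "\<forall>w. c w < r"
    have bd: "\<forall>v. e (\<lambda>w. c (v @ w)) < R" using codes_colourings_less[OF e] c by simp
    from n1[OF bd] obtain L where L: "param_word a (Suc a) L" "length L = n1"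
      "\<And>x y. x < a \<Longrightarrow> y < a \<Longrightarrow> e (\<lambda>w. c (act a [x] L @ w)) = e (\<lambda>w. c (act a [y] L @ w))"
      by blast
    have Lx: "c (act a [x] L @ w) = c (act a [0] L @ w)" if "x < a" "w \<in> words a n2" for x w
      using codes_colourings_eqD[OF e, of "\<lambda>w. c (act a [x] L @ w)" "\<lambda>w. c (act a [0] L @ w)" w] L(3)[of x 0] that c by auto
    obtain U where U: "param_word a (a + d) U" "length U = n2"
      "\<And>w w'. w\<in>words a d \<Longrightarrow> w' \<in> words a d \<Longrightarrow> c (act a [0] L @ act a w U) = c (act a [0] L @ act a w' U)"
      using n2[of "\<lambda>w. c (act a [0] L @ w)"] c by blast
    have col: "c (act a v (shift_join a L U)) = c (act a [0] L @ act a (tl v) U) \<and> tl v \<in> words a d"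
      if vw: "v \<in> words a (Suc d)" for v
    proof -
      obtain x w where v: "v = x # w" "x < a" "w \<in> words a d"
        using vw by (auto simp: words_def length_Suc_conv)
      have "act a w U \<in> words a n2"
        using set_act_consts[of U a w] param_word_letters[OF U(1)] v(3) U(2) by (auto simp: words_def)
      then show ?thesis
        using Lx[OF v(2)] v unfolding v(1) act_shift_join[OF L(1)] by auto
    qed
    show "\<exists>U. param_word a (a + Suc d) U \<and> length U = n1 + n2 \<and>
        (\<forall>w\<in>words a (Suc d). \<forall>w'\<in>words a (Suc d). c (act a w U) = c (act a w' U))"
    proof (intro exI[of _ "shift_join a L U"] conjI ballI)
      show "param_word a (a + Suc d) (shift_join a L U)" by (rule param_word_shift_join[OF L(1) U(1)])
      show "length (shift_join a L U) = n1 + n2" using L(2) U(2) by (simp add: length_shift_join)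
      show "c (act a w (shift_join a L U)) = c (act a w' (shift_join a L U))"
        if "w \<in> words a (Suc d)" "w' \<in> words a (Suc d)" for w w'
        using col[OF that(1)] col[OF that(2)] U(3) by simp
    qed
  qed
qed

section \<open>The Graham-Rothschild theorem\<close>

text \<open>
The parameter \<open>i\<close> of \<open>V\<close> is introduced as the value of the parameter \<open>j\<close> of \<open>W\<close>, and the part of the
composite before that place comes from the corresponding parts of \<open>V\<close> and \<open>W\<close>.
\<close>

lemma before_act:
  assumes W: "param_word a (a + n) W" and V: "param_word a (a + d) V" "length V = n" and i: "i < d"
  obtains j where "j < n" "V ! j = a + i" "length (before (a + i) V) = j"
    "before (a + i) (act a V W) = act a (before (a + i) V) (before (a + j) W)"
    "set (before (a + j) W) \<subseteq> {..<a + j}" "set (before (a + i) V) \<subseteq> {..<a + i}"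
proof -
  obtain V' where V': "V = before (a + i) V @ (a + i) # V'" "param_word a (a + i) (before (a + i) V)"
    by (rule param_word_split[OF V(1), of "a + i"]) (use i in auto)
  define j where "j = length (before (a + i) V)"
  have jn: "j < n" using V'(1) V(2) by (metis j_def length_append length_Cons less_add_Suc1 add_Suc_right)
  have Vj: "V ! j = a + i" using V'(1) unfolding j_def by (metis nth_append_length)
  obtain W' where W': "W = before (a + j) W @ (a + j) # W'" "param_word a (a + j) (before (a + j) W)"
    by (rule param_word_split[OF W, of "a + j"]) (use jn in auto)
  have sW: "set (before (a + j) W) \<subseteq> {..<a + j}" by (rule param_word_letters[OF W'(2)])
  have sV: "set (before (a + i) V) \<subseteq> {..<a + i}" by (rule param_word_letters[OF V'(2)])
  have "act a V (before (a + j) W) = act a (before (a + i) V @ (a + i) # V') (before (a + j) W)"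
    using V'(1) by simp
  also have "\<dots> = act a (before (a + i) V) (before (a + j) W)"
    by (rule act_take) (use sW in \<open>simp add: j_def\<close>)
  finally have pre: "act a V (before (a + j) W) = act a (before (a + i) V) (before (a + j) W)" .
  have "act a V W = act a V (before (a + j) W @ (a + j) # W')" using W'(1) by simp
  also have "\<dots> = act a (before (a + i) V) (before (a + j) W) @ (a + i) # act a V W'"
    using pre Vj by (simp add: act_append act_Cons)
  finally have eq: "act a V W = act a (before (a + i) V) (before (a + j) W) @ (a + i) # act a V W'" .
  have "param_word a (a + i) (act a (before (a + i) V) (before (a + j) W))"
    by (rule param_word_act) (use W'(2) V'(2) in \<open>auto simp: j_def\<close>)
  then have "before (a + i) (act a V W) = act a (before (a + i) V) (before (a + j) W)"
    unfolding eq by (intro before_unique param_word_letters)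
  then show thesis using that jn Vj sW sV by (simp add: j_def)
qed

lemma words_act:
  assumes "set u \<subseteq> {..<a + n}" "v \<in> words a n"
  shows "act a v u \<in> words a (length u)"
  using assms set_act_consts[of u a v] by (auto simp: words_def)

text \<open>
The levels are treated from the last one downwards. A Hales-Jewett subspace \<open>U\<close> settles the words of full
length; a new parameter appended to it closes the top level. Shorter words are evaluated in the parts
of \<open>U\<close> before its parameters, which yields a colouring to which the induction hypothesis applies.
\<close>

lemma prefix_colouring_by_level:
  fixes r :: nat
  shows "\<exists>n. \<forall>c. (\<forall>w. c w < r) \<longrightarrow> (\<exists>W. param_word a (a + d) W \<and> length W = n \<and>
    (\<forall>i<d. \<forall>q\<in>words a i. \<forall>q'\<in>words a i.
       c (act a q (before (a + i) W)) = c (act a q' (before (a + i) W))))"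
proof (induction d)
  case 0
  have "param_word a (a + 0) []" by simp
  then show ?case by blast
next
  case (Suc d)
  obtain n1 where n1: "\<And>c. (\<forall>w. c w < r) \<Longrightarrow> (\<exists>W. param_word a (a + d) W \<and> length W = n1 \<and>
    (\<forall>i<d. \<forall>q\<in>words a i. \<forall>q'\<in>words a i.
       c (act a q (before (a + i) W)) = c (act a q' (before (a + i) W))))" using Suc.IH by blast
  obtain n where n: "\<And>c. (\<forall>w. c w < r) \<Longrightarrow> (\<exists>U. param_word a (a + n1) U \<and> length U = n \<and>
    (\<forall>w\<in>words a n1. \<forall>w'\<in>words a n1. c (act a w U) = c (act a w' U)))"
    using Hales_Jewett[of r a n1] by blast
  show ?case
  proof (intro exI[of _ "Suc n"] allI impI)
    fix c :: "nat list \<Rightarrow> nat"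
    assume c: "\<forall>w. c w < r"
    obtain U where U: "param_word a (a + n1) U" "length U = n"
      "\<And>w w'. w \<in> words a n1 \<Longrightarrow> w' \<in> words a n1 \<Longrightarrow> c (act a w U) = c (act a w' U)"
      using n[OF c] by blast
    define c' where "c' p = c (act a p (before (a + length p) U))" for p
    have "\<forall>w. c' w < r" using c by (simp add: c'_def)
    from n1[OF this] obtain V where V: "param_word a (a + d) V" "length V = n1"
      "\<And>i q q'. i < d \<Longrightarrow> q \<in> words a i \<Longrightarrow> q' \<in> words a i \<Longrightarrow>
         c' (act a q (before (a + i) V)) = c' (act a q' (before (a + i) V))" by blast
    define W where "W = act a V U @ [a + d]"
    have VU: "param_word a (a + d) (act a V U)"
      by (rule param_word_act) (use U(1) V in auto)
    have W: "param_word a (a + Suc d) W" unfolding W_def param_word_append using VU by auto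
    have lenW: "length W = Suc n" using U(2) by (simp add: W_def)
    have "c (act a q (before (a + i) W)) = c (act a q' (before (a + i) W))"
      if i: "i < Suc d" and q: "q \<in> words a i" "q' \<in> words a i" for i q q'
    proof (cases "i = d")
      case True
      have b: "before (a + i) W = act a V U"
        unfolding True W_def using before_unique[OF param_word_letters[OF VU], of "[]"] by simp
      have "act a p (act a V U) = act a (act a p V) U" for p
        by (rule act_act) (use param_word_letters[OF U(1)] V(2) in auto)
      moreover have "act a p V \<in> words a n1" if "p \<in> words a i" for p
        using words_act[of V a d p] param_word_letters[OF V(1)] V(2) that True by auto
      ultimately show ?thesis unfolding b using q U(3)[of "act a q V" "act a q' V"] by simp
    next
      case False
      then have i': "i < d" using i by simp
      obtain j where j: "length (before (a + i) V) = j"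
        "before (a + i) (act a V U) = act a (before (a + i) V) (before (a + j) U)"
        "set (before (a + j) U) \<subseteq> {..<a + j}"
        by (rule before_act[OF U(1) V(1,2) i'])
      obtain w' where "act a V U = before (a + i) (act a V U) @ (a + i) # w'"
        "param_word a (a + i) (before (a + i) (act a V U))"
        by (rule param_word_split[OF VU, of "a + i"]) (use i' in auto)
      then have b: "before (a + i) W = before (a + i) (act a V U)"
        unfolding W_def by (metis append_Cons append_assoc before_unique param_word_letters)
      have "c (act a p (before (a + i) W)) = c' (act a p (before (a + i) V))" for p
        unfolding c'_def b j(2) using act_act[of "before (a + j) U" a "before (a + i) V" p] j(1,3)
        by simp
      then show ?thesis using V(3)[OF i' q] by simp
    qed
    then show "\<exists>W. param_word a (a + Suc d) W \<and> length W = Suc n \<and>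
      (\<forall>i<Suc d. \<forall>q\<in>words a i. \<forall>q'\<in>words a i.
         c (act a q (before (a + i) W)) = c (act a q' (before (a + i) W)))"
      using W lenW by blast
  qed
qed

text \<open>
Keeps the parameters with index in \<open>J\<close> and gives the value 0 to all others, for which some constant has
to exist.
\<close>

lemma param_word_selecting:
  assumes "0 < a"
  shows "param_word a (a + card {j\<in>J. j < n})
    (map (\<lambda>j. if j \<in> J then a + card {i\<in>J. i < j} else 0) [0..<n])"
proof (induction n)
  case (Suc n)
  have "finite {j \<in> J. j < n}" by simp
  moreover have "{j \<in> J. j < Suc n} = (if n \<in> J then insert n {j \<in> J. j < n} else {j \<in> J. j < n})"
    by (auto simp: less_Suc_eq)
  ultimately show ?case using Suc assms by (auto simp: param_word_append)
qed simp

text \<open>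
By the pigeonhole principle, \<open>d\<close> out of \<open>r * d\<close> levels share their colour; the parameters of the other
levels are set to a constant.
\<close>

lemma prefix_colouring:
  fixes r :: nat
  shows "\<exists>n. \<forall>c. (\<forall>w. c w < r) \<longrightarrow> (\<exists>W col. param_word a (a + d) W \<and> length W = n \<and>
    (\<forall>i<d. \<forall>q\<in>words a i. c (act a q (before (a + i) W)) = col))"
proof (cases "a = 0")
  case True
  have "(\<exists>W col. param_word a (a + d) W \<and> length W = d \<and>
    (\<forall>i<d. \<forall>q\<in>words a i. c (act a q (before (a + i) W)) = col))" if "\<forall>w. c w < r" for c
  proof (intro exI conjI allI impI ballI)
    show "param_word a (a + d) [a..<a + d]" by (rule param_word_params)
    fix i q assume "q \<in> words a i"
    then have "i = 0" using True by (auto simp: words_def)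
    moreover have "before 0 [0..<d] = []" by (cases d) (auto simp: before_def upt_rec)
    ultimately show "c (act a q (before (a + i) [a..<a + d])) = c []" using True by simp
  qed simp
  then show ?thesis by blast
next
  case False
  obtain n where n: "\<And>c. (\<forall>w. c w < r) \<Longrightarrow> (\<exists>W. param_word a (a + r * d) W \<and> length W = n \<and>
    (\<forall>i<r * d. \<forall>q\<in>words a i. \<forall>q'\<in>words a i.
       c (act a q (before (a + i) W)) = c (act a q' (before (a + i) W))))"
    using prefix_colouring_by_level[of r a "r * d"] by blast
  show ?thesis
  proof (intro exI[of _ n] allI impI)
    fix c :: "nat list \<Rightarrow> nat"
    assume c: "\<forall>w. c w < r"
    obtain W where W: "param_word a (a + r * d) W" "length W = n"
      "\<And>i q q'. i < r * d \<Longrightarrow> q \<in> words a i \<Longrightarrow> q' \<in> words a i \<Longrightarrow>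
         c (act a q (before (a + i) W)) = c (act a q' (before (a + i) W))" using n[OF c] by blast
    define \<kappa> where "\<kappa> i = c (act a (replicate i 0) (before (a + i) W))" for i
    have "\<exists>col<r. d \<le> card {i. i < r * d \<and> \<kappa> i = col}"
    proof (rule ccontr)
      assume neg: "\<not> ?thesis"
      have r: "0 < r" using c by (metis gr0I not_less0)
      then have d: "0 < d" using neg by (metis le0 neq0_conv)
      have "{..<r * d} = (\<Union>col<r. {i. i < r * d \<and> \<kappa> i = col})" using c by (auto simp: \<kappa>_def)
      then have "r * d = card (\<Union>col<r. {i. i < r * d \<and> \<kappa> i = col})" by (metis card_lessThan)
      also have "\<dots> \<le> (\<Sum>col<r. card {i. i < r * d \<and> \<kappa> i = col})" by (rule card_UN_le) simp
      also have "\<dots> < (\<Sum>col<r. d)" using neg r by (intro sum_strict_mono) (auto simp: not_le)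
      finally show False by simp
    qed
    then obtain col J where J: "J \<subseteq> {i. i < r * d \<and> \<kappa> i = col}" "card J = d"
      by (metis obtain_subset_with_card_n)
    define V where "V = map (\<lambda>j. if j \<in> J then a + card {i\<in>J. i < j} else 0) [0..<r * d]"
    have "{j \<in> J. j < r * d} = J" using J(1) by auto
    then have V: "param_word a (a + d) V" "length V = r * d"
      using param_word_selecting[of a J "r * d"] False J(2) by (auto simp: V_def)
    show "\<exists>U col. param_word a (a + d) U \<and> length U = n \<and>
      (\<forall>i<d. \<forall>q\<in>words a i. c (act a q (before (a + i) U)) = col)"
    proof (intro exI[of _ "act a V W"] exI[of _ col] conjI allI impI ballI)
      show "param_word a (a + d) (act a V W)" by (rule param_word_act) (use V W in auto)
      show "length (act a V W) = n" using W(2) by simp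
      fix i q assume i: "i < d" and q: "q \<in> words a i"
      obtain j where j: "j < r * d" "V ! j = a + i" "length (before (a + i) V) = j"
        "before (a + i) (act a V W) = act a (before (a + i) V) (before (a + j) W)"
        "set (before (a + j) W) \<subseteq> {..<a + j}" "set (before (a + i) V) \<subseteq> {..<a + i}"
        by (rule before_act[OF W(1) V i])
      have "j \<in> J" using j(1,2) False by (auto simp: V_def split: if_splits)
      then have col: "c (act a (replicate j 0) (before (a + j) W)) = col" using J(1) by (auto simp: \<kappa>_def)
      have "act a q (before (a + i) (act a V W)) = act a (act a q (before (a + i) V)) (before (a + j) W)"
        unfolding j(4) by (rule act_act) (use j in auto)
      moreover have "act a q (before (a + i) V) \<in> words a j"
        using words_act[OF j(6) q] j(3) by simp
      moreover have "replicate j 0 \<in> words a j" using False by (auto simp: words_def)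
      ultimately show "c (act a q (before (a + i) (act a V W))) = col"
        using W(3)[OF j(1)] col by metis
    qed
  qed
qed

text \<open>
The number \<open>k\<close> counts constants and parameters together, so the coloured words have \<open>k - a\<close> parameters.
Passing from \<open>a\<close> to \<open>Suc a\<close> with \<open>k\<close> fixed trades one parameter for a constant.
\<close>

definition Graham_Rothschild_property :: "nat \<Rightarrow> nat \<Rightarrow> bool" where
  "Graham_Rothschild_property a k \<longleftrightarrow> (\<forall>d r. \<exists>n. \<forall>c. (\<forall>w. c w < r) \<longrightarrow>
     (\<exists>U (col :: nat). param_word a (a + d) U \<and> length U = n \<and>
        (\<forall>v. param_word a k v \<longrightarrow> length v = d \<longrightarrow> c (act a v U) = col)))"

text \<open>
A coloured word \<open>p @ a # w\<close> is cut at its first parameter; the colour is to depend only on \<open>p\<close>, as long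
as \<open>p\<close> has length at least \<open>j\<close>.
\<close>

definition prefix_determines ::
  "(nat list \<Rightarrow> nat) \<Rightarrow> nat \<Rightarrow> nat \<Rightarrow> nat \<Rightarrow> nat \<Rightarrow> nat list \<Rightarrow> bool" where
  "prefix_determines c a k j m U \<longleftrightarrow>
    (\<forall>p w w'. set p \<subseteq> {..<a} \<longrightarrow> j \<le> length p \<longrightarrow>
       param_word (Suc a) k w \<longrightarrow> param_word (Suc a) k w' \<longrightarrow>
       length p + Suc (length w) = m \<longrightarrow> length w' = length w \<longrightarrow>
       c (act a (p @ a # w) U) = c (act a (p @ a # w') U))"

lemma prefix_determinesD:
  "prefix_determines c a k j m U \<Longrightarrow> set p \<subseteq> {..<a} \<Longrightarrow> j \<le> length p \<Longrightarrow>
    param_word (Suc a) k w \<Longrightarrow> param_word (Suc a) k w' \<Longrightarrow>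
    length p + Suc (length w) = m \<Longrightarrow> length w' = length w \<Longrightarrow>
    c (act a (p @ a # w) U) = c (act a (p @ a # w') U)"
  unfolding prefix_determines_def
  by (drule spec[of _ p], drule spec[of _ w], drule spec[of _ w']) simp

text \<open>
Position after position, the word after the first parameter loses its influence. At position \<open>j\<close> the
Graham-Rothschild property over the larger alphabet is applied to the pattern of colours over all
prefixes of length \<open>j\<close>. The subspaces chosen later leave the first \<open>Suc j\<close> letters alone, so that what has
been achieved for \<open>j\<close> persists.
\<close>

lemma fusion:
  assumes GR: "Graham_Rothschild_property (Suc a) k"
  shows "\<exists>n. \<forall>c. (\<forall>w. c w < r) \<longrightarrow> (\<exists>U. param_word a (a + j + l) U \<and> length U = j + n \<and>
    take j U = [a..<a + j] \<and> prefix_determines c a k j (j + l) U)"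
proof (induction l arbitrary: j r)
  case 0
  show ?case
  proof (intro exI[of _ 0] allI impI)
    fix c :: "nat list \<Rightarrow> nat"
    show "\<exists>U. param_word a (a + j + 0) U \<and> length U = j + 0 \<and> take j U = [a..<a + j] \<and>
     prefix_determines c a k j (j + 0) U"
      by (rule exI[of _ "[a..<a + j]"]) (simp add: param_word_params prefix_determines_def)
  qed
next
  case (Suc l)
  obtain n1 where n1: "\<And>c. (\<forall>w. c w < r) \<Longrightarrow> (\<exists>U. param_word a (a + Suc j + l) U \<and> length U = Suc j + n1 \<and>
    take (Suc j) U = [a..<a + Suc j] \<and> prefix_determines c a k (Suc j) (Suc j + l) U)"
    using Suc.IH[of r "Suc j"] by blast
  obtain e R where e: "codes_colourings (words a j) r e R"
    using codes_colourings_exists[OF finite_words, of a j r] by blast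
  obtain n where n: "\<And>c. (\<forall>w. c w < R) \<Longrightarrow>
     (\<exists>U (col :: nat). param_word (Suc a) (Suc a + n1) U \<and> length U = n \<and>
        (\<forall>v. param_word (Suc a) k v \<longrightarrow> length v = n1 \<longrightarrow> c (act (Suc a) v U) = col))"
    using GR[unfolded Graham_Rothschild_property_def, THEN spec, THEN spec, of R n1] by blast
  show ?case
  proof (intro exI[of _ "Suc n"] allI impI)
    fix c :: "nat list \<Rightarrow> nat"
    assume c: "\<forall>w. c w < r"
    have bd: "\<forall>w. e (\<lambda>p. c (p @ a # w)) < R" using codes_colourings_less[OF e] c by simp
    from n[OF bd] obtain X col where X: "param_word (Suc a) (Suc a + n1) X" "length X = n"
      "\<And>v. param_word (Suc a) k v \<Longrightarrow> length v = n1 \<Longrightarrow> e (\<lambda>p. c (p @ a # act (Suc a) v X)) = col"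
      by blast
    define U1 where "U1 = [a..<a + Suc j] @ shift a j X"
    have "param_word (a + Suc j) (a + Suc j + n1) (shift a j X)"
      using param_word_shift[OF X(1), of a j] by (simp add: algebra_simps)
    then have "param_word a (a + Suc j + n1) U1"
      unfolding U1_def param_word_append using param_word_params[of a "Suc j"] by blast
    moreover have "length U1 = j + Suc n" unfolding U1_def using X(2) by (simp del: upt_Suc)
    ultimately have U1: "param_word a (a + (Suc j + n1)) U1" "length U1 = j + Suc n"
      by (simp_all only: add.assoc)
    have act_U1: "act a (p @ a # w) U1 = p @ a # act (Suc a) w X" if pj: "length p = j" for p w
      using act_params[of a "p @ [a]" w] act_shift[OF pj, of a "a # w" X] pj
      by (simp add: U1_def act_append act_new_constant del: upt_Suc)
    have "\<forall>w. c (act a w U1) < r" using c by simp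
    from n1[OF this] obtain U2 where U2: "param_word a (a + Suc j + l) U2" "length U2 = Suc j + n1"
      "take (Suc j) U2 = [a..<a + Suc j]"
      "prefix_determines (\<lambda>w. c (act a w U1)) a k (Suc j) (Suc j + l) U2"
      by blast
    define Y where "Y = drop (Suc j) U2"
    have U2Y: "U2 = [a..<a + Suc j] @ Y" using U2(3) unfolding Y_def by (metis append_take_drop_id)
    have Y: "param_word (a + Suc j) (a + Suc j + l) Y"
    proof -
      obtain b where b: "param_word a b [a..<a + Suc j]" "param_word b (a + Suc j + l) Y"
        using U2(1) unfolding U2Y param_word_append by blast
      have "b = a + Suc j"
      proof -
        have uniq: "b1 = b2" if "param_word x b1 u" "param_word x b2 u" for x b1 b2 u
          using that by (induction u arbitrary: x) auto
        show ?thesis using uniq[OF b(1) param_word_params[of a "Suc j"]] .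
      qed
      then show ?thesis using b(2) by simp
    qed
    have lenY: "length Y = n1" using U2(2) by (simp add: Y_def)
    have actact: "act a v (act a U2 U1) = act a (act a v U2) U1" for v
      by (rule act_act) (use param_word_letters[OF U1(1)] U2(2) in auto)
    have fst: "c (act a (p @ a # w) (act a U2 U1)) = c (act a (p @ a # w') (act a U2 U1))"
      if p: "set p \<subseteq> {..<a}" "length p = j" and w: "param_word (Suc a) k w" "param_word (Suc a) k w'"
        "length w = l" "length w' = l" for p w w'
    proof -
      have A: "\<exists>w1. act a (p @ a # w) U2 = p @ a # w1 \<and> param_word (Suc a) k w1 \<and> length w1 = n1"
        if w: "param_word (Suc a) k w" "length w = l" for w
      proof (intro exI conjI)
        have "map ((!) ([0..<a] @ p @ a # w)) [a..<a + Suc j] = p @ [a]"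
          using act_params[of a "p @ [a]" w] p(2) by (simp add: act_def del: upt_Suc)
        then show "act a (p @ a # w) U2 = p @ a # map ((!) (([0..<a] @ p @ [a]) @ w)) Y"
          unfolding act_def U2Y map_append by simp
        show "param_word (Suc a) k (map ((!) (([0..<a] @ p @ [a]) @ w)) Y)"
          by (rule param_word_subst[OF Y]) (use p w in auto)
        show "length (map ((!) (([0..<a] @ p @ [a]) @ w)) Y) = n1" using lenY by simp
      qed
      obtain w1 where w1: "act a (p @ a # w) U2 = p @ a # w1" "param_word (Suc a) k w1" "length w1 = n1"
        using A[OF w(1,3)] by blast
      obtain w2 where w2: "act a (p @ a # w') U2 = p @ a # w2" "param_word (Suc a) k w2" "length w2 = n1"
        using A[OF w(2,4)] by blast
      have "e (\<lambda>p. c (p @ a # act (Suc a) w1 X)) = e (\<lambda>p. c (p @ a # act (Suc a) w2 X))"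
        using X(3) w1 w2 by metis
      then have "c (p @ a # act (Suc a) w1 X) = c (p @ a # act (Suc a) w2 X)"
        by (rule codes_colourings_eqD[OF e]) (use c p in \<open>auto simp: words_def\<close>)
      then show ?thesis unfolding actact w1(1) w2(1) using act_U1[OF p(2)] by simp
    qed
    show "\<exists>U. param_word a (a + j + Suc l) U \<and> length U = j + Suc n \<and> take j U = [a..<a + j] \<and>
     prefix_determines c a k j (j + Suc l) U"
    proof (intro exI[of _ "act a U2 U1"] conjI)
      show "param_word a (a + j + Suc l) (act a U2 U1)"
        by (rule param_word_act) (use U1 U2 in auto)
      show "length (act a U2 U1) = j + Suc n" using U1(2) by simp
      have "act a U2 [a..<a + Suc j] = [a..<a + Suc j]"
        using act_params[of a "[a..<a + Suc j]" Y] unfolding U2Y by (simp del: upt_Suc)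
      then have "act a U2 U1 = [a..<a + Suc j] @ act a U2 (shift a j X)"
        unfolding U1_def act_append by simp
      then show "take j (act a U2 U1) = [a..<a + j]" by simp
      show "prefix_determines c a k j (j + Suc l) (act a U2 U1)"
        unfolding prefix_determines_def
      proof (intro allI impI)
        fix p w w' assume H: "set p \<subseteq> {..<a}" "j \<le> length p"
         "param_word (Suc a) k w" "param_word (Suc a) k w'"
         "length p + Suc (length w) = j + Suc l" "length w' = length w"
        show "c (act a (p @ a # w) (act a U2 U1)) = c (act a (p @ a # w') (act a U2 U1))"
        proof (cases "length p = j")
          case True
          then show ?thesis using fst[of p w w'] H by simp
        next
          case False
          then show ?thesis unfolding actact
            using prefix_determinesD[OF U2(4), of p w w'] H by simp
        qed
      qed
    qed
  qed
qed

text \<open>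
After fusion the colour of a word depends only on the constants before its first parameter, and the
colouring of these prefixes is made constant by a further substitution.
\<close>

lemma Graham_Rothschild_step:
  assumes ak: "a < k" and GR: "Graham_Rothschild_property (Suc a) k"
  shows "Graham_Rothschild_property a k"
  unfolding Graham_Rothschild_property_def
proof (intro allI)
  fix d r :: nat
  obtain M where M: "\<And>c. (\<forall>w. c w < r) \<Longrightarrow> (\<exists>W col. param_word a (a + d) W \<and> length W = M \<and>
    (\<forall>i<d. \<forall>q\<in>words a i. c (act a q (before (a + i) W)) = col))"
    using prefix_colouring[of r a d] by blast
  obtain n where n: "\<And>c. (\<forall>w. c w < r) \<Longrightarrow> (\<exists>U. param_word a (a + M) U \<and> length U = n \<and>
    prefix_determines c a k 0 M U)"
    using fusion[OF GR, of r 0 M] by auto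
  show "\<exists>n. \<forall>c. (\<forall>w. c w < r) \<longrightarrow>
     (\<exists>U (col :: nat). param_word a (a + d) U \<and> length U = n \<and>
        (\<forall>v. param_word a k v \<longrightarrow> length v = d \<longrightarrow> c (act a v U) = col))"
  proof (intro exI[of _ n] allI impI)
    fix c :: "nat list \<Rightarrow> nat"
    assume c: "\<forall>w. c w < r"
    obtain U where U: "param_word a (a + M) U" "length U = n"
      "prefix_determines c a k 0 M U"
      using n[OF c] by blast
    \<comment> \<open>Some completion of \<open>p\<close>, of the length that is needed; by the choice of \<open>U\<close> all have the same colour.\<close>
    define rest where "rest p = (SOME w. param_word (Suc a) k w \<and> length p + Suc (length w) = M)" for p :: "nat list"
    have "\<forall>p. c (act a (p @ a # rest p) U) < r" using c by simp
    from M[OF this] obtain W col where W: "param_word a (a + d) W" "length W = M"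
      "\<And>i q. i < d \<Longrightarrow> q \<in> words a i \<Longrightarrow>
         c (act a (act a q (before (a + i) W) @ a # rest (act a q (before (a + i) W))) U) = col" by blast
    show "\<exists>U (col :: nat). param_word a (a + d) U \<and> length U = n \<and>
        (\<forall>v. param_word a k v \<longrightarrow> length v = d \<longrightarrow> c (act a v U) = col)"
    proof (intro exI[of _ "act a W U"] exI[of _ col] conjI allI impI)
      show "param_word a (a + d) (act a W U)" by (rule param_word_act) (use U W in auto)
      show "length (act a W U) = n" using U(2) by simp
      fix v assume v: "param_word a k v" "length v = d"
      obtain w where w: "v = before a v @ a # w" "param_word a a (before a v)" "param_word (Suc a) k w"
        by (rule param_word_split[OF v(1), of a]) (use ak in auto)
      define q where "q = before a v"
      define i where "i = length q"
      have q: "q \<in> words a i" "set q \<subseteq> {..<a}"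
        using w(2) by (auto simp: words_def q_def i_def param_word_const_iff)
      have vq: "v = q @ a # w" using w(1) by (simp add: q_def)
      have i: "i < d" "length w = d - Suc i" using v(2) vq by (auto simp: i_def)
      obtain W2 where W2: "W = before (a + i) W @ (a + i) # W2" "param_word a (a + i) (before (a + i) W)"
        "param_word (Suc (a + i)) (a + d) W2"
        by (rule param_word_split[OF W(1), of "a + i"]) (use i in auto)
      define p where "p = act a q (before (a + i) W)"
      define x where "x = map ((!) (([0..<a] @ q @ [a]) @ w)) W2"
      have x: "param_word (Suc a) k x" unfolding x_def
        by (rule param_word_subst[OF W2(3)]) (use q w(3) i in \<open>auto simp: i_def\<close>)
      have "act a v W = act a v (before (a + i) W @ (a + i) # W2)" using W2(1) by simp
      also have "\<dots> = act a v (before (a + i) W) @ v ! i # act a v W2"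
        by (simp add: act_append act_Cons)
      also have "act a v (before (a + i) W) = p" unfolding vq p_def
        by (rule act_take) (use param_word_letters[OF W2(2)] in \<open>simp add: i_def\<close>)
      also have "v ! i = a" by (simp add: vq i_def)
      also have "act a v W2 = x" by (simp add: x_def act_def vq)
      finally have vW: "act a v W = p @ a # x" .
      have len: "length p + Suc (length x) = M"
        using arg_cong[OF vW, of length] W(2) by simp
      have p: "set p \<subseteq> {..<a}"
        unfolding p_def by (rule set_act_consts) (use param_word_letters[OF W2(2)] q in \<open>auto simp: i_def\<close>)
      have "\<exists>w. param_word (Suc a) k w \<and> length p + Suc (length w) = M" using x len by blast
      then have rest: "param_word (Suc a) k (rest p)" "length p + Suc (length (rest p)) = M"
        unfolding rest_def by (metis (mono_tags, lifting) someI_ex)+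
      have "act a v (act a W U) = act a (p @ a # x) U"
        unfolding vW[symmetric] by (rule act_act) (use param_word_letters[OF U(1)] W(2) in auto)
      also have "c \<dots> = c (act a (p @ a # rest p) U)"
        by (rule prefix_determinesD[OF U(3)]) (use p x rest len in auto)
      also have "\<dots> = col" using W(3)[OF i(1) q(1)] by (simp add: p_def)
      finally show "c (act a v (act a W U)) = col" .
    qed
  qed
qed

lemma Graham_Rothschild:
  assumes "a \<le> k"
  shows "Graham_Rothschild_property a k"
  using assms
proof (induction rule: inc_induct)
  case base
  show ?case unfolding Graham_Rothschild_property_def
  proof (intro allI)
    fix d r :: nat
    obtain n where n: "\<And>c. (\<forall>w. c w < r) \<Longrightarrow> (\<exists>U. param_word k (k + d) U \<and> length U = n \<and>
    (\<forall>w\<in>words k d. \<forall>w'\<in>words k d. c (act k w U) = c (act k w' U)))"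
      using Hales_Jewett[of r k d] by blast
    show "\<exists>n. \<forall>c. (\<forall>w. c w < r) \<longrightarrow>
     (\<exists>U (col :: nat). param_word k (k + d) U \<and> length U = n \<and>
        (\<forall>v. param_word k k v \<longrightarrow> length v = d \<longrightarrow> c (act k v U) = col))"
    proof (intro exI[of _ n] allI impI)
      fix c :: "nat list \<Rightarrow> nat"
      assume "\<forall>w. c w < r"
      then obtain U where U: "param_word k (k + d) U" "length U = n"
        "\<forall>w\<in>words k d. \<forall>w'\<in>words k d. c (act k w U) = c (act k w' U)" using n by blast
      have W: "param_word k k v \<longrightarrow> length v = d \<longrightarrow> v \<in> words k d" for v
        by (simp add: param_word_const_iff words_def)
      have "\<exists>col. \<forall>w\<in>words k d. c (act k w U) = col" using U(3) by blast
      then show "\<exists>U (col :: nat). param_word k (k + d) U \<and> length U = n \<and>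
        (\<forall>v. param_word k k v \<longrightarrow> length v = d \<longrightarrow> c (act k v U) = col)"
        using U(1,2) W by blast
    qed
  qed
next
  case (step a)
  show ?case by (rule Graham_Rothschild_step[OF step.hyps(2) step.IH])
qed

text \<open>
The case of the empty alphabet: \<open>U\<close> and \<open>v\<close> are rigid surjections and \<open>map ((!) v) U\<close> is their composite.
\<close>

lemma finite_dual_Ramsey:
  fixes r :: nat
  shows "\<exists>n. \<forall>c. (\<forall>w. c w < r) \<longrightarrow> (\<exists>U col. param_word 0 m U \<and> length U = n \<and>
    (\<forall>v. param_word 0 k v \<longrightarrow> length v = m \<longrightarrow> c (map ((!) v) U) = col))"
  using Graham_Rothschild[of 0 k, OF le0, unfolded Graham_Rothschild_property_def, THEN spec, THEN spec, of r m]
  by (simp only: act_def upt_0 append_Nil add_0)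

section \<open>Convexity in terms of negligible distances\<close>

lemma nsum_0 [simp]: "nsum 0 x = 0"
  by (simp add: nsum_def)

lemma nsum_Suc: "nsum (Suc n) x = nsum n x + x"
  by (simp add: nsum_def)

lemma nsum_1 [simp]: "nsum (Suc 0) x = x"
  by (simp add: nsum_Suc)

lemma nsum_add: "nsum (m + n) x = nsum m x + nsum n x"
  by (induction n) (simp_all add: nsum_Suc add.assoc)

lemma nsum_nsum: "nsum m (nsum n x) = nsum (m * n) x"
  by (induction m) (simp_all add: nsum_Suc nsum_add ac_simps)

lemma nsum_mono: "x \<le> y \<Longrightarrow> nsum n x \<le> nsum n y"
  by (induction n) (simp_all add: nsum_Suc add_mono)

lemma le_add_left: "(x :: 'm::distance_monoid) \<le> y + x"
  using add_mono[OF zero_least[of y] order_refl[of x]] by simp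

lemma le_add_right: "(x :: 'm::distance_monoid) \<le> x + y"
  using le_add_left[of x y] by (simp add: add.commute)

lemma le_zero [simp]: "(x :: 'm::distance_monoid) \<le> 0 \<longleftrightarrow> x = 0"
  using zero_least[of x] by auto

lemma nsum_zero [simp]: "nsum n 0 = 0"
  by (induction n) (simp_all add: nsum_Suc)

text \<open>
For \<open>y \<noteq> 0\<close> this says that \<open>x\<close> lies in a lower archimedean class than \<open>y\<close>. Blocks enter all further
arguments only through this relation.
\<close>

definition negligible :: "'m::distance_monoid \<Rightarrow> 'm \<Rightarrow> bool" where
  "negligible x y \<longleftrightarrow> (\<forall>n. nsum n x < y)"

lemma not_negligible: "\<not> negligible x y \<longleftrightarrow> (\<exists>n. y \<le> nsum n x)"
  by (auto simp: negligible_def not_less)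

lemma negligible_irrefl [simp]: "\<not> negligible x x"
  unfolding not_negligible by (rule exI[of _ "Suc 0"]) simp

lemma negligible_less: "negligible x y \<Longrightarrow> x < y"
  unfolding negligible_def by (drule spec[of _ "Suc 0"]) simp

lemma negligible_mono: "negligible x y \<Longrightarrow> x' \<le> x \<Longrightarrow> y \<le> y' \<Longrightarrow> negligible x' y'"
  unfolding negligible_def using nsum_mono[of x' x] by (blast intro: le_less_trans less_le_trans)

lemma negligible_nsum: "negligible x y \<Longrightarrow> negligible (nsum n x) y"
  by (simp add: negligible_def nsum_nsum)

lemma negligible_add:
  assumes "negligible x z" "negligible y z"
  shows "negligible (x + y) z"
proof -
  have "negligible (nsum 2 (max x y)) z"
    using assms by (intro negligible_nsum) (simp add: max_def)
  moreover have "x + y \<le> nsum 2 (max x y)"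
    by (simp add: numeral_2_eq_2 nsum_Suc add_mono)
  ultimately show ?thesis using negligible_mono by blast
qed

lemma negligible_zero_iff: "negligible 0 x \<longleftrightarrow> x \<noteq> 0"
  using zero_least[of x] by (auto simp: negligible_def less_le)

text \<open>
Distances that agree up to a negligible amount have the same negligible elements. The proof rests on
sums of negligible elements being negligible.
\<close>

lemma negligible_shift:
  assumes x: "negligible x D" and D: "D \<le> x + D'" and D': "D' \<le> x + D"
  shows "negligible y D \<longleftrightarrow> negligible y D'"
proof
  assume y: "negligible y D"
  show "negligible y D'"
  proof (rule ccontr)
    assume "\<not> negligible y D'"
    then obtain n where "D' \<le> nsum n y" by (auto simp: not_negligible)
    then have "D \<le> x + nsum n y" using D add_left_mono order_trans by blast
    moreover have "x + nsum n y < D" by (intro negligible_less negligible_add negligible_nsum x y)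
    ultimately show False by simp
  qed
next
  assume y: "negligible y D'"
  show "negligible y D"
  proof (rule ccontr)
    assume "\<not> negligible y D"
    then obtain n where n: "D \<le> nsum n y" by (auto simp: not_negligible)
    have "x \<le> D" using negligible_less[OF x] by simp
    then have "D' \<le> D + D" using D' add_right_mono order_trans by blast
    also have "\<dots> \<le> nsum (n + n) y" unfolding nsum_add by (intro add_mono n)
    finally show False using y by (metis negligible_def not_le)
  qed
qed

text \<open>
The hypotheses place \<open>D1\<close> and \<open>D2\<close> in the same archimedean class.
\<close>

lemma negligible_equiv:
  assumes "\<not> negligible D1 D2" "\<not> negligible D2 D1"
  shows "negligible y D1 \<longleftrightarrow> negligible y D2"
proof -
  have "negligible y E" if "negligible y D" "\<not> negligible E D" for D E
  proof (rule ccontr)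
    assume "\<not> negligible y E"
    then obtain n where "E \<le> nsum n y" by (auto simp: not_negligible)
    then show False using that negligible_mono[OF negligible_nsum] by blast
  qed
  then show ?thesis using assms by blast
qed

text \<open>
Convexity is expressed by negligible distances in place of blocks; the two are compared in lemma
\<open>convexly_ordered_metric_space_iff\<close>.
\<close>

locale convex_metric =
  fixes P :: "'a set" and d :: "'a \<Rightarrow> 'a \<Rightarrow> 'm::distance_monoid" and R :: "('a \<times> 'a) set"
  assumes metric: "metric_on P d"
    and linear: "linear_order_on P R"
    and convex: "\<And>a b c. a \<in> P \<Longrightarrow> b \<in> P \<Longrightarrow> c \<in> P \<Longrightarrow> negligible (d a b) (d a c) \<Longrightarrow>
      (a, c) \<in> R \<longleftrightarrow> (b, c) \<in> R"
begin

lemma dist_eq_0: "a \<in> P \<Longrightarrow> b \<in> P \<Longrightarrow> d a b = 0 \<longleftrightarrow> a = b"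
  using metric by (simp add: metric_on_def)

lemma dist_commute: "a \<in> P \<Longrightarrow> b \<in> P \<Longrightarrow> d a b = d b a"
  using metric by (simp add: metric_on_def)

lemma triangle: "a \<in> P \<Longrightarrow> b \<in> P \<Longrightarrow> c \<in> P \<Longrightarrow> d a c \<le> d a b + d b c"
  using metric by (simp add: metric_on_def)

lemma order_refl: "a \<in> P \<Longrightarrow> (a, a) \<in> R"
  using linear by (auto simp: order_on_defs refl_on_def)

lemma order_antisym: "(a, b) \<in> R \<Longrightarrow> (b, a) \<in> R \<Longrightarrow> a = b"
  using linear by (auto simp: order_on_defs antisym_def)

lemma order_trans: "(a, b) \<in> R \<Longrightarrow> (b, c) \<in> R \<Longrightarrow> (a, c) \<in> R"
  using linear by (auto simp: order_on_defs dest: transD)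

lemma order_total: "a \<in> P \<Longrightarrow> b \<in> P \<Longrightarrow> (a, b) \<in> R \<or> (b, a) \<in> R"
  using linear order_refl by (cases "a = b") (auto simp: order_on_defs total_on_def)

lemma order_first:
  assumes "finite A" "A \<noteq> {}" "A \<subseteq> P"
  shows "\<exists>x\<in>A. \<forall>y\<in>A. (x, y) \<in> R"
  using assms
proof (induction rule: finite_ne_induct)
  case (singleton x)
  then show ?case using order_refl by auto
next
  case (insert x F)
  then obtain m where m: "m \<in> F" "\<forall>y\<in>F. (m, y) \<in> R" by auto
  have "(x, m) \<in> R \<or> (m, x) \<in> R" using order_total m(1) insert.prems by blast
  then show ?case
  proof
    assume "(x, m) \<in> R"
    then have "\<forall>y\<in>insert x F. (x, y) \<in> R" using m order_trans order_refl insert.prems by blast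
    then show ?thesis by blast
  next
    assume "(m, x) \<in> R"
    then show ?thesis using m by blast
  qed
qed

text \<open>
As \<open>d x y\<close> is not negligible against \<open>D\<close>, the distance \<open>d x x'\<close> is negligible even against \<open>d x y\<close>, and
convexity applies.
\<close>

lemma far_from_near:
  assumes P: "x \<in> P" "x' \<in> P" "y \<in> P" and near: "negligible (d x x') D" and far: "\<not> negligible (d x y) D"
  shows "(x, y) \<in> R \<longleftrightarrow> (x', y) \<in> R" "x' \<noteq> y" "\<not> negligible (d x' y) D"
proof -
  have "negligible (d x x') (d x y)"
  proof (rule ccontr)
    assume "\<not> ?thesis"
    then obtain n where "d x y \<le> nsum n (d x x')" unfolding not_negligible by blast
    then have "negligible (d x y) D" by (rule negligible_mono[OF negligible_nsum[OF near] _ order.refl])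
    then show False using far by blast
  qed
  then show "(x, y) \<in> R \<longleftrightarrow> (x', y) \<in> R" by (rule convex[OF P])
  show "x' \<noteq> y" using near far by blast
  show "\<not> negligible (d x' y) D"
    using far negligible_mono[OF negligible_add[OF near] triangle[OF P(1,2,3)]] by blast
qed

end

text \<open>
The block of \<open>\<beta>\<close>, for \<open>\<beta> \<noteq> 0\<close>.
\<close>

definition archimedean_class :: "'m::distance_monoid \<Rightarrow> 'm set" where
  "archimedean_class \<beta> = {r. \<not> negligible \<beta> r \<and> \<not> negligible r \<beta>}"

lemma block_archimedean_class:
  assumes \<beta>: "\<beta> \<noteq> 0"
  shows "block (archimedean_class \<beta>)"
proof -
  let ?B = "archimedean_class \<beta>"
  have 0: "0 \<notin> ?B" using \<beta> by (simp add: archimedean_class_def negligible_zero_iff)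
  have sum: "r + s \<in> ?B" if rs: "r \<in> ?B" "s \<in> ?B" for r s
  proof -
    obtain k l where kl: "r \<le> nsum k \<beta>" "s \<le> nsum l \<beta>"
      using rs by (auto simp: archimedean_class_def not_negligible)
    then have "r + s \<le> nsum (k + l) \<beta>" unfolding nsum_add by (rule add_mono)
    moreover have "\<not> negligible (r + s) \<beta>"
      using rs negligible_mono[OF _ le_add_right[of r s] order.refl] by (auto simp: archimedean_class_def)
    ultimately show ?thesis unfolding archimedean_class_def not_negligible by blast
  qed
  have arch: "\<exists>n>0. s \<le> nsum n r" if rs: "r \<in> ?B" "s \<in> ?B" for r s
  proof -
    obtain k m where km: "s \<le> nsum k \<beta>" "\<beta> \<le> nsum m r"
      using rs by (auto simp: archimedean_class_def not_negligible)
    have "s \<le> nsum k (nsum m r)" using km(1) nsum_mono[OF km(2)] by (rule order.trans)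
    also have "\<dots> \<le> nsum (Suc (k * m)) r" unfolding nsum_nsum nsum_Suc by (rule le_add_right)
    finally show ?thesis by blast
  qed
  have "archimedean_submonoid (insert 0 ?B)"
    unfolding archimedean_submonoid_def
  proof (intro conjI ballI impI)
    show "r + s \<in> insert 0 ?B" if "r \<in> insert 0 ?B" "s \<in> insert 0 ?B" for r s
      using that sum[of r s] by auto
    show "\<exists>n>0. s \<le> nsum n r" if "r \<in> insert 0 ?B" "s \<in> insert 0 ?B" "r \<noteq> 0" "s \<noteq> 0" for r s
      using that arch[of r s] by auto
  qed simp
  moreover have "T = insert 0 ?B" if T: "archimedean_submonoid T" "insert 0 ?B \<subseteq> T" for T
  proof -
    have "\<beta> \<in> T" using T(2) by (auto simp: archimedean_class_def)
    then have "t \<in> ?B" if "t \<in> T" "t \<noteq> 0" for t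
      using T(1) that \<beta> unfolding archimedean_submonoid_def archimedean_class_def not_negligible by blast
    then show ?thesis using T(2) by blast
  qed
  ultimately show ?thesis using 0 unfolding block_def maximal_archimedean_submonoid_def by blast
qed

text \<open>
Convexity without blocks. If \<open>d a b\<close> is negligible against \<open>d a c\<close>, then the block of \<open>d a b\<close> joins \<open>a\<close>
to \<open>b\<close> and not to \<open>c\<close>. Conversely, a block that joins \<open>a\<close> to \<open>b\<close> contains all multiples of a bound of
\<open>d a b\<close>, so if it does not join \<open>a\<close> to \<open>c\<close>, these multiples stay below \<open>d a c\<close>.
\<close>

lemma convexly_ordered_metric_space_iff:
  "convexly_ordered_metric_space X \<longleftrightarrow> convex_metric (points X) (mdist X) (ordering X)"
proof
  assume X: "convexly_ordered_metric_space X"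
  show "convex_metric (points X) (mdist X) (ordering X)"
  proof
    show m: "metric_on (points X) (mdist X)" and "linear_order_on (points X) (ordering X)"
      using X by (auto simp: convexly_ordered_metric_space_def)
    fix a b c assume P: "a \<in> points X" "b \<in> points X" "c \<in> points X"
      and neg: "negligible (mdist X a b) (mdist X a c)"
    show "(a, c) \<in> ordering X \<longleftrightarrow> (b, c) \<in> ordering X"
    proof (cases "a = b")
      case False
      define \<beta> where "\<beta> = mdist X a b"
      have "\<beta> \<noteq> 0" using False m P by (auto simp: \<beta>_def metric_on_def)
      then have B: "block (archimedean_class \<beta>)" by (rule block_archimedean_class)
      have "\<beta> \<in> archimedean_class \<beta>" by (simp add: archimedean_class_def)
      then have ab: "block_equiv (mdist X) (archimedean_class \<beta>) a b"
        unfolding block_equiv_def \<beta>_def[symmetric] by (rule bexI[rotated]) simp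
      have ac: "\<not> block_equiv (mdist X) (archimedean_class \<beta>) a c"
      proof
        assume "block_equiv (mdist X) (archimedean_class \<beta>) a c"
        then obtain r where "\<not> negligible \<beta> r" "mdist X a c \<le> r"
          by (auto simp: block_equiv_def archimedean_class_def)
        then show False using negligible_mono[OF neg] unfolding \<beta>_def by blast
      qed
      show ?thesis
        using X[unfolded convexly_ordered_metric_space_def, THEN conjunct2, THEN conjunct2, rule_format,
            OF B P ab ac] .
    qed simp
  qed
next
  assume "convex_metric (points X) (mdist X) (ordering X)"
  then interpret convex_metric "points X" "mdist X" "ordering X" .
  show "convexly_ordered_metric_space X"
    unfolding convexly_ordered_metric_space_def
  proof (intro conjI allI ballI impI metric linear)
    fix B a b c assume B: "block B" and P: "a \<in> points X" "b \<in> points X" "c \<in> points X"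
      and ab: "block_equiv (mdist X) B a b" and ac: "\<not> block_equiv (mdist X) B a c"
    obtain \<beta> where \<beta>: "\<beta> \<in> B" "mdist X a b \<le> \<beta>" using ab by (auto simp: block_equiv_def)
    have above: "\<gamma> < mdist X a c" if "\<gamma> \<in> B" for \<gamma> using ac that by (auto simp: block_equiv_def)
    have sum: "r + s \<in> insert 0 B" if "r \<in> insert 0 B" "s \<in> insert 0 B" for r s
      using B that by (auto simp: block_def maximal_archimedean_submonoid_def archimedean_submonoid_def)
    have "nsum n \<beta> \<in> insert 0 B" for n
      by (induction n) (use sum \<beta>(1) in \<open>auto simp: nsum_Suc\<close>)
    moreover have "\<gamma> < mdist X a c" if "\<gamma> \<in> insert 0 B" for \<gamma>
      using that above[of \<gamma>] above[OF \<beta>(1)] zero_least[of \<beta>] by auto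
    ultimately have "negligible \<beta> (mdist X a c)" by (simp add: negligible_def)
    then show "(a, c) \<in> ordering X \<longleftrightarrow> (b, c) \<in> ordering X"
      by (intro convex P negligible_mono[OF _ \<beta>(2)]) auto
  qed
qed

section \<open>Powers of convexly ordered spaces\<close>

definition sup_dist :: "nat \<Rightarrow> ('a \<Rightarrow> 'a \<Rightarrow> 'm::distance_monoid) \<Rightarrow> 'a list \<Rightarrow> 'a list \<Rightarrow> 'm" where
  "sup_dist n d w w' = Max (insert 0 ((\<lambda>i. d (w ! i) (w' ! i)) ` {..<n}))"

lemma sup_dist_ge: "i < n \<Longrightarrow> d (w ! i) (w' ! i) \<le> sup_dist n d w w'"
  unfolding sup_dist_def by (rule Max_ge) auto

lemma sup_dist_leI: "(\<And>i. i < n \<Longrightarrow> d (w ! i) (w' ! i) \<le> z) \<Longrightarrow> sup_dist n d w w' \<le> z"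
  unfolding sup_dist_def by (rule Max.boundedI) (auto simp: zero_least)

lemma sup_dist_attained:
  "sup_dist n d w w' \<noteq> 0 \<Longrightarrow> \<exists>i<n. d (w ! i) (w' ! i) = sup_dist n d w w'"
proof -
  assume "sup_dist n d w w' \<noteq> 0"
  moreover have "sup_dist n d w w' \<in> insert 0 ((\<lambda>i. d (w ! i) (w' ! i)) ` {..<n})"
    unfolding sup_dist_def by (rule Max_in) auto
  ultimately show ?thesis by auto
qed

text \<open>
The plain lexicographic order is not convex, because a negligible difference in an early coordinate
would decide between words that are far apart. The deciding coordinate is therefore the first one in
which the difference is not negligible against the distance of the words.
\<close>

definition block_lex ::
  "nat \<Rightarrow> ('a \<Rightarrow> 'a \<Rightarrow> 'm::distance_monoid) \<Rightarrow> ('a \<times> 'a) set \<Rightarrow> 'a list \<Rightarrow> 'a list \<Rightarrow> bool" where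
  "block_lex n d R w w' \<longleftrightarrow>
     (\<exists>i<n. w ! i \<noteq> w' ! i \<and> (w ! i, w' ! i) \<in> R \<and>
        \<not> negligible (d (w ! i) (w' ! i)) (sup_dist n d w w') \<and>
        (\<forall>j<i. negligible (d (w ! j) (w' ! j)) (sup_dist n d w w')))"

definition power_space :: "nat \<Rightarrow> ('a, 'm::distance_monoid) ordered_space \<Rightarrow> ('a list, 'm) ordered_space" where
  "power_space n X = \<lparr>points = {w. length w = n \<and> set w \<subseteq> points X},
     mdist = sup_dist n (mdist X),
     ordering = {(w, w'). length w = n \<and> set w \<subseteq> points X \<and> length w' = n \<and> set w' \<subseteq> points X \<and>
       (w = w' \<or> block_lex n (mdist X) (ordering X) w w')}\<rparr>"

context convex_metric
begin

definition tuples :: "nat \<Rightarrow> 'a list set" where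
  "tuples n = {w. length w = n \<and> set w \<subseteq> P}"

lemma tuples_nth: "w \<in> tuples n \<Longrightarrow> i < n \<Longrightarrow> w ! i \<in> P"
  using nth_mem by (auto simp: tuples_def)

lemma metric_sup_dist: "metric_on (tuples n) (sup_dist n d)"
  unfolding metric_on_def
proof (intro conjI ballI)
  fix v w assume vw: "v \<in> tuples n" "w \<in> tuples n"
  note nth = tuples_nth[OF vw(1)] tuples_nth[OF vw(2)]
  show "sup_dist n d v w = 0 \<longleftrightarrow> v = w"
  proof
    assume "sup_dist n d v w = 0"
    then have "d (v ! i) (w ! i) = 0" if "i < n" for i using sup_dist_ge[OF that, of d v w] by simp
    then show "v = w" using vw nth by (intro nth_equalityI) (auto simp: tuples_def dist_eq_0)
  next
    assume "v = w"
    then have "sup_dist n d v w \<le> 0" by (intro sup_dist_leI) (use nth dist_eq_0 in simp)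
    then show "sup_dist n d v w = 0" by simp
  qed
  have "(\<lambda>i. d (v ! i) (w ! i)) ` {..<n} = (\<lambda>i. d (w ! i) (v ! i)) ` {..<n}"
    using nth dist_commute by (intro image_cong) auto
  then show "sup_dist n d v w = sup_dist n d w v" by (simp add: sup_dist_def)
  fix u assume u: "u \<in> tuples n"
  show "sup_dist n d v u \<le> sup_dist n d v w + sup_dist n d w u"
  proof (rule sup_dist_leI)
    fix i assume i: "i < n"
    have "d (v ! i) (u ! i) \<le> d (v ! i) (w ! i) + d (w ! i) (u ! i)"
      using triangle nth tuples_nth[OF u] i by simp
    also have "\<dots> \<le> sup_dist n d v w + sup_dist n d w u"
      by (intro add_mono sup_dist_ge i)
    finally show "d (v ! i) (u ! i) \<le> sup_dist n d v w + sup_dist n d w u" .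
  qed
qed

lemma sup_dist_commute: "v \<in> tuples n \<Longrightarrow> w \<in> tuples n \<Longrightarrow> sup_dist n d v w = sup_dist n d w v"
  using metric_sup_dist by (simp add: metric_on_def)

lemma sup_dist_self: "w \<in> tuples n \<Longrightarrow> sup_dist n d w w = 0"
  using metric_sup_dist by (simp add: metric_on_def)

lemma sup_dist_triangle:
  "u \<in> tuples n \<Longrightarrow> v \<in> tuples n \<Longrightarrow> w \<in> tuples n \<Longrightarrow> sup_dist n d u w \<le> sup_dist n d u v + sup_dist n d v w"
  using metric_sup_dist by (simp add: metric_on_def)

lemma block_lex_total:
  assumes vw: "v \<in> tuples n" "w \<in> tuples n" "v \<noteq> w"
  shows "block_lex n d R v w \<or> block_lex n d R w v"
proof -
  define far where "far i \<longleftrightarrow> i < n \<and> \<not> negligible (d (v ! i) (w ! i)) (sup_dist n d v w)" for i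
  have "sup_dist n d v w \<noteq> 0" using metric_sup_dist vw by (auto simp: metric_on_def)
  then obtain k where "far k" using sup_dist_attained[of n d v w] unfolding far_def by (metis negligible_irrefl)
  define i where "i = (LEAST i. far i)"
  have i: "far i" unfolding i_def using \<open>far k\<close> by (rule LeastI)
  have first: "negligible (d (v ! j) (w ! j)) (sup_dist n d v w)" if "j < i" for j
    using not_less_Least[of j far] that i by (auto simp: far_def i_def)
  have P: "v ! i \<in> P" "w ! i \<in> P" using i vw by (auto simp: far_def tuples_nth)
  have ne: "v ! i \<noteq> w ! i"
    using i dist_eq_0[OF P] negligible_zero_iff[of "sup_dist n d v w"] \<open>sup_dist n d v w \<noteq> 0\<close>
    by (auto simp: far_def)
  have comm: "d (w ! j) (v ! j) = d (v ! j) (w ! j)" if "j < n" for j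
    using that vw by (intro dist_commute) (auto simp: tuples_nth)
  show ?thesis
    using order_total[OF P]
  proof
    assume "(v ! i, w ! i) \<in> R"
    then have "block_lex n d R v w" unfolding block_lex_def using i first ne far_def by blast
    then show ?thesis ..
  next
    assume "(w ! i, v ! i) \<in> R"
    moreover have "negligible (d (w ! j) (v ! j)) (sup_dist n d w v)" if "j < i" for j
      using first[OF that] comm[of j] that i sup_dist_commute[OF vw(2,1)] by (simp add: far_def)
    moreover have "\<not> negligible (d (w ! i) (v ! i)) (sup_dist n d w v)" "i < n"
      using i comm[of i] sup_dist_commute[OF vw(2,1)] by (simp_all add: far_def)
    ultimately have "block_lex n d R w v" unfolding block_lex_def using ne by metis
    then show ?thesis ..
  qed
qed

lemma block_lex_asym:
  assumes vw: "v \<in> tuples n" "w \<in> tuples n" and 1: "block_lex n d R v w"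
  shows "\<not> block_lex n d R w v"
proof
  assume 2: "block_lex n d R w v"
  have comm: "d (w ! j) (v ! j) = d (v ! j) (w ! j)" if "j < n" for j
    using that vw by (intro dist_commute) (auto simp: tuples_nth)
  obtain i where i: "i < n" "v ! i \<noteq> w ! i" "(v ! i, w ! i) \<in> R"
    "\<not> negligible (d (v ! i) (w ! i)) (sup_dist n d v w)"
    "\<And>j. j < i \<Longrightarrow> negligible (d (v ! j) (w ! j)) (sup_dist n d v w)" using 1 unfolding block_lex_def by blast
  obtain k where k: "k < n" "(w ! k, v ! k) \<in> R"
    "\<not> negligible (d (w ! k) (v ! k)) (sup_dist n d w v)"
    "\<And>j. j < k \<Longrightarrow> negligible (d (w ! j) (v ! j)) (sup_dist n d w v)" using 2 unfolding block_lex_def by blast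
  note k' = k(3,4)[unfolded sup_dist_commute[OF vw(2,1)]]
  have "i = k"
  proof (rule linorder_cases[of i k])
    assume "i < k" then show ?thesis using k'(2) i(4) comm[OF i(1)] by metis
  next
    assume "k < i" then show ?thesis using i(5) k'(1) comm[OF k(1)] by metis
  qed
  then show False using i k order_antisym by blast
qed

text \<open>
The coordinate that decides between \<open>u\<close> and \<open>w\<close> also decides between \<open>v\<close> and \<open>w\<close>, since all coordinates of
\<open>u\<close> and \<open>v\<close> are close at this scale.
\<close>

lemma block_lex_near:
  assumes t: "u \<in> tuples n" "v \<in> tuples n" "w \<in> tuples n"
    and near: "negligible (sup_dist n d u v) (sup_dist n d u w)" and uw: "block_lex n d R u w"
  shows "block_lex n d R v w"
proof -
  define D where "D = sup_dist n d u w"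
  have "sup_dist n d v w \<le> sup_dist n d u v + D"
    using sup_dist_triangle[OF t(2,1,3)] sup_dist_commute[OF t(1,2)] by (simp add: D_def)
  then have D: "negligible y (sup_dist n d v w) \<longleftrightarrow> negligible y D" for y
    using negligible_shift[OF near, of "sup_dist n d v w"] sup_dist_triangle[OF t] by (simp add: D_def)
  have near_uv: "negligible (d (u ! j) (v ! j)) D" if "j < n" for j
    using negligible_mono[OF near sup_dist_ge[OF that]] by (simp add: D_def)
  obtain i where i: "i < n" "(u ! i, w ! i) \<in> R"
    "\<not> negligible (d (u ! i) (w ! i)) D"
    "\<And>j. j < i \<Longrightarrow> negligible (d (u ! j) (w ! j)) D" using uw unfolding block_lex_def D_def by blast
  have "negligible (d (v ! j) (w ! j)) D" if j: "j < i" for j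
  proof -
    have "j < n" using i(1) j by simp
    then have "d (v ! j) (w ! j) \<le> d (u ! j) (v ! j) + d (u ! j) (w ! j)"
      using triangle[of "v ! j" "u ! j" "w ! j"] dist_commute[of "v ! j" "u ! j"] t by (simp add: tuples_nth)
    then show ?thesis using negligible_mono[OF negligible_add[OF near_uv i(4)]] \<open>j < n\<close> j by blast
  qed
  moreover have "(u ! i, w ! i) \<in> R \<longleftrightarrow> (v ! i, w ! i) \<in> R" "v ! i \<noteq> w ! i" "\<not> negligible (d (v ! i) (w ! i)) D"
    by (rule far_from_near[OF _ _ _ near_uv[OF i(1)] i(3)]; use t i(1) in \<open>simp add: tuples_nth\<close>)+
  ultimately show ?thesis unfolding block_lex_def D using i(1,2) by blast
qed

lemma block_lex_near_iff:
  assumes t: "u \<in> tuples n" "v \<in> tuples n" "w \<in> tuples n"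
    and near: "negligible (sup_dist n d u v) (sup_dist n d u w)"
  shows "block_lex n d R u w \<longleftrightarrow> block_lex n d R v w" "block_lex n d R w u \<longleftrightarrow> block_lex n d R w v"
proof -
  have "sup_dist n d v w \<le> sup_dist n d u v + sup_dist n d u w"
    using sup_dist_triangle[OF t(2,1,3)] sup_dist_commute[OF t(1,2)] by simp
  then have "negligible (sup_dist n d v u) (sup_dist n d v w)"
    using negligible_shift[OF near, of "sup_dist n d v w"] sup_dist_triangle[OF t] near
      sup_dist_commute[OF t(1,2)] by simp
  then show *: "block_lex n d R u w \<longleftrightarrow> block_lex n d R v w"
    using block_lex_near[OF t near] block_lex_near[OF t(2,1,3)] by blast
  have uw: "u \<noteq> w" using near sup_dist_self[OF t(3)] negligible_less zero_least by (metis leD)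
  have vw: "v \<noteq> w" using near by auto
  show "block_lex n d R w u \<longleftrightarrow> block_lex n d R w v"
    using * block_lex_total[OF t(1,3) uw] block_lex_total[OF t(2,3) vw]
      block_lex_asym[OF t(1,3)] block_lex_asym[OF t(2,3)] block_lex_asym[OF t(3,1)] block_lex_asym[OF t(3,2)]
    by blast
qed

text \<open>
If one of the two distances is negligible against the other, the step of the smaller distance does not
affect the comparison. Otherwise both have the same scale, and the smaller of the two deciding
coordinates decides between \<open>u\<close> and \<open>w\<close>.
\<close>

lemma block_lex_trans:
  assumes t: "u \<in> tuples n" "v \<in> tuples n" "w \<in> tuples n"
    and uv: "block_lex n d R u v" and vw: "block_lex n d R v w"
  shows "block_lex n d R u w"
proof -
  define D where "D = sup_dist n d u v"
  define E where "E = sup_dist n d v w"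
  define F where "F = sup_dist n d u w"
  note DE = sup_dist_commute[OF t(1,2)] sup_dist_commute[OF t(2,3)] sup_dist_commute[OF t(1,3)]
  consider "negligible D E" | "negligible E D" | "\<not> negligible D E" "\<not> negligible E D" by blast
  then show ?thesis
  proof cases
    case 1
    then show ?thesis using block_lex_near_iff(1)[OF t(2,1,3)] vw DE by (simp add: D_def E_def)
  next
    case 2
    then show ?thesis using block_lex_near_iff(2)[OF t(2,3,1)] uv DE by (simp add: D_def E_def)
  next
    case 3
    then have eqv: "negligible y E \<longleftrightarrow> negligible y D" for y using negligible_equiv by blast
    have P: "u ! j \<in> P" "v ! j \<in> P" "w ! j \<in> P" if "j < n" for j using t that by (auto simp: tuples_nth)
    obtain i where i: "i < n" "u ! i \<noteq> v ! i" "(u ! i, v ! i) \<in> R" "\<not> negligible (d (u ! i) (v ! i)) D"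
      "\<And>j. j < i \<Longrightarrow> negligible (d (u ! j) (v ! j)) D" using uv unfolding block_lex_def D_def by blast
    obtain k where k: "k < n" "v ! k \<noteq> w ! k" "(v ! k, w ! k) \<in> R" "\<not> negligible (d (v ! k) (w ! k)) D"
      "\<And>j. j < k \<Longrightarrow> negligible (d (v ! j) (w ! j)) D"
      using vw unfolding block_lex_def E_def[symmetric] eqv by blast
    define m where "m = min i k"
    have m: "m < n" using i(1) by (simp add: m_def)
    have near: "negligible (d (u ! j) (w ! j)) D" if "j < m" for j
    proof -
      have j: "j < i" "j < k" using that by (simp_all add: m_def)
      have jn: "j < n" using j(1) i(1) by simp
      show ?thesis
        by (rule negligible_mono[OF negligible_add[OF i(5)[OF j(1)] k(5)[OF j(2)]] triangle order.refl])
          (rule P[OF jn])+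
    qed
    have far: "(u ! m, w ! m) \<in> R \<and> u ! m \<noteq> w ! m \<and> \<not> negligible (d (u ! m) (w ! m)) D"
    proof (rule linorder_cases[of i k])
      assume ik: "i < k"
      then have mi: "m = i" by (simp add: m_def)
      have n1: "negligible (d (v ! i) (w ! i)) D" using k(5) ik by blast
      have n2: "\<not> negligible (d (v ! i) (u ! i)) D"
        using i(4) dist_commute[OF P(1)[OF i(1)] P(2)[OF i(1)]] by simp
      note * = far_from_near[OF P(2)[OF i(1)] P(3)[OF i(1)] P(1)[OF i(1)] n1 n2]
      have "(v ! i, u ! i) \<notin> R" using i(2,3) order_antisym by blast
      then have "(w ! i, u ! i) \<notin> R" using *(1) by blast
      then have "(u ! i, w ! i) \<in> R" using order_total P[OF i(1)] by blast
      then show ?thesis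
        using *(2,3) dist_commute[OF P(1)[OF i(1)] P(3)[OF i(1)]] unfolding mi by auto
    next
      assume ki: "k < i"
      then have mk: "m = k" by (simp add: m_def)
      have n1: "negligible (d (v ! k) (u ! k)) D" 
        using i(5)[OF ki] dist_commute[OF P(1)[OF k(1)] P(2)[OF k(1)]] by simp
      show ?thesis using far_from_near[OF P(2)[OF k(1)] P(1)[OF k(1)] P(3)[OF k(1)] n1 k(4)] k(3)
        unfolding mk by blast
    next
      assume ik: "i = k"
      then have mi: "m = i" by (simp add: m_def)
      have uw: "(u ! i, w ! i) \<in> R" using i(3) k(3) ik order_trans by blast
      have "\<not> negligible (d (u ! i) (w ! i)) D"
      proof
        assume "negligible (d (u ! i) (w ! i)) D"
        from far_from_near(1)[OF P(1)[OF i(1)] P(3)[OF i(1)] P(2)[OF i(1)] this i(4)]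
        have "(w ! i, v ! i) \<in> R" using i(3) by blast
        then show False using k(2,3) ik order_antisym by blast
      qed
      moreover have "u ! i \<noteq> w ! i" using i(2,3) k(3) ik order_antisym by metis
      ultimately show ?thesis using uw mi by simp
    qed
    have "negligible y F \<longleftrightarrow> negligible y D" for y
    proof (rule negligible_equiv)
      show "\<not> negligible F D"
        using far negligible_mono[OF _ sup_dist_ge[OF m, of d u w] order.refl] by (auto simp: F_def)
      obtain l where l: "E \<le> nsum l D" using 3(1) by (auto simp: not_negligible)
      have "F \<le> D + E" using sup_dist_triangle[OF t] by (simp add: D_def E_def F_def)
      also have "\<dots> \<le> nsum (Suc l) D" using add_mono[OF l order.refl[of D]] by (simp add: nsum_Suc add.commute)
      finally show "\<not> negligible D F" by (auto simp: not_negligible)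
    qed
    then show ?thesis
      unfolding block_lex_def F_def[symmetric] using m near far by blast
  qed
qed

end

lemma convexly_ordered_power_space:
  assumes "convexly_ordered_metric_space X"
  shows "convexly_ordered_metric_space (power_space n X)"
proof -
  interpret convex_metric "points X" "mdist X" "ordering X"
    using assms by (simp add: convexly_ordered_metric_space_iff)
  have pts: "points (power_space n X) = tuples n" by (simp add: power_space_def tuples_def)
  have ord: "(v, w) \<in> ordering (power_space n X) \<longleftrightarrow>
    v \<in> tuples n \<and> w \<in> tuples n \<and> (v = w \<or> block_lex n (mdist X) (ordering X) v w)" for v w
    by (auto simp: power_space_def tuples_def)
  have dist: "mdist (power_space n X) = sup_dist n (mdist X)" by (simp add: power_space_def)
  show ?thesis unfolding convexly_ordered_metric_space_iff pts dist
  proof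
    show "metric_on (tuples n) (sup_dist n (mdist X))" by (rule metric_sup_dist)
    show "linear_order_on (tuples n) (ordering (power_space n X))"
      unfolding linear_order_on_def partial_order_on_def preorder_on_def
    proof (intro conjI)
      show "ordering (power_space n X) \<subseteq> tuples n \<times> tuples n" using ord by auto
      show "refl_on (tuples n) (ordering (power_space n X))" using ord by (auto simp: refl_on_def)
      show "trans (ordering (power_space n X))" 
      proof (rule transI)
        fix u v w assume "(u, v) \<in> ordering (power_space n X)" "(v, w) \<in> ordering (power_space n X)"
        then show "(u, w) \<in> ordering (power_space n X)"
          using block_lex_trans[of u n v w] unfolding ord by blast
      qed
      show "antisym (ordering (power_space n X))" 
      proof (rule antisymI)
        fix v w assume "(v, w) \<in> ordering (power_space n X)" "(w, v) \<in> ordering (power_space n X)"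
        then show "v = w" using block_lex_asym[of v n w] unfolding ord by blast
      qed
      show "total_on (tuples n) (ordering (power_space n X))" using ord block_lex_total by (auto simp: total_on_def)
    qed
    fix a b c assume *: "a \<in> tuples n" "b \<in> tuples n" "c \<in> tuples n"
      "negligible (sup_dist n (mdist X) a b) (sup_dist n (mdist X) a c)"
    then have "b \<noteq> c" by auto
    moreover have "a \<noteq> c"
      using *(4) sup_dist_self[OF *(3)] negligible_less zero_least by (metis leD)
    ultimately show "(a, c) \<in> ordering (power_space n X) \<longleftrightarrow> (b, c) \<in> ordering (power_space n X)"
      using block_lex_near_iff(1)[OF *] *(1-3) unfolding ord by blast
  qed
qed

section \<open>Residuals in finitely generated distance monoids\<close>

inductive_set generated :: "'m::distance_monoid set \<Rightarrow> 'm set" for S where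
  generated_0: "0 \<in> generated S"
| generated_add_gen: "x \<in> generated S \<Longrightarrow> s \<in> S \<Longrightarrow> x + s \<in> generated S"

lemma generated_superset: "s \<in> S \<Longrightarrow> s \<in> generated S"
  using generated_add_gen[OF generated_0] by force

lemma generated_add: "y \<in> generated S \<Longrightarrow> x \<in> generated S \<Longrightarrow> x + y \<in> generated S"
  by (induction rule: generated.induct) (auto simp: add.assoc[symmetric] intro: generated_add_gen)

lemma generated_insert:
  assumes "x \<in> generated (insert s S)"
  shows "\<exists>n. \<exists>y\<in>generated S. x = nsum n s + y"
  using assms
proof induction
  case generated_0
  have "(0 :: 'a) = nsum 0 s + 0" by simp
  then show ?case using generated.generated_0 by blast
next
  case (generated_add_gen x t)
  then obtain n y where y: "y \<in> generated S" "x = nsum n s + y" by blast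
  show ?case
  proof (cases "t = s")
    case True
    then have "x + t = nsum (Suc n) s + y" using y(2) by (simp add: nsum_Suc ac_simps)
    then show ?thesis using y(1) by blast
  next
    case False
    then have "y + t \<in> generated S" using y(1) generated_add_gen by (blast intro: generated.generated_add_gen)
    moreover have "x + t = nsum n s + (y + t)" using y(2) by (simp add: ac_simps)
    ultimately show ?thesis by blast
  qed
qed

lemma nat_increasing_subsequence:
  fixes f :: "nat \<Rightarrow> nat"
  obtains \<phi> where "strict_mono \<phi>" "incseq (f \<circ> \<phi>)"
proof -
  obtain \<phi> where \<phi>: "strict_mono \<phi>" "monoseq (\<lambda>n. f (\<phi> n))" using seq_monosub by blast
  show thesis
  proof (cases "incseq (\<lambda>n. f (\<phi> n))")
    case True
    then show ?thesis using that[OF \<phi>(1)] by (simp add: comp_def)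
  next
    case False
    then have dec: "decseq (\<lambda>n. f (\<phi> n))" using \<phi>(2) by (simp add: monoseq_iff)
    define k where "k = (ARG_MIN (\<lambda>n. f (\<phi> n)) n. True)"
    have k: "f (\<phi> k) \<le> f (\<phi> n)" for n unfolding k_def by (rule arg_min_nat_le) simp
    have "f (\<phi> (k + n)) = f (\<phi> k)" for n
      using decseqD[OF dec, of k "k + n"] k[of "k + n"] by simp
    then have "incseq (f \<circ> (\<lambda>n. \<phi> (k + n)))" by (simp add: incseq_def)
    moreover have "strict_mono (\<lambda>n. \<phi> (k + n))" using \<phi>(1) by (simp add: strict_mono_def)
    ultimately show ?thesis using that by blast
  qed
qed

text \<open>
Dickson's lemma: a sequence of linear combinations has a subsequence along which all coefficients
increase, and sums are monotone in the coefficients.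
\<close>

lemma generated_increasing_subsequence:
  fixes f :: "nat \<Rightarrow> 'm::distance_monoid"
  assumes "finite S" "\<And>i. f i \<in> generated S"
  shows "\<exists>\<phi>. strict_mono \<phi> \<and> incseq (f \<circ> \<phi>)"
  using assms
proof (induction S arbitrary: f rule: finite_induct)
  case empty
  have "x = 0" if "x \<in> generated {}" for x :: 'm using that by induction auto
  then have "f i = 0" for i using empty by blast
  then have "incseq (f \<circ> id)" by (simp add: incseq_def)
  then show ?case using strict_mono_id by blast
next
  case (insert s S)
  have "\<exists>n y. y \<in> generated S \<and> f i = nsum n s + y" for i
    using generated_insert[OF insert.prems[of i]] by blast
  then obtain n y where ny: "\<And>i. y i \<in> generated S" "\<And>i. f i = nsum (n i) s + y i" by metis
  obtain \<phi> where \<phi>: "strict_mono \<phi>" "incseq (y \<circ> \<phi>)" using insert.IH[of y, OF ny(1)] by blast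
  obtain \<psi> where \<psi>: "strict_mono \<psi>" "incseq ((n \<circ> \<phi>) \<circ> \<psi>)"
    using nat_increasing_subsequence[of "n \<circ> \<phi>"] .
  have "f (\<phi> (\<psi> i)) \<le> f (\<phi> (\<psi> j))" if ij: "i \<le> j" for i j
  proof -
    obtain l where "n (\<phi> (\<psi> j)) = n (\<phi> (\<psi> i)) + l"
      using incseqD[OF \<psi>(2) ij] by (auto simp: le_iff_add)
    then have "nsum (n (\<phi> (\<psi> i))) s \<le> nsum (n (\<phi> (\<psi> j))) s" by (simp add: nsum_add le_add_right)
    moreover have "y (\<phi> (\<psi> i)) \<le> y (\<phi> (\<psi> j))"
      using incseqD[OF \<phi>(2), of "\<psi> i" "\<psi> j"] strict_mono_less_eq[OF \<psi>(1)] ij by simp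
    ultimately show ?thesis unfolding ny(2) by (rule add_mono)
  qed
  then have "incseq (f \<circ> (\<phi> \<circ> \<psi>))" by (simp add: incseq_def)
  then show ?case using strict_mono_o[OF \<phi>(1) \<psi>(1)] by blast
qed

locale well_ordered_submonoid =
  fixes W :: "'m::distance_monoid set"
  assumes zero_in: "0 \<in> W"
    and add_in: "\<And>x y. x \<in> W \<Longrightarrow> y \<in> W \<Longrightarrow> x + y \<in> W"
    and has_least: "\<And>Q. Q \<subseteq> W \<Longrightarrow> Q \<noteq> {} \<Longrightarrow> \<exists>m\<in>Q. \<forall>q\<in>Q. m \<le> q"

text \<open>
A strictly descending sequence has no increasing subsequence.
\<close>

lemma well_ordered_generated:
  assumes "finite S"
  shows "well_ordered_submonoid (generated S)"
proof
  show "0 \<in> generated S" by (rule generated_0)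
  show "x + y \<in> generated S" if "x \<in> generated S" "y \<in> generated S" for x y
    using that by (blast intro: generated_add)
  fix Q assume Q: "Q \<subseteq> generated S" "Q \<noteq> {}"
  show "\<exists>m\<in>Q. \<forall>q\<in>Q. m \<le> q"
  proof (rule ccontr)
    assume no: "\<not> ?thesis"
    have "\<exists>f. \<forall>n. f n \<in> Q \<and> f (Suc n) < f n"
      by (rule dependent_nat_choice) (use Q no in \<open>auto simp: not_le\<close>)
    then obtain f where f: "\<And>n. f n \<in> Q" "\<And>n. f (Suc n) < f n" by blast
    obtain \<phi> where \<phi>: "strict_mono \<phi>" "incseq (f \<circ> \<phi>)"
      using generated_increasing_subsequence[OF assms, of f] f(1) Q(1) by blast
    have dec: "f j < f i" if "i < j" for i j
      using that by (induction rule: less_Suc_induct) (use f(2) in auto)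
    have "f (\<phi> 1) < f (\<phi> 0)" using dec \<phi>(1) by (simp add: strict_mono_def)
    moreover have "f (\<phi> 0) \<le> f (\<phi> 1)" using incseqD[OF \<phi>(2), of 0 1] by simp
    ultimately show False by simp
  qed
qed

context well_ordered_submonoid
begin

lemma nsum_in: "x \<in> W \<Longrightarrow> nsum n x \<in> W"
  by (induction n) (auto simp: nsum_Suc zero_in add_in)

text \<open>
The image is well-ordered upwards, being a subset of \<open>W\<close>, and downwards, being an antitone image of \<open>W\<close>.
Concretely, beyond a place where \<open>v\<close> takes its least value it is constant, so finiteness of the image
passes from all proper initial segments of \<open>I\<close> to \<open>I\<close>.
\<close>

lemma finite_antimono_image:
  assumes v: "\<And>x. x \<in> W \<Longrightarrow> v x \<in> W" and anti: "\<And>x y. x \<in> W \<Longrightarrow> y \<in> W \<Longrightarrow> x \<le> y \<Longrightarrow> v y \<le> (v x :: 'm)"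
  shows "finite (v ` W)"
proof -
  have ext: "finite (v ` I)"
    if I: "I \<subseteq> W" and below: "\<And>x. x \<in> I \<Longrightarrow> finite (v ` {y\<in>W. y < x})" for I
  proof (cases "I = {}")
    case False
    have "v ` I \<subseteq> W" using I v by blast
    then obtain m where m: "m \<in> v ` I" "\<forall>q\<in>v ` I. m \<le> q" using has_least[of "v ` I"] False by blast
    then obtain x where x: "x \<in> I" "v x = m" by blast
    have "v ` I \<subseteq> insert m (v ` {y\<in>W. y < x})"
    proof
      fix z assume "z \<in> v ` I"
      then obtain y where y: "y \<in> I" "z = v y" by blast
      show "z \<in> insert m (v ` {y\<in>W. y < x})"
      proof (cases "y < x")
        case False
        then have "x \<le> y" by simp
        then have "v y \<le> m" using anti[of x y] x y I by blast
        moreover have "m \<le> v y" using m(2) y(1) by blast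
        ultimately show ?thesis using y(2) by simp
      qed (use y I in blast)
    qed
    then show ?thesis using below[OF x(1)] finite_subset by blast
  qed simp
  have all: "finite (v ` {y\<in>W. y < x})" if "x \<in> W" for x
  proof (rule ccontr)
    assume "infinite (v ` {y\<in>W. y < x})"
    then have "{x\<in>W. infinite (v ` {y\<in>W. y < x})} \<noteq> {}" using that by blast
    then obtain x0 where x0: "x0 \<in> W" "infinite (v ` {y\<in>W. y < x0})"
      "\<forall>q\<in>{x\<in>W. infinite (v ` {y\<in>W. y < x})}. x0 \<le> q"
      using has_least[of "{x\<in>W. infinite (v ` {y\<in>W. y < x})}"] by blast
    have "finite (v ` {y\<in>W. y < x0})" by (rule ext) (use x0(3) in force)+
    then show False using x0(2) by blast
  qed
  show ?thesis by (rule ext) (use all in auto)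
qed

text \<open>
Truncated subtraction of \<open>e\<close> from \<open>t\<close>, characterised by the adjunction \<open>residual_le_iff\<close>.
\<close>

definition residual :: "'m \<Rightarrow> 'm \<Rightarrow> 'm" where
  "residual t e = (LEAST s. s \<in> W \<and> t \<le> s + e)"

lemma residual_props:
  assumes "t \<in> W"
  shows "residual t e \<in> W \<and> t \<le> residual t e + e \<and> (\<forall>s\<in>W. t \<le> s + e \<longrightarrow> residual t e \<le> s)"
proof -
  have "t \<in> {s\<in>W. t \<le> s + e}" using assms by (simp add: le_add_right)
  then obtain m where m: "m \<in> W" "t \<le> m + e" "\<forall>q\<in>{s\<in>W. t \<le> s + e}. m \<le> q"
    using has_least[of "{s\<in>W. t \<le> s + e}"] by blast
  have "residual t e = m" unfolding residual_def by (rule Least_equality) (use m in auto)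
  then show ?thesis using m by blast
qed

lemma residual_in: "t \<in> W \<Longrightarrow> residual t e \<in> W"
  using residual_props by blast

lemma residual_le_iff: "t \<in> W \<Longrightarrow> s \<in> W \<Longrightarrow> residual t e \<le> s \<longleftrightarrow> t \<le> s + e"
  using residual_props[of t e] add_right_mono[of "residual t e" s e] by (metis order.trans)

lemma residual_le: "t \<in> W \<Longrightarrow> residual t e \<le> t"
  by (simp add: residual_le_iff le_add_right)

lemma residual_0: "t \<in> W \<Longrightarrow> residual t 0 = t"
  by (rule antisym) (use residual_props[of t 0] residual_le in auto)

lemma residual_eq_0: "t \<in> W \<Longrightarrow> t \<le> e \<Longrightarrow> residual t e = 0"
  using residual_le_iff[of t 0 e] zero_in by simp

lemma residual_antimono: "t \<in> W \<Longrightarrow> e \<le> f \<Longrightarrow> residual t f \<le> residual t e"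
  using residual_props[of t e] add_left_mono[of e f "residual t e"]
  by (simp add: residual_le_iff residual_in order.trans[of t "residual t e + e"])

text \<open>
Both sides have the same upper bounds in \<open>W\<close>.
\<close>

lemma residual_residual:
  assumes "t \<in> W" "f \<in> W"
  shows "residual (residual t e) f = residual t (f + e)"
proof -
  have iff: "residual (residual t e) f \<le> s \<longleftrightarrow> residual t (f + e) \<le> s" if "s \<in> W" for s
    using assms that by (simp add: residual_le_iff residual_in add_in add.assoc)
  show ?thesis
    using iff[of "residual (residual t e) f"] iff[of "residual t (f + e)"] assms
    by (simp add: residual_in)
qed

text \<open>
Iterated residuals of \<open>t\<close> are residuals of \<open>t\<close>, and these are finitely many because they decrease as the
subtracted element grows.
\<close>

lemma finite_alphabet:
  assumes "finite S" "S \<subseteq> W"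
  obtains \<Sigma> where "finite \<Sigma>" "insert 0 S \<subseteq> \<Sigma>" "\<Sigma> \<subseteq> W"
    "\<And>t e. t \<in> \<Sigma> \<Longrightarrow> e \<in> W \<Longrightarrow> residual t e \<in> \<Sigma>"
proof
  define \<Sigma> where "\<Sigma> = (\<Union>t\<in>insert 0 S. residual t ` W)"
  have S: "t \<in> W" if "t \<in> insert 0 S" for t using that assms(2) zero_in by blast
  show "finite \<Sigma>" unfolding \<Sigma>_def
    by (intro finite_UN_I finite_antimono_image residual_in residual_antimono)
      (use assms(1) S in auto)
  show "insert 0 S \<subseteq> \<Sigma>"
  proof
    fix t assume t: "t \<in> insert 0 S"
    then have "t = residual t 0" using residual_0[OF S] by simp
    then show "t \<in> \<Sigma>" unfolding \<Sigma>_def using t zero_in by blast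
  qed
  show "\<Sigma> \<subseteq> W" unfolding \<Sigma>_def using S residual_in by blast
  fix t e assume "t \<in> \<Sigma>" and e: "e \<in> W"
  then obtain s f where s: "s \<in> insert 0 S" "f \<in> W" "t = residual s f" unfolding \<Sigma>_def by blast
  then have "residual t e = residual s (e + f)" using residual_residual[OF S[OF s(1)] e] by simp
  then show "residual t e \<in> \<Sigma>" unfolding \<Sigma>_def using s add_in[OF e] by blast
qed

definition diff_dist :: "'m \<Rightarrow> 'm \<Rightarrow> 'm" where
  "diff_dist s t = max (residual s t) (residual t s)"

lemma diff_dist_in: "s \<in> W \<Longrightarrow> t \<in> W \<Longrightarrow> diff_dist s t \<in> W"
  by (simp add: diff_dist_def max_def residual_in)

lemma diff_dist_le_iff:
  "s \<in> W \<Longrightarrow> t \<in> W \<Longrightarrow> r \<in> W \<Longrightarrow> diff_dist s t \<le> r \<longleftrightarrow> s \<le> r + t \<and> t \<le> r + s"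
  by (simp add: diff_dist_def residual_le_iff)

lemma diff_dist_bounds:
  assumes "s \<in> W" "t \<in> W"
  shows "s \<le> diff_dist s t + t" "t \<le> diff_dist s t + s"
  using diff_dist_le_iff[OF assms diff_dist_in[OF assms]] by simp_all

lemma diff_dist_self: "t \<in> W \<Longrightarrow> diff_dist t t = 0"
  using diff_dist_le_iff[of t t 0] zero_in by simp

lemma diff_dist_0: "t \<in> W \<Longrightarrow> diff_dist 0 t = t"
  using residual_0[of t] residual_eq_0[OF zero_in zero_least[of t]]
  by (simp add: diff_dist_def max_def zero_least)

text \<open>
For real distances this would be a subset of the half-line with its usual distance and order.
\<close>

definition alphabet_space :: "'m set \<Rightarrow> ('m, 'm) ordered_space" where
  "alphabet_space \<Sigma> = \<lparr>points = \<Sigma>, mdist = diff_dist, ordering = {(s, t). s \<in> \<Sigma> \<and> t \<in> \<Sigma> \<and> s \<le> t}\<rparr>"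

lemma diff_dist_commute: "diff_dist s t = diff_dist t s"
  by (simp add: diff_dist_def max.commute)

lemma diff_dist_between:
  assumes W: "s \<in> W" "t \<in> W" "u \<in> W" and st: "s \<le> t" and tu: "t \<le> u"
  shows "diff_dist s t \<le> diff_dist s u" "diff_dist t u \<le> diff_dist s u"
proof -
  note su = diff_dist_bounds[OF W(1,3)]
  have "t \<le> diff_dist s u + s" using tu su(2) by (rule order.trans)
  moreover have "s \<le> diff_dist s u + t" using st le_add_left by (rule order.trans)
  ultimately show "diff_dist s t \<le> diff_dist s u"
    using diff_dist_le_iff[OF W(1,2) diff_dist_in[OF W(1,3)]] by simp
  have "u \<le> diff_dist s u + t" using su(2) add_left_mono[OF st] by (rule order.trans)
  moreover have "t \<le> diff_dist s u + u" using tu le_add_left by (rule order.trans)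
  ultimately show "diff_dist t u \<le> diff_dist s u"
    using diff_dist_le_iff[OF W(2,3) diff_dist_in[OF W(1,3)]] by simp
qed

lemma convexly_ordered_alphabet:
  assumes "\<Sigma> \<subseteq> W"
  shows "convexly_ordered_metric_space (alphabet_space \<Sigma>)"
proof -
  have \<Sigma>: "t \<in> W" if "t \<in> \<Sigma>" for t using that assms by blast
  have "convex_metric \<Sigma> diff_dist {(s, t). s \<in> \<Sigma> \<and> t \<in> \<Sigma> \<and> s \<le> t}"
  proof
    show "metric_on \<Sigma> diff_dist"
      unfolding metric_on_def
    proof (intro conjI ballI)
      fix a b assume ab: "a \<in> \<Sigma>" "b \<in> \<Sigma>"
      show "diff_dist a b = 0 \<longleftrightarrow> a = b"
        using diff_dist_le_iff[OF \<Sigma> \<Sigma> zero_in, OF ab] by auto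
      show "diff_dist a b = diff_dist b a" by (rule diff_dist_commute)
      fix c assume c: "c \<in> \<Sigma>"
      have W: "a \<in> W" "b \<in> W" "c \<in> W" using ab c \<Sigma> by auto
      have "a \<le> diff_dist a b + b" "b \<le> diff_dist b c + c" "c \<le> diff_dist b c + b" "b \<le> diff_dist a b + a"
        using diff_dist_bounds W by blast+
      then have "a \<le> diff_dist a b + (diff_dist b c + c)" "c \<le> diff_dist b c + (diff_dist a b + a)"
        using add_left_mono order.trans by blast+
      then show "diff_dist a c \<le> diff_dist a b + diff_dist b c"
        using diff_dist_le_iff[OF W(1,3) add_in[OF diff_dist_in diff_dist_in]] W by (simp add: ac_simps)
    qed
    show "linear_order_on \<Sigma> {(s, t). s \<in> \<Sigma> \<and> t \<in> \<Sigma> \<and> s \<le> t}"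
      unfolding linear_order_on_def partial_order_on_def preorder_on_def
      by (auto simp: refl_on_def trans_def antisym_def total_on_def)
    fix a b c assume *: "a \<in> \<Sigma>" "b \<in> \<Sigma>" "c \<in> \<Sigma>" "negligible (diff_dist a b) (diff_dist a c)"
    have W: "a \<in> W" "b \<in> W" "c \<in> W" using *(1-3) \<Sigma> by auto
    have less: "diff_dist a b < diff_dist a c" by (rule negligible_less[OF *(4)])
    have "a \<le> c \<longleftrightarrow> b \<le> c"
    proof (rule iffI; rule ccontr)
      assume "a \<le> c" "\<not> b \<le> c"
      then have "diff_dist a c \<le> diff_dist a b" by (intro diff_dist_between(1) W) auto
      then show False using less by simp
    next
      assume "b \<le> c" "\<not> a \<le> c"
      then have "diff_dist c a \<le> diff_dist b a" by (intro diff_dist_between(2) W) auto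
      then show False using less by (simp add: diff_dist_commute)
    qed
    then show "(a, c) \<in> {(s, t). s \<in> \<Sigma> \<and> t \<in> \<Sigma> \<and> s \<le> t} \<longleftrightarrow> (b, c) \<in> {(s, t). s \<in> \<Sigma> \<and> t \<in> \<Sigma> \<and> s \<le> t}"
      using * by simp
  qed
  then show ?thesis by (simp add: convexly_ordered_metric_space_iff alphabet_space_def)
qed

end

section \<open>An order on functions\<close>

definition lipschitz_functions ::
  "'m::distance_monoid set \<Rightarrow> 'a set \<Rightarrow> ('a \<Rightarrow> 'a \<Rightarrow> 'm) \<Rightarrow> ('a \<Rightarrow> 'm) set" where
  "lipschitz_functions \<Sigma> P d = {g \<in> P \<rightarrow>\<^sub>E \<Sigma>. \<forall>x\<in>P. \<forall>y\<in>P. g x \<le> g y + d x y}"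

text \<open>
The level sets \<open>{x. t \<le> g x}\<close> and \<open>{x. t \<le> h x}\<close> are compared from the highest level downwards, and at
the highest level \<open>t\<close> where they differ, the function whose level set contains the first point of
difference is the larger one. The witness \<open>x\<close> is this point, and \<open>t = h x\<close>.
\<close>

definition peak_less ::
  "'a set \<Rightarrow> ('a \<times> 'a) set \<Rightarrow> ('a \<Rightarrow> 'm::linorder) \<Rightarrow> ('a \<Rightarrow> 'm) \<Rightarrow> bool" where
  "peak_less P R g h \<longleftrightarrow> (\<exists>x\<in>P. g x < h x \<and>
     (\<forall>y\<in>P. g y \<noteq> h y \<longrightarrow> max (g y) (h y) \<le> h x \<and> (max (g y) (h y) = h x \<longrightarrow> (x, y) \<in> R)))"

lemma peak_lessE:
  assumes "peak_less P R g h"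
  obtains x where "x \<in> P" "g x < h x"
    "\<And>y. y \<in> P \<Longrightarrow> g y \<noteq> h y \<Longrightarrow> g y \<le> h x" "\<And>y. y \<in> P \<Longrightarrow> g y \<noteq> h y \<Longrightarrow> h y \<le> h x"
    "\<And>y. y \<in> P \<Longrightarrow> g y \<noteq> h y \<Longrightarrow> g y = h x \<or> h y = h x \<Longrightarrow> (x, y) \<in> R"
proof -
  obtain x where x: "x \<in> P" "g x < h x" and
    top: "\<And>y. y \<in> P \<Longrightarrow> g y \<noteq> h y \<Longrightarrow> max (g y) (h y) \<le> h x \<and> (max (g y) (h y) = h x \<longrightarrow> (x, y) \<in> R)"
    using assms unfolding peak_less_def by blast
  show thesis
  proof (rule that[OF x])
    fix y assume y: "y \<in> P" "g y \<noteq> h y"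
    show "g y \<le> h x" "h y \<le> h x" using top[OF y] by simp_all
    assume "g y = h x \<or> h y = h x"
    then have "max (g y) (h y) = h x" using \<open>g y \<le> h x\<close> \<open>h y \<le> h x\<close> by (auto simp: max_def)
    then show "(x, y) \<in> R" using top[OF y] by blast
  qed
qed

lemma peak_lessI:
  assumes "x \<in> P" "g x < h x"
    "\<And>y. y \<in> P \<Longrightarrow> g y \<noteq> h y \<Longrightarrow> g y \<le> h x" "\<And>y. y \<in> P \<Longrightarrow> g y \<noteq> h y \<Longrightarrow> h y \<le> h x"
    "\<And>y. y \<in> P \<Longrightarrow> g y \<noteq> h y \<Longrightarrow> g y = h x \<or> h y = h x \<Longrightarrow> (x, y) \<in> R"
  shows "peak_less P R g h"
  unfolding peak_less_def
proof (intro bexI[of _ x] conjI ballI impI)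
  fix y assume y: "y \<in> P" "g y \<noteq> h y"
  show "max (g y) (h y) \<le> h x" using assms(3,4)[OF y] by simp
  assume "max (g y) (h y) = h x"
  then show "(x, y) \<in> R" by (intro assms(5)[OF y]) (auto simp: max_def split: if_splits)
qed (use assms in auto)

context convex_metric
begin

lemma peak_less_total:
  fixes g h :: "'a \<Rightarrow> 'c::linorder"
  assumes fin: "finite P" and gh: "g \<in> extensional P" "h \<in> extensional P" "g \<noteq> h"
  shows "peak_less P R g h \<or> peak_less P R h g"
proof -
  define K where "K = {y\<in>P. g y \<noteq> h y}"
  define key where "key y = max (g y) (h y)" for y
  have "\<not> (\<forall>x\<in>P. g x = h x)" using gh extensionalityI by blast
  then have K: "finite K" "K \<noteq> {}" using fin by (auto simp: K_def)
  define t where "t = Max (key ` K)"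
  have t: "t \<in> key ` K" "\<And>y. y \<in> K \<Longrightarrow> key y \<le> t" unfolding t_def using K by auto
  have "{y\<in>K. key y = t} \<noteq> {}" "{y\<in>K. key y = t} \<subseteq> P" using t(1) by (auto simp: K_def)
  then obtain x where x: "x \<in> K" "key x = t" and first: "\<And>y. y \<in> K \<Longrightarrow> key y = t \<Longrightarrow> (x, y) \<in> R"
    using order_first[of "{y\<in>K. key y = t}"] K(1) by auto
  have xP: "x \<in> P" "g x \<noteq> h x" using x(1) by (auto simp: K_def)
  have bound: "g y \<le> t" "h y \<le> t" if "y \<in> P" "g y \<noteq> h y" for y
    using t(2)[of y] that by (auto simp: K_def key_def)
  have tie: "(x, y) \<in> R" if y: "y \<in> P" "g y \<noteq> h y" "g y = t \<or> h y = t" for y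
  proof -
    have "key y = t" using bound[OF y(1,2)] y(3) by (auto simp: key_def max_def)
    then show ?thesis using first[of y] y by (simp add: K_def)
  qed
  show ?thesis
  proof (cases "g x < h x")
    case True
    then have "h x = t" using x(2) by (simp add: key_def)
    then have "peak_less P R g h" using True xP bound tie by (intro peak_lessI[of x]) auto
    then show ?thesis ..
  next
    case False
    then have gt: "h x < g x" using xP by simp
    then have "g x = t" using x(2) by (simp add: key_def)
    then have "peak_less P R h g" using gt xP bound tie by (intro peak_lessI[of x]) auto
    then show ?thesis ..
  qed
qed

lemma peak_less_asym:
  assumes 1: "peak_less P R g h" and 2: "peak_less P R h g"
  shows False
proof -
  obtain x where x: "x \<in> P" "g x < h x" "\<And>y. y \<in> P \<Longrightarrow> g y \<noteq> h y \<Longrightarrow> g y \<le> h x"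
    "\<And>y. y \<in> P \<Longrightarrow> g y \<noteq> h y \<Longrightarrow> g y = h x \<or> h y = h x \<Longrightarrow> (x, y) \<in> R"
    using peak_lessE[OF 1] by metis
  obtain z where z: "z \<in> P" "h z < g z" "\<And>y. y \<in> P \<Longrightarrow> h y \<noteq> g y \<Longrightarrow> h y \<le> g z"
    "\<And>y. y \<in> P \<Longrightarrow> h y \<noteq> g y \<Longrightarrow> h y = g z \<or> g y = g z \<Longrightarrow> (z, y) \<in> R"
    using peak_lessE[OF 2] by metis
  have "g z \<le> h x" using x(3)[OF z(1)] z(2) by simp
  moreover have "h x \<le> g z" using z(3)[OF x(1)] x(2) by simp
  ultimately have "g z = h x" by simp
  then have "(x, z) \<in> R" "(z, x) \<in> R" using x(4)[OF z(1)] z(4)[OF x(1)] x(2) z(2) by auto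
  then show False using order_antisym x(2) z(2) by fastforce
qed

text \<open>
Of the two witnesses, the one with the higher level, or on the same level the earlier one, is a witness
for the composite.
\<close>

lemma peak_less_trans:
  assumes 1: "peak_less P R f g" and 2: "peak_less P R g h"
  shows "peak_less P R f h"
proof -
  obtain x where x: "x \<in> P" "f x < g x" "\<And>y. y \<in> P \<Longrightarrow> f y \<noteq> g y \<Longrightarrow> f y \<le> g x"
    "\<And>y. y \<in> P \<Longrightarrow> f y \<noteq> g y \<Longrightarrow> g y \<le> g x"
    "\<And>y. y \<in> P \<Longrightarrow> f y \<noteq> g y \<Longrightarrow> f y = g x \<or> g y = g x \<Longrightarrow> (x, y) \<in> R"
    by (rule peak_lessE[OF 1]) (rule that)
  obtain z where z: "z \<in> P" "g z < h z" "\<And>y. y \<in> P \<Longrightarrow> g y \<noteq> h y \<Longrightarrow> g y \<le> h z"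
    "\<And>y. y \<in> P \<Longrightarrow> g y \<noteq> h y \<Longrightarrow> h y \<le> h z"
    "\<And>y. y \<in> P \<Longrightarrow> g y \<noteq> h y \<Longrightarrow> g y = h z \<or> h y = h z \<Longrightarrow> (z, y) \<in> R"
    by (rule peak_lessE[OF 2]) (rule that)
  have f_le: "f y \<le> max (g x) (h z)" and h_le: "h y \<le> max (g x) (h z)" if "y \<in> P" "f y \<noteq> h y" for y
    using x(3,4)[of y] z(3,4)[of y] that by (auto simp: max_def split: if_splits) (metis order.trans nle_le)+
  show ?thesis
  proof (cases "h z < g x \<or> (h z = g x \<and> (x, z) \<in> R)")
    case True
    have hx: "h x = g x"
    proof (rule ccontr)
      assume ne: "h x \<noteq> g x"
      then have "g x \<le> h z" using z(3)[OF x(1)] by simp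
      then have eq: "h z = g x" "(x, z) \<in> R" using True by auto
      then have "(z, x) \<in> R" using z(5)[OF x(1)] ne by simp
      then have "x = z" using eq(2) order_antisym by blast
      then show False using z(2) eq(1) by simp
    qed
    show ?thesis
    proof (rule peak_lessI[OF x(1)])
      show "f x < h x" using x(2) hx by simp
      fix y assume y: "y \<in> P" "f y \<noteq> h y"
      show "f y \<le> h x" "h y \<le> h x" using f_le[OF y] h_le[OF y] True hx by auto
      assume eq: "f y = h x \<or> h y = h x"
      show "(x, y) \<in> R"
      proof (cases "f y \<noteq> g y \<and> (f y = g x \<or> g y = g x)")
        case True
        then show ?thesis using x(5)[OF y(1)] by blast
      next
        case False
        then have gh: "g y \<noteq> h y" "h y = g x \<or> g y = g x" using eq hx y(2) by auto
        then have "g x \<le> h z" using z(3,4)[OF y(1)] by auto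
        then have eqz: "h z = g x" "(x, z) \<in> R" using True by auto
        then have "(z, y) \<in> R" using z(5)[OF y(1) gh(1)] gh(2) by auto
        then show ?thesis using eqz(2) order_trans by blast
      qed
    qed
  next
    case False
    have xz: "g x \<le> h z" using False by auto
    have tie: "(z, x) \<in> R \<and> z \<noteq> x" if "h z = g x"
      using False that order_total[OF x(1) z(1)] order_refl[OF x(1)] by auto
    have fz: "f z < h z"
    proof (cases "f z = g z")
      case True
      then show ?thesis using z(2) by simp
    next
      case ne: False
      have le: "f z \<le> g x" using x(3)[OF z(1) ne] .
      show ?thesis
      proof (cases "h z = g x")
        case True
        then have "f z \<noteq> g x" using x(5)[OF z(1) ne] tie order_antisym by blast
        then show ?thesis using le True by simp
      next
        case False
        then have "g x < h z" using xz by simp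
        then show ?thesis using le by simp
      qed
    qed
    show ?thesis
    proof (rule peak_lessI[of z P f h R, OF z(1) fz])
      fix y assume y: "y \<in> P" "f y \<noteq> h y"
      show "f y \<le> h z" "h y \<le> h z" using f_le[OF y] h_le[OF y] xz by auto
      assume eq: "f y = h z \<or> h y = h z"
      show "(z, y) \<in> R"
      proof (cases "g y \<noteq> h y \<and> (g y = h z \<or> h y = h z)")
        case True
        then show ?thesis using z(5)[OF y(1)] by blast
      next
        case no: False
        then have fg: "f y \<noteq> g y" "f y = h z \<or> g y = h z" using eq y(2) by auto
        then have "h z \<le> g x" using x(3,4)[OF y(1)] by auto
        then have eqx: "h z = g x" using xz by simp
        then have "(x, y) \<in> R" using x(5)[OF y(1) fg(1)] fg(2) by auto
        then show ?thesis using tie[OF eqx] order_trans by blast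
      qed
    qed
  qed
qed

end

lemma finite_strict_order_list:
  assumes "finite F"
    and trans: "\<And>x y z. L x y \<Longrightarrow> L y z \<Longrightarrow> L x z"
    and total: "\<And>x y. x \<in> F \<Longrightarrow> y \<in> F \<Longrightarrow> x \<noteq> y \<Longrightarrow> L x y \<or> L y x"
  shows "\<exists>xs. set xs = F \<and> sorted_wrt L xs \<and> distinct xs"
  using assms(1,3)
proof (induction F rule: finite_induct)
  case empty
  then show ?case by simp
next
  case (insert x F)
  then obtain xs where xs: "set xs = F" "sorted_wrt L xs" "distinct xs" by blast
  define zs where "zs = filter (\<lambda>y. L y x) xs @ x # filter (\<lambda>y. \<not> L y x) xs"
  have set: "set zs = insert x F" using xs(1) by (auto simp: zs_def)
  have right: "L x y" if "y \<in> F" "\<not> L y x" for y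
    using insert.prems[of x y] insert.hyps that by auto
  have "sorted_wrt L zs"
    unfolding zs_def sorted_wrt_append
    using xs right trans by (auto simp: sorted_wrt_filter)
  moreover have "distinct zs" using xs insert.hyps by (auto simp: zs_def)
  ultimately show ?case using set by blast
qed

context convex_metric
begin

lemma sorted_function_list:
  fixes F :: "('a \<Rightarrow> 'c::linorder) set"
  assumes "finite P" "finite F" "F \<subseteq> extensional P"
  shows "\<exists>gs. set gs = F \<and> sorted_wrt (peak_less P R) gs \<and> distinct gs"
proof (rule finite_strict_order_list[OF assms(2)])
  show "peak_less P R f h" if "peak_less P R f g" "peak_less P R g h" for f g h :: "'a \<Rightarrow> 'c"
    using that by (rule peak_less_trans)
  show "peak_less P R g h \<or> peak_less P R h g" if "g \<in> F" "h \<in> F" "g \<noteq> h" for g h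
    using that assms(3) by (intro peak_less_total assms(1)) auto
qed

end

section \<open>Lipschitz functions and their least extensions\<close>

text \<open>
The letters are required to contain the distances of the space, so that the distance from a fixed point
is a function into \<open>\<Sigma>\<close>, and to be closed under residuals, so that functions can be extended.
\<close>

locale lipschitz_space =
  well_ordered_submonoid W + convex_metric P d R
  for W :: "'m::distance_monoid set" and P :: "'a set" and d R +
  fixes \<Sigma> :: "'m set"
  assumes finite_space: "finite P" and finite_letters: "finite \<Sigma>" and letters_zero: "0 \<in> \<Sigma>"
    and letters_scale: "\<Sigma> \<subseteq> W"
    and letters_residual: "\<And>t e. t \<in> \<Sigma> \<Longrightarrow> e \<in> W \<Longrightarrow> residual t e \<in> \<Sigma>"
    and distances: "\<And>x y. x \<in> P \<Longrightarrow> y \<in> P \<Longrightarrow> d x y \<in> \<Sigma>"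
begin

abbreviation Lip :: "('a \<Rightarrow> 'm) set" where
  "Lip \<equiv> lipschitz_functions \<Sigma> P d"

lemma dist_scale: "x \<in> P \<Longrightarrow> y \<in> P \<Longrightarrow> d x y \<in> W"
  using distances letters_scale by blast

lemma Lip_letter: "g \<in> Lip \<Longrightarrow> x \<in> P \<Longrightarrow> g x \<in> \<Sigma>"
  by (auto simp: lipschitz_functions_def)

lemma Lip_scale: "g \<in> Lip \<Longrightarrow> x \<in> P \<Longrightarrow> g x \<in> W"
  using Lip_letter letters_scale by blast

lemma Lip_le: "g \<in> Lip \<Longrightarrow> x \<in> P \<Longrightarrow> y \<in> P \<Longrightarrow> g x \<le> g y + d x y"
  by (simp add: lipschitz_functions_def)

lemma Lip_dist_le:
  assumes "g \<in> Lip" "x \<in> P" "y \<in> P"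
  shows "diff_dist (g x) (g y) \<le> d x y"
proof -
  have "g x \<le> d x y + g y" "g y \<le> d x y + g x"
    using Lip_le[OF assms] Lip_le[OF assms(1,3,2)] dist_commute[OF assms(3,2)] by (simp_all add: add.commute)
  then show ?thesis using assms by (simp add: diff_dist_le_iff Lip_scale dist_scale)
qed

lemma restrict_Lip:
  assumes "\<And>x. x \<in> P \<Longrightarrow> g x \<in> \<Sigma>" "\<And>x y. x \<in> P \<Longrightarrow> y \<in> P \<Longrightarrow> g x \<le> g y + d x y"
  shows "restrict g P \<in> Lip"
  using assms by (auto simp: lipschitz_functions_def)

lemma dist_from_Lip: "z \<in> P \<Longrightarrow> restrict (\<lambda>x. d z x) P \<in> Lip"
proof (rule restrict_Lip)
  assume z: "z \<in> P"
  show "d z x \<in> \<Sigma>" if "x \<in> P" for x using that z by (rule distances[rotated])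
  show "d z x \<le> d z y + d x y" if "x \<in> P" "y \<in> P" for x y
    using triangle[OF z that(2,1)] dist_commute[OF that] by simp
qed

text \<open>
The least Lipschitz function with value \<open>t\<close> at \<open>z\<close>.
\<close>

lemma cone_Lip:
  assumes t: "t \<in> \<Sigma>" and z: "z \<in> P"
  shows "restrict (\<lambda>x. residual t (d z x)) P \<in> Lip"
proof (rule restrict_Lip)
  have tW: "t \<in> W" using t letters_scale by blast
  show "residual t (d z x) \<in> \<Sigma>" if "x \<in> P" for x using that t z by (simp add: letters_residual dist_scale)
  show "residual t (d z x) \<le> residual t (d z y) + d x y" if xy: "x \<in> P" "y \<in> P" for x y
  proof -
    have "t \<le> residual t (d z y) + d z y" using residual_props[OF tW] by blast
    also have "\<dots> \<le> residual t (d z y) + (d z x + d x y)" by (intro add_left_mono triangle z xy)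
    finally show ?thesis
      using residual_le_iff[OF tW add_in[OF residual_in[OF tW] dist_scale[OF xy]]] by (simp add: ac_simps)
  qed
qed

lemma finite_Lip: "finite Lip"
  by (rule finite_subset[OF _ finite_PiE[OF finite_space, of "\<lambda>_. \<Sigma>"]])
    (auto simp: lipschitz_functions_def finite_letters)

lemma Lip_extensional: "g \<in> Lip \<Longrightarrow> g \<in> extensional P"
  by (auto simp: lipschitz_functions_def PiE_def)

lemma Lip_peak_less_total: "g \<in> Lip \<Longrightarrow> h \<in> Lip \<Longrightarrow> g \<noteq> h \<Longrightarrow> peak_less P R g h \<or> peak_less P R h g"
  by (intro peak_less_total finite_space Lip_extensional)

text \<open>
By the adjunction, adding \<open>e\<close> to something below \<open>t\<close> does not lead up to \<open>t\<close>, and this can be iterated.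
\<close>

lemma residual_stable:
  assumes t: "t \<in> W" and s: "s \<in> W" "s < t" and e: "e \<in> W" and stable: "residual t e = t"
  shows "s + nsum n e < t"
proof (induction n)
  case 0
  then show ?case using s by simp
next
  case (Suc n)
  show ?case
  proof (rule ccontr)
    assume "\<not> ?thesis"
    then have "t \<le> (s + nsum n e) + e" by (simp add: nsum_Suc add.assoc)
    then have "residual t e \<le> s + nsum n e"
      using residual_le_iff[OF t add_in[OF s(1) nsum_in[OF e]]] by simp
    then show False using Suc stable by simp
  qed
qed

text \<open>
Suppose that \<open>h y < h x\<close>. Let \<open>t\<close> be the least letter that is not negligible against \<open>d x y\<close>, and let
\<open>g\<close> be the cone of height \<open>t\<close> over \<open>y\<close>; it vanishes at \<open>x\<close> and thus separates \<open>x\<close> and \<open>y\<close> at the scale of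
their distance. As \<open>h\<close> is the first function to do so, \<open>g\<close> comes after \<open>h\<close>. But \<open>h x\<close> is at least
\<open>t\<close>, so \<open>g\<close> must have the value \<open>t\<close> at a point \<open>p\<close> not after \<open>x\<close>. Such a point is so close to \<open>y\<close> that
by convexity it lies on the same side of \<open>x\<close> as \<open>y\<close>, that is, after \<open>x\<close>.
\<close>

lemma first_far_coordinate_increasing:
  assumes xy: "x \<in> P" "y \<in> P" "(x, y) \<in> R" "x \<noteq> y"
    and h: "h \<in> Lip" "\<not> negligible (diff_dist (h x) (h y)) (d x y)"
    and first: "\<And>g. g \<in> Lip \<Longrightarrow> peak_less P R g h \<Longrightarrow> negligible (diff_dist (g x) (g y)) (d x y)"
  shows "h x < h y"
proof (rule ccontr)
  assume "\<not> h x < h y"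
  define D where "D = d x y"
  have D: "D \<in> \<Sigma>" "D \<noteq> 0" using distances[OF xy(1,2)] dist_eq_0[OF xy(1,2)] xy(4) by (auto simp: D_def)
  have hW: "h x \<in> W" "h y \<in> W" using Lip_scale[OF h(1)] xy by auto
  have hyx: "h y < h x"
  proof (rule ccontr)
    assume "\<not> h y < h x"
    then have "h x = h y" using \<open>\<not> h x < h y\<close> by simp
    then show False using h(2) D diff_dist_self[OF hW(1)] by (simp add: negligible_zero_iff D_def)
  qed
  have "diff_dist (h x) (h y) \<le> h x"
    using hyx le_add_left[of "h x" "h x"] le_add_right[of "h x" "h y"] order.strict_implies_order[OF hyx]
      order.trans[of "h y" "h x" "h x + h x"]
    by (simp add: diff_dist_le_iff hW)
  then have hx_far: "\<not> negligible (h x) D"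
    using h(2) negligible_mono[of "h x" D "diff_dist (h x) (h y)" D] by (auto simp: D_def)
  have "{t\<in>\<Sigma>. \<not> negligible t D} \<noteq> {}" "{t\<in>\<Sigma>. \<not> negligible t D} \<subseteq> W"
    using D letters_scale by auto
  then obtain t where t: "t \<in> \<Sigma>" "\<not> negligible t D"
    and least: "\<forall>s\<in>{t\<in>\<Sigma>. \<not> negligible t D}. t \<le> s"
    using has_least[of "{t\<in>\<Sigma>. \<not> negligible t D}"] by blast
  have tW: "t \<in> W" using t letters_scale by blast
  have t_le: "t \<le> h x" "t \<le> D" using least hx_far Lip_letter[OF h(1) xy(1)] D by auto
  have t0: "t \<noteq> 0" using t(2) D(2) by (auto simp: negligible_zero_iff)
  \<comment> \<open>The cone over \<open>y\<close>, a competitor of \<open>h\<close> that increases from \<open>x\<close> to \<open>y\<close>.\<close>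
  define g where "g = restrict (\<lambda>z. residual t (d y z)) P"
  have gL: "g \<in> Lip" unfolding g_def by (rule cone_Lip[OF t(1) xy(2)])
  have gy: "g y = t" using xy dist_eq_0[of y y] by (simp add: g_def residual_0[OF tW])
  have gx: "g x = 0" using xy t_le(2) dist_commute[of y x] by (simp add: g_def D_def residual_eq_0[OF tW])
  have g_le: "g z \<le> t" if "z \<in> P" for z using that by (simp add: g_def residual_le[OF tW])
  have far: "\<not> negligible (diff_dist (g x) (g y)) D" using t(2) by (simp add: gx gy diff_dist_0[OF tW])
  have ne: "g \<noteq> h" using gx t_le(1) t0 by auto
  have "\<not> peak_less P R g h" using first[OF gL] far by (auto simp: D_def)
  then have "peak_less P R h g" using Lip_peak_less_total[OF gL h(1) ne] by blast
  then obtain p where p: "p \<in> P" "h p < g p" "\<And>z. z \<in> P \<Longrightarrow> h z \<noteq> g z \<Longrightarrow> h z \<le> g p"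
    "\<And>z. z \<in> P \<Longrightarrow> h z \<noteq> g z \<Longrightarrow> h z = g p \<or> g z = g p \<Longrightarrow> (p, z) \<in> R"
    by (rule peak_lessE) (rule that)
  have hgx: "h x \<noteq> g x" using gx t_le(1) t0 by auto
  have "h x \<le> g p" using p(3)[OF xy(1) hgx] .
  then have eq: "g p = t" "h x = g p" using g_le[OF p(1)] t_le(1) by auto
  then have px: "(p, x) \<in> R" using p(4)[OF xy(1) hgx] by simp
  have stable: "residual t (d y p) = t" using eq(1) p(1) by (simp add: g_def)
  have "negligible (d y p) D"
    unfolding negligible_def
  proof
    fix n
    have "0 + nsum n (d y p) < t"
      by (rule residual_stable[OF tW zero_in _ dist_scale[OF xy(2) p(1)] stable])
        (use t0 zero_least[of t] in \<open>simp add: less_le\<close>)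
    then show "nsum n (d y p) < D" using t_le(2) by simp
  qed
  then have "negligible (d y p) (d y x)" using dist_commute[OF xy(1,2)] by (simp add: D_def)
  then have "(y, x) \<in> R \<longleftrightarrow> (p, x) \<in> R" by (rule convex[OF xy(2) p(1) xy(1)])
  then show False using px xy(3,4) order_antisym by blast
qed

end

text \<open>
The space \<open>B\<close> is rich enough in letters and \<open>A\<close> is embedded in it by \<open>f\<close>; the distances of \<open>A\<close> are then letters too.
\<close>

locale lipschitz_extension =
  B: lipschitz_space W PB dB RB \<Sigma> + A: convex_metric PA dA RA
  for W :: "'m::distance_monoid set" and PB :: "'b set" and dB RB \<Sigma> and PA :: "'a set" and dA RA +
  fixes f :: "'a \<Rightarrow> 'b"
  assumes finite_A: "finite PA"
    and f_mem: "\<And>x. x \<in> PA \<Longrightarrow> f x \<in> PB"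
    and f_dist: "\<And>x y. x \<in> PA \<Longrightarrow> y \<in> PA \<Longrightarrow> dB (f x) (f y) = dA x y"
    and f_order: "\<And>x y. x \<in> PA \<Longrightarrow> y \<in> PA \<Longrightarrow> (f x, f y) \<in> RB \<longleftrightarrow> (x, y) \<in> RA"
begin

abbreviation LipA :: "('a \<Rightarrow> 'm) set" where
  "LipA \<equiv> lipschitz_functions \<Sigma> PA dA"

lemma restrict_LipA: "h \<in> B.Lip \<Longrightarrow> restrict (h \<circ> f) PA \<in> LipA"
  using f_mem f_dist[symmetric] by (auto simp: lipschitz_functions_def)

lemma LipA_scale: "g \<in> LipA \<Longrightarrow> x \<in> PA \<Longrightarrow> g x \<in> W"
  using B.letters_scale by (auto simp: lipschitz_functions_def)

lemma LipA_letter: "g \<in> LipA \<Longrightarrow> x \<in> PA \<Longrightarrow> g x \<in> \<Sigma>"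
  by (auto simp: lipschitz_functions_def)

lemma LipA_le: "g \<in> LipA \<Longrightarrow> x \<in> PA \<Longrightarrow> y \<in> PA \<Longrightarrow> g x \<le> g y + dA x y"
  by (simp add: lipschitz_functions_def)

text \<open>
The insertion of 0 makes this meaningful for the empty space and changes nothing otherwise.
\<close>

definition least_ext :: "('a \<Rightarrow> 'm) \<Rightarrow> 'b \<Rightarrow> 'm" where
  "least_ext g = restrict (\<lambda>p. Max (insert 0 ((\<lambda>x. B.residual (g x) (dB (f x) p)) ` PA))) PB"

lemma least_ext_ge: "p \<in> PB \<Longrightarrow> x \<in> PA \<Longrightarrow> B.residual (g x) (dB (f x) p) \<le> least_ext g p"
  using finite_A by (simp add: least_ext_def)

lemma least_ext_attained:
  assumes "p \<in> PB"
  shows "least_ext g p = 0 \<or> (\<exists>x\<in>PA. least_ext g p = B.residual (g x) (dB (f x) p))"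
proof -
  have "Max (insert 0 ((\<lambda>x. B.residual (g x) (dB (f x) p)) ` PA)) \<in>
    insert 0 ((\<lambda>x. B.residual (g x) (dB (f x) p)) ` PA)"
    by (rule Max_in) (use finite_A in auto)
  then show ?thesis using assms by (auto simp: least_ext_def)
qed

lemma least_ext_leI:
  assumes "p \<in> PB" "\<And>x. x \<in> PA \<Longrightarrow> B.residual (g x) (dB (f x) p) \<le> z"
  shows "least_ext g p \<le> z"
  using least_ext_attained[OF assms(1), of g] assms(2) zero_least[of z] by auto

lemma least_ext_letter:
  assumes "g \<in> LipA" "p \<in> PB"
  shows "least_ext g p \<in> \<Sigma>"
  using least_ext_attained[OF assms(2), of g] B.letters_zero
    B.letters_residual[OF LipA_letter[OF assms(1)] B.dist_scale[OF f_mem assms(2)]] by auto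

text \<open>
By the adjunction for residuals, this is the triangle inequality through \<open>f x\<close>.
\<close>

lemma least_ext_Lip:
  assumes g: "g \<in> LipA"
  shows "least_ext g \<in> B.Lip"
proof -
  have W: "least_ext g p \<in> W" if "p \<in> PB" for p using least_ext_letter[OF g that] B.letters_scale by blast
  have "least_ext g p \<le> least_ext g q + dB p q" if pq: "p \<in> PB" "q \<in> PB" for p q
  proof (rule least_ext_leI[OF pq(1)])
    fix x assume x: "x \<in> PA"
    have "g x \<le> B.residual (g x) (dB (f x) q) + dB (f x) q"
      using B.residual_props[OF LipA_scale[OF g x]] by blast
    also have "\<dots> \<le> least_ext g q + (dB (f x) p + dB p q)"
      by (intro add_mono least_ext_ge pq x B.triangle f_mem)
    finally show "B.residual (g x) (dB (f x) p) \<le> least_ext g q + dB p q"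
      using B.residual_le_iff[OF LipA_scale[OF g x] B.add_in[OF W[OF pq(2)] B.dist_scale[OF pq]]]
      by (simp add: ac_simps)
  qed
  then have "restrict (least_ext g) PB \<in> B.Lip" by (intro B.restrict_Lip least_ext_letter[OF g])
  moreover have "restrict (least_ext g) PB = least_ext g" by (rule ext) (simp add: least_ext_def)
  ultimately show ?thesis by simp
qed

lemma least_ext_extends:
  assumes g: "g \<in> LipA" and z: "z \<in> PA"
  shows "least_ext g (f z) = g z"
proof (rule antisym)
  show "least_ext g (f z) \<le> g z"
  proof (rule least_ext_leI[OF f_mem[OF z]])
    fix x assume x: "x \<in> PA"
    have "g x \<le> g z + dB (f x) (f z)" using LipA_le[OF g x z] f_dist[OF x z] by simp
    then show "B.residual (g x) (dB (f x) (f z)) \<le> g z"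
      using B.residual_le_iff[OF LipA_scale[OF g x] LipA_scale[OF g z]] by simp
  qed
  have "dB (f z) (f z) = 0" using B.dist_eq_0 f_mem[OF z] by simp
  then show "g z \<le> least_ext g (f z)"
    using least_ext_ge[OF f_mem[OF z] z, of g] B.residual_0[OF LipA_scale[OF g z]] by simp
qed

lemma least_ext_least:
  assumes h: "h \<in> B.Lip" and p: "p \<in> PB"
  shows "least_ext (restrict (h \<circ> f) PA) p \<le> h p"
proof (rule least_ext_leI[OF p])
  fix x assume x: "x \<in> PA"
  show "B.residual (restrict (h \<circ> f) PA x) (dB (f x) p) \<le> h p"
    using B.residual_le_iff[OF B.Lip_scale[OF h f_mem[OF x]] B.Lip_scale[OF h p]]
      B.Lip_le[OF h f_mem[OF x] p] x by simp
qed

text \<open>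
A function that is pointwise below another one never comes after it.
\<close>

lemma least_ext_not_after:
  assumes h: "h \<in> B.Lip"
  shows "\<not> peak_less PB RB h (least_ext (restrict (h \<circ> f) PA))"
proof
  assume "peak_less PB RB h (least_ext (restrict (h \<circ> f) PA))"
  then obtain p where "p \<in> PB" "h p < least_ext (restrict (h \<circ> f) PA) p" by (rule peak_lessE)
  then show False using least_ext_least[OF h, of p] by simp
qed

text \<open>
A value above \<open>t\<close> of an extension stems from a value above \<open>t\<close> of the function, where \<open>g\<close> and \<open>g'\<close> agree.
\<close>

lemma least_ext_mono_above:
  assumes g: "g \<in> LipA" and agree: "\<And>z. z \<in> PA \<Longrightarrow> g z \<noteq> g' z \<Longrightarrow> g z \<le> t"
    and p: "p \<in> PB" "t < least_ext g p"
  shows "least_ext g p \<le> least_ext g' p"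
proof -
  have "least_ext g p \<noteq> 0" using p(2) zero_least[of t] by auto
  then obtain z where z: "z \<in> PA" "least_ext g p = B.residual (g z) (dB (f z) p)"
    using least_ext_attained[OF p(1), of g] by blast
  have "least_ext g p \<le> g z" unfolding z(2) by (rule B.residual_le[OF LipA_scale[OF g z(1)]])
  then have "\<not> g z \<le> t" using p(2) by simp
  then have "g z = g' z" using agree[OF z(1)] by blast
  then show ?thesis using least_ext_ge[OF p(1) z(1), of g'] z(2) by simp
qed

text \<open>
Let \<open>t\<close> be the level of the witness \<open>x\<close> for \<open>g\<close> and \<open>g'\<close>. The extensions agree above level \<open>t\<close> and
differ at \<open>f x\<close>. Let \<open>p\<close> be the first point at which they differ at level \<open>t\<close>. If the extension of
\<open>g\<close> were the larger one there, its value would stem from some \<open>z\<close> with \<open>g z = t\<close>, and \<open>x\<close> would come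
before \<open>z\<close>. Then \<open>p\<close> is so close to \<open>f z\<close> that subtracting their distance from \<open>t\<close> has no effect, whereas
\<open>g x < t\<close> shows that \<open>f x\<close> is far from \<open>f z\<close> at this scale. By convexity, \<open>f z\<close> lies on the same side of
\<open>f x\<close> as \<open>p\<close>, namely before it, a contradiction.
\<close>

lemma least_ext_peak_less:
  assumes g: "g \<in> LipA" and g': "g' \<in> LipA" and less: "peak_less PA RA g g'"
  shows "peak_less PB RB (least_ext g) (least_ext g')"
proof -
  obtain x where x: "x \<in> PA" "g x < g' x" "\<And>z. z \<in> PA \<Longrightarrow> g z \<noteq> g' z \<Longrightarrow> g z \<le> g' x"
    "\<And>z. z \<in> PA \<Longrightarrow> g z \<noteq> g' z \<Longrightarrow> g' z \<le> g' x"
    "\<And>z. z \<in> PA \<Longrightarrow> g z \<noteq> g' z \<Longrightarrow> g z = g' x \<or> g' z = g' x \<Longrightarrow> (x, z) \<in> RA"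
    by (rule peak_lessE[OF less]) (rule that)
  define t where "t = g' x"
  have tW: "t \<in> W" using LipA_scale[OF g' x(1)] by (simp add: t_def)
  have t0: "t \<noteq> 0" using x(2) zero_least[of "g x"] by (auto simp: t_def)
  have bound: "least_ext g p \<le> t \<and> least_ext g' p \<le> t" if p: "p \<in> PB" "least_ext g p \<noteq> least_ext g' p" for p
  proof (rule ccontr)
    have 1: "least_ext g p \<le> least_ext g' p" if "t < least_ext g p"
      by (rule least_ext_mono_above[OF g _ p(1) that]) (simp add: t_def x(3))
    have 2: "least_ext g' p \<le> least_ext g p" if "t < least_ext g' p"
      by (rule least_ext_mono_above[OF g' _ p(1) that]) (metis t_def x(4))
    assume "\<not> ?thesis"
    then have "t < least_ext g p \<or> t < least_ext g' p" by auto
    then have "t < least_ext g p \<and> t < least_ext g' p" using 1 2 by auto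
    then show False using 1 2 p(2) by simp
  qed
  define K where "K = {p\<in>PB. least_ext g p \<noteq> least_ext g' p \<and> (least_ext g p = t \<or> least_ext g' p = t)}"
  have "f x \<in> K"
    using f_mem[OF x(1)] least_ext_extends[OF g x(1)] least_ext_extends[OF g' x(1)] x(2) by (auto simp: K_def t_def)
  moreover have "finite K" "K \<subseteq> PB" using B.finite_space by (auto simp: K_def)
  ultimately obtain p where p: "p \<in> K" and first: "\<And>q. q \<in> K \<Longrightarrow> (p, q) \<in> RB"
    using B.order_first[of K] by blast
  have pB: "p \<in> PB" using p by (simp add: K_def)
  have less_p: "least_ext g p < least_ext g' p"
  proof (rule ccontr)
    assume "\<not> ?thesis"
    then have lt: "least_ext g' p < least_ext g p" "least_ext g p = t" using p bound[OF pB] by (auto simp: K_def)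
    obtain z where z: "z \<in> PA" "least_ext g p = B.residual (g z) (dB (f z) p)"
      using least_ext_attained[OF pB, of g] lt(2) t0 by auto
    have "g z \<noteq> g' z"
    proof
      assume "g z = g' z"
      then have "least_ext g p \<le> least_ext g' p" using least_ext_ge[OF pB z(1), of g'] z(2) by simp
      then show False using lt(1) by simp
    qed
    moreover have "t \<le> g z" using B.residual_le[OF LipA_scale[OF g z(1)]] z(2) lt(2) by simp
    ultimately have gz: "g z = t" "(x, z) \<in> RA" using x(3,5)[OF z(1)] by (auto simp: t_def)
    define e where "e = dB (f z) p"
    have eW: "e \<in> W" unfolding e_def by (rule B.dist_scale[OF f_mem[OF z(1)] pB])
    have stable: "B.residual t e = t" using z(2) lt(2) gz(1) by (simp add: e_def)
    have gx: "g x \<in> W" "g x < t" using LipA_scale[OF g x(1)] x(2) by (auto simp: t_def)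
    have "negligible e (dB (f z) (f x))"
      unfolding negligible_def
    proof
      fix n
      show "nsum n e < dB (f z) (f x)"
      proof (rule ccontr)
        assume "\<not> ?thesis"
        then have "dA z x \<le> nsum n e" using f_dist[OF z(1) x(1)] by simp
        then have "g z \<le> g x + nsum n e" using LipA_le[OF g z(1) x(1)] add_left_mono order.trans by blast
        then show False using B.residual_stable[OF tW gx eW stable, of n] gz(1) by simp
      qed
    qed
    then have "(f z, f x) \<in> RB \<longleftrightarrow> (p, f x) \<in> RB"
      unfolding e_def by (rule B.convex[OF f_mem[OF z(1)] pB f_mem[OF x(1)]])
    then have "(z, x) \<in> RA" using first[OF \<open>f x \<in> K\<close>] f_order[OF z(1) x(1)] by simp
    then have "x = z" using gz(2) A.order_antisym by blast
    then show False using gz(1) gx(2) by simp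
  qed
  show ?thesis
  proof (rule peak_lessI[of p PB "least_ext g" "least_ext g'" RB, OF pB less_p])
    have pt: "least_ext g' p = t" using p less_p bound[OF pB] by (auto simp: K_def)
    fix q assume q: "q \<in> PB" "least_ext g q \<noteq> least_ext g' q"
    show "least_ext g q \<le> least_ext g' p" "least_ext g' q \<le> least_ext g' p" using bound[OF q] pt by simp_all
    assume "least_ext g q = least_ext g' p \<or> least_ext g' q = least_ext g' p"
    then show "(p, q) \<in> RB" using first[of q] q pt by (auto simp: K_def)
  qed
qed

end

section \<open>Restriction as a rigid surjection\<close>

context lipschitz_extension
begin

text \<open>
The function number \<open>j\<close> on \<open>B\<close> restricts to the function number \<open>v ! j\<close> on \<open>A\<close>. The first function to
restrict to a given one is its least extension, and least extensions are listed in the order of the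
functions that they extend.
\<close>

lemma restriction_word:
  assumes hB: "set hB = B.Lip" "sorted_wrt (peak_less PB RB) hB"
    and hA: "set hA = LipA" "sorted_wrt (peak_less PA RA) hA" "distinct hA"
  obtains v where "param_word 0 (length hA) v" "length v = length hB"
    "\<And>j x. j < length hB \<Longrightarrow> x \<in> PA \<Longrightarrow> (hB ! j) (f x) = (hA ! (v ! j)) x"
proof -
  have nB: "hB ! j \<in> B.Lip" if "j < length hB" for j using that hB(1) nth_mem by blast
  have nA: "hA ! i \<in> LipA" if "i < length hA" for i using that hA(1) nth_mem by blast
  have "\<forall>j. \<exists>i. j < length hB \<longrightarrow> i < length hA \<and> hA ! i = restrict (hB ! j \<circ> f) PA"
    using restrict_LipA[OF nB] hA(1) by (metis in_set_conv_nth)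
  then obtain v where v: "\<And>j. j < length hB \<Longrightarrow> v j < length hA"
    "\<And>j. j < length hB \<Longrightarrow> hA ! (v j) = restrict (hB ! j \<circ> f) PA" by metis
  have "\<forall>i. \<exists>j. i < length hA \<longrightarrow> j < length hB \<and> hB ! j = least_ext (hA ! i)"
    using least_ext_Lip[OF nA] hB(1) by (metis in_set_conv_nth)
  then obtain pos where pos: "\<And>i. i < length hA \<Longrightarrow> pos i < length hB"
    "\<And>i. i < length hA \<Longrightarrow> hB ! (pos i) = least_ext (hA ! i)" by metis
  have inv: "v (pos i) = i" if i: "i < length hA" for i
  proof -
    have "restrict (least_ext (hA ! i) \<circ> f) PA = hA ! i"
    proof
      fix x
      show "restrict (least_ext (hA ! i) \<circ> f) PA x = (hA ! i) x"
        using least_ext_extends[OF nA[OF i], of x] nA[OF i]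
        by (cases "x \<in> PA") (auto simp: lipschitz_functions_def PiE_def extensional_def)
    qed
    then have "hA ! (v (pos i)) = hA ! i" using v(2)[OF pos(1)[OF i]] pos(2)[OF i] by simp
    then show ?thesis using nth_eq_iff_index_eq[OF hA(3)] v(1)[OF pos(1)[OF i]] i by blast
  qed
  have mono: "pos i < pos j" if ij: "i < j" "j < length hA" for i j
  proof (rule ccontr)
    assume "\<not> pos i < pos j"
    have i: "i < length hA" using ij by simp
    have less: "peak_less PB RB (hB ! pos i) (hB ! pos j)"
      unfolding pos(2)[OF i] pos(2)[OF ij(2)]
      by (rule least_ext_peak_less[OF nA[OF i] nA[OF ij(2)] sorted_wrt_nth_less[OF hA(2) ij]])
    from \<open>\<not> pos i < pos j\<close> consider "pos i = pos j" | "pos j < pos i" by linarith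
    then show False
    proof cases
      case 1
      then show False using less B.peak_less_asym by auto
    next
      case 2
      then show False
        using less B.peak_less_asym sorted_wrt_nth_less[OF hB(2) 2 pos(1)[OF i]] by blast
    qed
  qed
  have first: "pos (v l) \<le> l" if l: "l < length hB" for l
  proof (rule ccontr)
    assume "\<not> pos (v l) \<le> l"
    then have "l < pos (v l)" by simp
    then have "peak_less PB RB (hB ! l) (hB ! pos (v l))"
      by (rule sorted_wrt_nth_less[OF hB(2) _ pos(1)[OF v(1)[OF l]]])
    then show False using least_ext_not_after[OF nB[OF l]] pos(2)[OF v(1)[OF l]] v(2)[OF l] by simp
  qed
  show thesis
  proof
    show "param_word 0 (length hA) (map v [0..<length hB])"
      by (rule param_word_from_first_positions[OF v(1) pos(1) inv mono first])
    show "length (map v [0..<length hB]) = length hB" by simp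
    show "(hB ! j) (f x) = (hA ! (map v [0..<length hB] ! j)) x" if "j < length hB" "x \<in> PA" for j x
      using v(2)[OF that(1)] that by simp
  qed
qed

end

section \<open>The coordinate embedding into a power\<close>

context lipschitz_space
begin

text \<open>
Distances are attained at the coordinate given by the distance from \<open>x\<close>. For the order, \<open>u\<close> being rigid, the
first coordinate in which the images of \<open>x\<close> and \<open>y\<close> are far apart belongs to the first function in the
list that separates them at this scale.
\<close>

lemma power_embedding:
  assumes h: "set hs = Lip" "sorted_wrt (peak_less P R) hs"
    and u: "param_word 0 (length hs) u" "length u = n"
    and xy: "x \<in> P" "y \<in> P"
  defines "\<Psi> \<equiv> (\<lambda>x. map (\<lambda>j. (hs ! j) x) u)"
  shows "\<Psi> x \<in> points (power_space n (alphabet_space \<Sigma>))"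
    and "mdist (power_space n (alphabet_space \<Sigma>)) (\<Psi> x) (\<Psi> y) = d x y"
    and "(x, y) \<in> R \<Longrightarrow> (\<Psi> x, \<Psi> y) \<in> ordering (power_space n (alphabet_space \<Sigma>))"
proof -
  have nth: "\<Psi> z ! i = (hs ! (u ! i)) z" if "i < n" for z i using that u(2) by (simp add: \<Psi>_def)
  have un: "u ! i < length hs" if "i < n" for i
    using param_word_letters[OF u(1)] that u(2) nth_mem by blast
  have L: "hs ! (u ! i) \<in> Lip" if "i < n" for i using un[OF that] h(1) nth_mem by blast
  have mem: "length (\<Psi> z) = n \<and> set (\<Psi> z) \<subseteq> \<Sigma>" if "z \<in> P" for z
  proof -
    have "(hs ! j) z \<in> \<Sigma>" if "j \<in> set u" for j
      using param_word_letters[OF u(1)] that h(1) nth_mem[of j hs] Lip_letter[OF _ \<open>z \<in> P\<close>] by blast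
    then show ?thesis using u(2) by (auto simp: \<Psi>_def)
  qed
  show "\<Psi> x \<in> points (power_space n (alphabet_space \<Sigma>))"
    using mem[OF xy(1)] by (simp add: power_space_def alphabet_space_def)
  have attained: "\<exists>i<n. diff_dist (\<Psi> x ! i) (\<Psi> y ! i) = d x y"
  proof -
    have "restrict (\<lambda>z. d x z) P \<in> set hs" using dist_from_Lip[OF xy(1)] h(1) by simp
    then obtain j where j: "j < length hs" "hs ! j = restrict (\<lambda>z. d x z) P" by (metis in_set_conv_nth)
    have "j \<in> set u" using param_word_all_letters[OF u(1)] j(1) by auto
    then obtain i where i: "i < n" "u ! i = j" using u(2) by (metis in_set_conv_nth)
    have "diff_dist (\<Psi> x ! i) (\<Psi> y ! i) = diff_dist 0 (d x y)"
      using xy dist_eq_0[of x x] by (simp add: nth[OF i(1)] i(2) j(2))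
    then show ?thesis using i(1) diff_dist_0[OF dist_scale[OF xy]] by auto
  qed
  have dist: "sup_dist n diff_dist (\<Psi> x) (\<Psi> y) = d x y"
  proof (rule antisym)
    show "sup_dist n diff_dist (\<Psi> x) (\<Psi> y) \<le> d x y"
      by (rule sup_dist_leI) (simp add: nth Lip_dist_le[OF L xy])
    show "d x y \<le> sup_dist n diff_dist (\<Psi> x) (\<Psi> y)"
      using attained sup_dist_ge[of _ n diff_dist "\<Psi> x" "\<Psi> y"] by metis
  qed
  then show "mdist (power_space n (alphabet_space \<Sigma>)) (\<Psi> x) (\<Psi> y) = d x y"
    by (simp add: power_space_def alphabet_space_def)
  show "(\<Psi> x, \<Psi> y) \<in> ordering (power_space n (alphabet_space \<Sigma>))" if R: "(x, y) \<in> R"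
  proof (cases "x = y")
    case True
    then show ?thesis using mem[OF xy(1)] by (simp add: power_space_def alphabet_space_def)
  next
    case False
    define far where "far i \<longleftrightarrow> i < n \<and> \<not> negligible (diff_dist (\<Psi> x ! i) (\<Psi> y ! i)) (d x y)" for i
    obtain i0 where "far i0" using attained unfolding far_def by (metis negligible_irrefl)
    define i where "i = (LEAST i. far i)"
    have i: "far i" unfolding i_def using \<open>far i0\<close> by (rule LeastI)
    then have i': "i < n" "\<not> negligible (diff_dist ((hs ! (u ! i)) x) ((hs ! (u ! i)) y)) (d x y)"
      using nth by (auto simp: far_def)
    have near: "negligible (diff_dist (\<Psi> x ! j) (\<Psi> y ! j)) (d x y)" if "j < i" for j
      using not_less_Least[of j far] that i'(1) by (auto simp: far_def i_def)
    have "(hs ! (u ! i)) x < (hs ! (u ! i)) y"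
    proof (rule first_far_coordinate_increasing[OF xy R False L[OF i'(1)] i'(2)])
      fix g assume g: "g \<in> Lip" "peak_less P R g (hs ! (u ! i))"
      obtain j where j: "j < length hs" "hs ! j = g" using g(1) h(1) by (metis in_set_conv_nth)
      have "j < u ! i"
      proof (rule ccontr)
        assume "\<not> j < u ! i"
        then consider "j = u ! i" | "u ! i < j" by linarith
        then show False
        proof cases
          case 1
          then show False using g(2) j(2) peak_less_asym by blast
        next
          case 2
          then show False using sorted_wrt_nth_less[OF h(2) 2 j(1)] g(2) j(2) peak_less_asym by blast
        qed
      qed
      then obtain l where l: "l < i" "u ! l = j"
        using param_word_earlier[OF u(1), of i j] i'(1) u(2) by auto
      then have "l < n" using i'(1) by simp
      then show "negligible (diff_dist (g x) (g y)) (d x y)"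
        using near[OF l(1)] nth l(2) j(2) by simp
    qed
    then have "\<Psi> x ! i < \<Psi> y ! i" using nth i'(1) by simp
    moreover have "\<Psi> x ! i \<in> \<Sigma>" "\<Psi> y ! i \<in> \<Sigma>" 
      using mem[OF xy(1)] mem[OF xy(2)] i'(1) nth_mem[of i "\<Psi> x"] nth_mem[of i "\<Psi> y"] by auto
    ultimately have "block_lex n diff_dist {(s, t). s \<in> \<Sigma> \<and> t \<in> \<Sigma> \<and> s \<le> t} (\<Psi> x) (\<Psi> y)"
      unfolding block_lex_def dist using i near
      by (intro exI[of _ i]) (auto simp: far_def)
    then show ?thesis using mem[OF xy(1)] mem[OF xy(2)] by (simp add: power_space_def alphabet_space_def)
  qed
qed

end

section \<open>Isomorphic copies\<close>

lemma isomorphicE: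
  assumes "isomorphic X Y"
  obtains f where "bij_betw f (points X) (points Y)"
    "\<And>x y. x \<in> points X \<Longrightarrow> y \<in> points X \<Longrightarrow> mdist Y (f x) (f y) = mdist X x y"
    "\<And>x y. x \<in> points X \<Longrightarrow> y \<in> points X \<Longrightarrow> (f x, f y) \<in> ordering Y \<longleftrightarrow> (x, y) \<in> ordering X"
proof -
  obtain f where f: "bij_betw f (points X) (points Y)" "\<forall>x\<in>points X. \<forall>y\<in>points X.
      mdist Y (f x) (f y) = mdist X x y \<and> ((f x, f y) \<in> ordering Y \<longleftrightarrow> (x, y) \<in> ordering X)"
    using assms unfolding isomorphic_def by blast
  show thesis by (rule that[of f]) (use f in simp_all)
qed

lemma isomorphic_sym:
  assumes "isomorphic X Y"
  shows "isomorphic Y X"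
  using assms
proof (rule isomorphicE)
  fix f assume f: "bij_betw f (points X) (points Y)"
    "\<And>x y. x \<in> points X \<Longrightarrow> y \<in> points X \<Longrightarrow> mdist Y (f x) (f y) = mdist X x y"
    "\<And>x y. x \<in> points X \<Longrightarrow> y \<in> points X \<Longrightarrow> (f x, f y) \<in> ordering Y \<longleftrightarrow> (x, y) \<in> ordering X"
  define g where "g = inv_into (points X) f"
  have g: "g y \<in> points X" "f (g y) = y" if "y \<in> points Y" for y
    using that f(1) by (auto simp: g_def bij_betw_inv_into_right bij_betw_apply[OF bij_betw_inv_into])
  show ?thesis
    unfolding isomorphic_def
  proof (intro exI[of _ g] conjI ballI)
    show "bij_betw g (points Y) (points X)" unfolding g_def by (rule bij_betw_inv_into[OF f(1)])
    fix x y assume xy: "x \<in> points Y" "y \<in> points Y"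
    show "mdist X (g x) (g y) = mdist Y x y"
      using f(2)[OF g(1)[OF xy(1)] g(1)[OF xy(2)]] g(2)[OF xy(1)] g(2)[OF xy(2)] by simp
    show "(g x, g y) \<in> ordering X \<longleftrightarrow> (x, y) \<in> ordering Y"
      using f(3)[OF g(1)[OF xy(1)] g(1)[OF xy(2)]] g(2)[OF xy(1)] g(2)[OF xy(2)] by simp
  qed
qed

lemma induced_induced:
  assumes "T \<subseteq> S"
  shows "induced (induced X S) T = induced X T"
  using assms by (auto simp: induced_def)

text \<open>
Used to rename the words of a power as elements of the given infinite type.
\<close>

definition transport ::
  "('a \<Rightarrow> 'b) \<Rightarrow> ('a, 'm) ordered_space \<Rightarrow> ('b, 'm) ordered_space" where
  "transport \<iota> X = \<lparr>points = \<iota> ` points X,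
     mdist = (\<lambda>a b. mdist X (inv_into (points X) \<iota> a) (inv_into (points X) \<iota> b)),
     ordering = {(\<iota> a, \<iota> b) | a b. (a, b) \<in> ordering X}\<rparr>"

lemma transport_props:
  assumes inj: "inj_on \<iota> (points X)" and sub: "ordering X \<subseteq> points X \<times> points X"
    and ab: "a \<in> points X" "b \<in> points X"
  shows "mdist (transport \<iota> X) (\<iota> a) (\<iota> b) = mdist X a b"
    and "(\<iota> a, \<iota> b) \<in> ordering (transport \<iota> X) \<longleftrightarrow> (a, b) \<in> ordering X"
proof -
  show "mdist (transport \<iota> X) (\<iota> a) (\<iota> b) = mdist X a b"
    using ab by (simp add: transport_def inv_into_f_f[OF inj])
  have "(a, b) \<in> ordering X" if ord: "(a', b') \<in> ordering X" "\<iota> a = \<iota> a'" "\<iota> b = \<iota> b'" for a' b'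
    using inj_onD[OF inj ord(2) ab(1)] inj_onD[OF inj ord(3) ab(2)] ord(1) sub by blast
  then show "(\<iota> a, \<iota> b) \<in> ordering (transport \<iota> X) \<longleftrightarrow> (a, b) \<in> ordering X"
    by (auto simp: transport_def)
qed

lemma convexly_ordered_transport:
  assumes inj: "inj_on \<iota> (points X)" and X: "convexly_ordered_metric_space X"
  shows "convexly_ordered_metric_space (transport \<iota> X)"
proof -
  interpret convex_metric "points X" "mdist X" "ordering X"
    using X by (simp add: convexly_ordered_metric_space_iff)
  have sub: "ordering X \<subseteq> points X \<times> points X"
    using linear by (simp add: order_on_defs)
  note tr = transport_props[OF inj sub]
  let ?Y = "transport \<iota> X"
  have pts: "points ?Y = \<iota> ` points X" by (simp add: transport_def)
  have "convex_metric (points ?Y) (mdist ?Y) (ordering ?Y)"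
  proof
    show "metric_on (points ?Y) (mdist ?Y)"
    proof -
      have "mdist ?Y (\<iota> x) (\<iota> y) = 0 \<longleftrightarrow> \<iota> x = \<iota> y" "mdist ?Y (\<iota> x) (\<iota> y) = mdist ?Y (\<iota> y) (\<iota> x)"
        "mdist ?Y (\<iota> x) (\<iota> z) \<le> mdist ?Y (\<iota> x) (\<iota> y) + mdist ?Y (\<iota> y) (\<iota> z)"
        if "x \<in> points X" "y \<in> points X" "z \<in> points X" for x y z
        using that dist_eq_0[of x y] dist_commute[of x y] triangle[of x y z] inj_on_eq_iff[OF inj, of x y]
        by (simp_all add: tr(1))
      then show ?thesis unfolding metric_on_def pts by blast
    qed
    show "linear_order_on (points ?Y) (ordering ?Y)"
      unfolding linear_order_on_def partial_order_on_def preorder_on_def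
    proof (intro conjI)
      show "ordering ?Y \<subseteq> points ?Y \<times> points ?Y" using sub by (auto simp: transport_def)
      show "refl_on (points ?Y) (ordering ?Y)" using order_refl by (auto simp: refl_on_def pts tr(2))
      show "trans (ordering ?Y)"
      proof (rule transI)
        fix u v w assume "(u, v) \<in> ordering ?Y" "(v, w) \<in> ordering ?Y"
        then obtain a b b' c where *: "u = \<iota> a" "v = \<iota> b" "v = \<iota> b'" "w = \<iota> c"
          "(a, b) \<in> ordering X" "(b', c) \<in> ordering X" by (auto simp: transport_def)
        have "b = b'" using inj_onD[OF inj, of b b'] * sub by auto
        then have "(a, c) \<in> ordering X" using *(5,6) order_trans by blast
        then show "(u, w) \<in> ordering ?Y" using *(1,4) by (auto simp: transport_def)
      qed
      show "antisym (ordering ?Y)"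
      proof (rule antisymI)
        fix u v assume uv: "(u, v) \<in> ordering ?Y" "(v, u) \<in> ordering ?Y"
        from uv(1) obtain a b where *: "u = \<iota> a" "v = \<iota> b" "(a, b) \<in> ordering X"
          by (auto simp: transport_def)
        have "a \<in> points X" "b \<in> points X" using *(3) sub by auto
        then have "(b, a) \<in> ordering X" using uv(2) tr(2)[of b a] by (simp add: *(1,2))
        then show "u = v" using *(3) order_antisym[of a b] by (simp add: *(1,2))
      qed
      show "total_on (points ?Y) (ordering ?Y)"
        unfolding total_on_def pts using order_total by (auto simp: tr(2))
    qed
    fix a b c assume "a \<in> points ?Y" "b \<in> points ?Y" "c \<in> points ?Y"
      and near: "negligible (mdist ?Y a b) (mdist ?Y a c)"
    then obtain x y z where "a = \<iota> x" "b = \<iota> y" "c = \<iota> z" "x \<in> points X" "y \<in> points X" "z \<in> points X"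
      unfolding pts by blast
    then show "(a, c) \<in> ordering ?Y \<longleftrightarrow> (b, c) \<in> ordering ?Y"
      using convex[of x y z] near by (simp add: tr)
  qed
  then show ?thesis by (simp add: convexly_ordered_metric_space_iff)
qed

lemma finite_points_power_space: "finite (points X) \<Longrightarrow> finite (points (power_space n X))"
  using finite_lists_length_eq[of "points X" n] by (simp add: power_space_def conj_commute)

lemma finite_inj_into_infinite:
  assumes "finite S"
  obtains \<iota> :: "'b \<Rightarrow> 'a::infinite" where "inj_on \<iota> S"
proof -
  obtain T :: "'a set" where "finite T" "card T = card S"
    using infinite_arbitrarily_large[OF infinite_UNIV] by blast
  then obtain \<iota> where "bij_betw \<iota> S T" using finite_same_card_bij[OF assms] by metis
  then show thesis using that bij_betw_imp_inj_on by blast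
qed

section \<open>The Ramsey property\<close>

theorem theorem1p6:
  shows "ramsey_class
    (finite_convexly_ordered_spaces :: ('a::infinite, 'm::distance_monoid) ordered_space set)"
  unfolding ramsey_class_def
proof (intro ballI allI impI)
  fix A B :: "('a, 'm) ordered_space" and k :: nat
  assume A: "A \<in> finite_convexly_ordered_spaces" and B: "B \<in> finite_convexly_ordered_spaces" and k: "0 < k"
  have finA: "finite (points A)" and finB: "finite (points B)"
    using A B by (auto simp: finite_convexly_ordered_spaces_def)
  interpret A: convex_metric "points A" "mdist A" "ordering A"
    using A by (simp add: finite_convexly_ordered_spaces_def convexly_ordered_metric_space_iff)
  interpret B: convex_metric "points B" "mdist B" "ordering B"
    using B by (simp add: finite_convexly_ordered_spaces_def convexly_ordered_metric_space_iff)
  \<comment> \<open>If \<open>A\<close> embeds in \<open>B\<close>, its distances belong to \<open>S\<close> as well; otherwise no copy of \<open>B\<close> contains a copy of \<open>A\<close>.\<close>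
  define S where "S = (\<lambda>(x, y). mdist B x y) ` (points B \<times> points B)"
  have finS: "finite S" using finB by (simp add: S_def)
  interpret W: well_ordered_submonoid "generated S" by (rule well_ordered_generated[OF finS])
  obtain \<Sigma> where \<Sigma>: "finite \<Sigma>" "insert 0 S \<subseteq> \<Sigma>" "\<Sigma> \<subseteq> generated S"
    "\<And>t e. t \<in> \<Sigma> \<Longrightarrow> e \<in> generated S \<Longrightarrow> W.residual t e \<in> \<Sigma>"
    by (rule W.finite_alphabet[OF finS]) (auto intro: generated_superset)
  interpret BL: lipschitz_space "generated S" "points B" "mdist B" "ordering B" \<Sigma>
    by standard (use \<Sigma> finB in \<open>auto simp: S_def\<close>)
  obtain hB where hB: "set hB = BL.Lip" "sorted_wrt (peak_less (points B) (ordering B)) hB"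
    using B.sorted_function_list[OF finB BL.finite_Lip] BL.Lip_extensional by blast
  define LA where "LA = lipschitz_functions \<Sigma> (points A) (mdist A)"
  have "finite LA"
    by (rule finite_subset[OF _ finite_PiE[OF finA, of "\<lambda>_. \<Sigma>"]])
      (auto simp: LA_def lipschitz_functions_def \<Sigma>(1))
  moreover have "LA \<subseteq> extensional (points A)" by (auto simp: LA_def lipschitz_functions_def PiE_def)
  ultimately obtain hA where hA: "set hA = LA" "sorted_wrt (peak_less (points A) (ordering A)) hA" "distinct hA"
    using A.sorted_function_list[OF finA] by blast
  obtain n where n: "\<And>c. (\<forall>w. c w < k) \<Longrightarrow> (\<exists>U col. param_word 0 (length hB) U \<and> length U = n \<and>
      (\<forall>v. param_word 0 (length hA) v \<longrightarrow> length v = length hB \<longrightarrow> c (map ((!) v) U) = col))"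
    using finite_dual_Ramsey[of k "length hB" "length hA"] by blast
  define X where "X = power_space n (W.alphabet_space \<Sigma>)"
  have X: "convexly_ordered_metric_space X" unfolding X_def
    by (intro convexly_ordered_power_space W.convexly_ordered_alphabet \<Sigma>(3))
  have finX: "finite (points X)" unfolding X_def
    by (rule finite_points_power_space) (simp add: W.alphabet_space_def \<Sigma>(1))
  obtain \<iota> :: "'m list \<Rightarrow> 'a" where \<iota>: "inj_on \<iota> (points X)" by (rule finite_inj_into_infinite[OF finX])
  define C where "C = transport \<iota> X"
  have ordX: "ordering X \<subseteq> points X \<times> points X" by (auto simp: X_def power_space_def)
  note tr = transport_props[OF \<iota> ordX, folded C_def]
  have ptsC: "points C = \<iota> ` points X" by (simp add: C_def transport_def)
  have C: "C \<in> finite_convexly_ordered_spaces"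
    using convexly_ordered_transport[OF \<iota> X] finX ptsC
    by (simp add: finite_convexly_ordered_spaces_def C_def)
  show "\<exists>C\<in>finite_convexly_ordered_spaces. \<forall>P::nat \<Rightarrow> ('a, 'm) ordered_space set.
          (\<Union>i<k. P i) = copies C A \<longrightarrow> disjoint_family_on P {..<k} \<longrightarrow>
          (\<exists>B'\<in>copies C B. \<exists>i<k. copies B' A \<subseteq> P i)"
  proof (intro bexI[OF _ C] allI impI)
    fix Q :: "nat \<Rightarrow> ('a, 'm) ordered_space set"
    assume Q: "(\<Union>i<k. Q i) = copies C A"
    define img where "img w = (\<lambda>x. \<iota> (map (\<lambda>j. (hA ! j) x) w)) ` points A" for w
    \<comment> \<open>The class of the copy of \<open>A\<close> that \<open>w\<close> describes; for words that describe no copy, any colour will do.\<close>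
    define col where "col w = (if \<exists>i<k. induced C (img w) \<in> Q i
      then LEAST i. i < k \<and> induced C (img w) \<in> Q i else 0)" for w
    have col: "col w < k \<and> induced C (img w) \<in> Q (col w)" if "\<exists>i<k. induced C (img w) \<in> Q i" for w
      using LeastI_ex[OF that] that by (simp add: col_def)
    then have "\<forall>w. col w < k" using k by (auto simp: col_def)
    from n[OF this] obtain u c where u: "param_word 0 (length hB) u" "length u = n"
      "\<And>v. param_word 0 (length hA) v \<Longrightarrow> length v = length hB \<Longrightarrow> col (map ((!) v) u) = c"
      by blast
    define \<Psi> where "\<Psi> x = map (\<lambda>j. (hB ! j) x) u" for x
    note emb = BL.power_embedding[OF hB u(1,2), folded X_def \<Psi>_def]
    interpret X: convex_metric "points X" "mdist X" "ordering X"
      using X by (simp add: convexly_ordered_metric_space_iff)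
    have ord: "(\<Psi> x, \<Psi> y) \<in> ordering X \<longleftrightarrow> (x, y) \<in> ordering B" if xy: "x \<in> points B" "y \<in> points B" for x y
    proof
      assume *: "(\<Psi> x, \<Psi> y) \<in> ordering X"
      show "(x, y) \<in> ordering B"
      proof (rule ccontr)
        assume no: "(x, y) \<notin> ordering B"
        then have yx: "(y, x) \<in> ordering B" using B.order_total xy by blast
        then have "\<Psi> x = \<Psi> y" using emb(3)[OF xy(2,1)] * X.order_antisym by blast
        then have "mdist B x y = 0"
          using emb(2)[OF xy] X.dist_eq_0[OF emb(1)[OF xy] emb(1)[OF xy(2,1)]] by simp
        then show False using B.dist_eq_0[OF xy] no yx by simp
      qed
    qed (rule emb(3)[OF xy])
    define T where "T = (\<lambda>x. \<iota> (\<Psi> x)) ` points B"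
    have TC: "T \<subseteq> points C" using emb(1) by (auto simp: T_def ptsC)
    have distT: "mdist C (\<iota> (\<Psi> x)) (\<iota> (\<Psi> y)) = mdist B x y"
      and ordT: "(\<iota> (\<Psi> x), \<iota> (\<Psi> y)) \<in> ordering C \<longleftrightarrow> (x, y) \<in> ordering B"
      if xy: "x \<in> points B" "y \<in> points B" for x y
      using tr[OF emb(1)[OF xy] emb(1)[OF xy(2,1)]] emb(2)[OF xy] ord[OF xy] by simp_all
    have inj: "inj_on (\<lambda>x. \<iota> (\<Psi> x)) (points B)"
    proof (rule inj_onI)
      fix x y assume xy: "x \<in> points B" "y \<in> points B" "\<iota> (\<Psi> x) = \<iota> (\<Psi> y)"
      then have "mdist B x y = mdist B x x" using distT[OF xy(1,2)] distT[OF xy(1,1)] by simp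
      then show "x = y" using B.dist_eq_0[OF xy(1,2)] B.dist_eq_0[OF xy(1,1)] by simp
    qed
    define B' where "B' = induced C T"
    have "isomorphic B B'"
      unfolding isomorphic_def
    proof (intro exI[of _ "\<lambda>x. \<iota> (\<Psi> x)"] conjI ballI)
      show "bij_betw (\<lambda>x. \<iota> (\<Psi> x)) (points B) (points B')"
        using inj by (simp add: bij_betw_def B'_def induced_def T_def)
      fix x y assume xy: "x \<in> points B" "y \<in> points B"
      show "mdist B' (\<iota> (\<Psi> x)) (\<iota> (\<Psi> y)) = mdist B x y" using distT[OF xy] by (simp add: B'_def induced_def)
      show "(\<iota> (\<Psi> x), \<iota> (\<Psi> y)) \<in> ordering B' \<longleftrightarrow> (x, y) \<in> ordering B"
        using ordT[OF xy] xy by (simp add: B'_def induced_def T_def)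
    qed
    then have B': "B' \<in> copies C B" using TC isomorphic_sym unfolding copies_def B'_def by blast
    have mono: "Z \<in> Q c \<and> c < k" if Z: "Z \<in> copies B' A" for Z
    proof -
      obtain V where V: "Z = induced B' V" "V \<subseteq> T" "isomorphic Z A"
        using Z by (auto simp: copies_def B'_def induced_def)
      have ZC: "Z = induced C V" using V(1,2) by (simp add: B'_def induced_induced)
      obtain g where g: "bij_betw g (points A) V"
        "\<And>x y. x \<in> points A \<Longrightarrow> y \<in> points A \<Longrightarrow> mdist C (g x) (g y) = mdist A x y"
        "\<And>x y. x \<in> points A \<Longrightarrow> y \<in> points A \<Longrightarrow> (g x, g y) \<in> ordering Z \<longleftrightarrow> (x, y) \<in> ordering A"
        by (rule isomorphicE[OF isomorphic_sym[OF V(3)]], rule that) (simp_all add: ZC induced_def)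
      have gV: "g x \<in> V" if "x \<in> points A" for x using g(1) that by (rule bij_betw_apply)
      have gord: "(g x, g y) \<in> ordering C \<longleftrightarrow> (x, y) \<in> ordering A" if "x \<in> points A" "y \<in> points A" for x y
        using g(3)[OF that] gV[OF that(1)] gV[OF that(2)] by (simp add: ZC induced_def)
      \<comment> \<open>The embedding of \<open>A\<close> in \<open>B\<close> that corresponds to the copy \<open>V\<close> of \<open>A\<close> inside \<open>T\<close>.\<close>
      define f where "f x = inv_into (points B) (\<lambda>x. \<iota> (\<Psi> x)) (g x)" for x
      have f: "f x \<in> points B" "\<iota> (\<Psi> (f x)) = g x" if "x \<in> points A" for x
      proof -
        have "g x \<in> (\<lambda>x. \<iota> (\<Psi> x)) ` points B" using gV[OF that] V(2) by (auto simp: T_def)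
        then show "f x \<in> points B" "\<iota> (\<Psi> (f x)) = g x"
          unfolding f_def by (rule inv_into_into, rule f_inv_into_f)
      qed
      interpret lipschitz_extension "generated S" "points B" "mdist B" "ordering B" \<Sigma>
        "points A" "mdist A" "ordering A" f
      proof
        show "finite (points A)" by (rule finA)
        show "f x \<in> points B" if "x \<in> points A" for x by (rule f(1)[OF that])
        show "mdist B (f x) (f y) = mdist A x y" if "x \<in> points A" "y \<in> points A" for x y
          using distT[OF f(1)[OF that(1)] f(1)[OF that(2)]] f(2) g(2) that by simp
        show "(f x, f y) \<in> ordering B \<longleftrightarrow> (x, y) \<in> ordering A" if "x \<in> points A" "y \<in> points A" for x y
          using ordT[OF f(1)[OF that(1)] f(1)[OF that(2)]] f(2) gord that by simp
      qed
      obtain v where v: "param_word 0 (length hA) v" "length v = length hB"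
        "\<And>j x. j < length hB \<Longrightarrow> x \<in> points A \<Longrightarrow> (hB ! j) (f x) = (hA ! (v ! j)) x"
        by (rule restriction_word[OF hB hA(1)[unfolded LA_def] hA(2,3)]) (rule that)
      have "\<Psi> (f x) = map (\<lambda>j. (hA ! j) x) (map ((!) v) u)" if "x \<in> points A" for x
        using v(3)[OF _ that] param_word_letters[OF u(1)] by (auto simp: \<Psi>_def)
      then have gx: "g x = \<iota> (map (\<lambda>j. (hA ! j) x) (map ((!) v) u))" if "x \<in> points A" for x
        using f(2)[OF that] that by simp
      have "g ` points A = img (map ((!) v) u)"
        unfolding img_def by (rule image_cong[OF refl gx])
      then have "V = img (map ((!) v) u)"
        using g(1) by (simp add: bij_betw_def)
      moreover have "Z \<in> copies C A" using ZC V(2,3) TC unfolding copies_def by blast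
      ultimately have "\<exists>i<k. induced C (img (map ((!) v) u)) \<in> Q i" using Q ZC by blast
      from col[OF this] show ?thesis using u(3)[OF v(1,2)] ZC \<open>V = img (map ((!) v) u)\<close> by simp
    qed
    show "\<exists>B'\<in>copies C B. \<exists>i<k. copies B' A \<subseteq> Q i"
    proof (rule bexI[OF _ B'], cases "copies B' A = {}")
      case True
      then show "\<exists>i<k. copies B' A \<subseteq> Q i" using k by auto
    next
      case False
      then show "\<exists>i<k. copies B' A \<subseteq> Q i" using mono by blast
    qed
  qed
qed

end
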